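(* Let $\Omega,\Omega_1,\Omega_2,\Gamma,S,b$, $V=H^1_0(\Omega)$, $H=L^2(\Omega)$, the operator $A:V\to V^*$ and the nonlinearity $f:H\to H$ be as described in the context; in particular $f$ is Lipschitz and there is a constant $K>0$ such that $(u,f(u))\le K$ and $\|f(u)\|_{H}\le K$ for all $u\in H$. Let $u_0\in H$. Then for any $T>0$ the problem $$\frac{du}{dt}+Au=f(u)\quad\text{as an equality in } L^2(0,T;V^* ),\qquad u(0)=u_0,$$ has a unique weak solution $u$ with $$u\in L^2(0,T;V),\qquad \frac{du}{dt}\in L^2(0,T;V^* ),$$ and $u\in C^0([0,T];H)$ (after possibly adjusting $u$ on a set of times of measure zero). Furthermore, for each $t\in[0,T]$ the map $u_0\mapsto u(t)$ belongs to $C^0(H;H)$, i.e. it is continuous from $H$ to $H$.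
   Context: Geometry: $N\ge 2$ is an integer, $\Omega\subset\mathbb{R}^N$ is an open domain with compact closure $\overline\Omega$ and boundary $S=\partial\Omega$. $\Gamma\subset\Omega$ is an $(N-1)$-dimensional surface dividing $\Omega$ into two open domains $\Omega_1,\Omega_2$, i.e. $\Gamma=\overline{\Omega}_1\cap\overline{\Omega}_2$, $\Omega=\Omega_1\cup\Omega_2\cup\Gamma$, with $\partial\Omega_1=\Gamma$ and $\partial\Omega_2=S\cup\Gamma$. Both $S$ and $\Gamma$ are of class $C^2$. Diffusion coefficient: $b:\overline{\Omega}_1\cup\Omega_2\to\mathbb{R}$ is given by $b(x)=b_1$ for $x\in\overline{\Omega}_1$ and $b(x)=b_2$ for $x\in\Omega_2$, where $b_1,b_2>0$ are constants. Spaces: $V=H^1_0(\Omega)$ with inner product $(u,v)_V=(u,v)_H+(\nabla u,\nabla v)_H$; $H=L^2(\Omega)$ with inner product $(\cdot,\cdot)$; $V^*$ is the dual of $V$, with duality pairing $\langle\cdot,\cdot\rangle$ between $V^*$ and $V$; $H$ is identified with its dual, so $V\subset H=H^*\subset V^*$. The time derivative $\frac{du}{dt}$ is the weak (distributional) derivative of a function of $t$ with values in $V^*$. Operator: $A:V\to V^*$ is the linear operator defined by $\langle Au,v\rangle=a(u,v)$ for all $u,v\in V$, where $a(u,v)=\int_\Omega b\,\nabla u\cdot\nabla v\,dx$. Nonlinearity: $f:L^2(\Omega)\to L^2(\Omega)$ is Lipschitz and there is a constant $K>0$ with $(u,f(u))\le K$ and $\|f(u)\|_{L^2(\Omega)}\le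 K$ for all $u\in L^2(\Omega)$. *)

theory Defs
  imports "HOL-Analysis.Analysis" "HOL-Library.Function_Algebras"
begin

text \<open>
  Elements of L2, H1 and of the dual spaces are represented by functions rather than by
  equivalence classes.  Accordingly a normed space is given by a carrier set X and a seminorm p
  on X, and two elements are identified when the seminorm of their difference vanishes.  The
  vector operations are pointwise.
\<close>

instantiation "fun" :: (type, scaleR) scaleR
begin

definition scaleR_fun :: "real \<Rightarrow> ('a \<Rightarrow> 'b) \<Rightarrow> 'a \<Rightarrow> 'b" where
  "scaleR_fun c f = (\<lambda>x. c *\<^sub>R f x)"

instance ..

end

instance "fun" :: (type, real_vector) real_vector
  by standard (simp_all add: scaleR_fun_def fun_eq_iff algebra_simps)


subsection \<open>Smooth functions and hypersurfaces\<close>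

text \<open>Intended for open U.\<close>

primrec Ck_on :: "nat \<Rightarrow> 'a::euclidean_space set \<Rightarrow> ('a \<Rightarrow> real) \<Rightarrow> bool" where
  "Ck_on 0 U f \<longleftrightarrow> continuous_on U f"
| "Ck_on (Suc k) U f \<longleftrightarrow>
     (\<forall>x\<in>U. f differentiable (at x)) \<and>
     (\<forall>i\<in>Basis. Ck_on k U (\<lambda>x. frechet_derivative f (at x) i))"

definition test_functions :: "'a::euclidean_space set \<Rightarrow> ('a \<Rightarrow> real) set" where
  "test_functions U =
     {\<phi>. (\<forall>k. Ck_on k UNIV \<phi>) \<and> compact (closure {x. \<phi> x \<noteq> 0}) \<and> closure {x. \<phi> x \<noteq> 0} \<subseteq> U}"

text \<open>An embedded surface of codimension one, given locally as a regular level set.\<close>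

definition C2_hypersurface :: "'a::euclidean_space set \<Rightarrow> bool" where
  "C2_hypersurface M \<longleftrightarrow>
     (\<forall>p\<in>M. \<exists>U \<psi>. open U \<and> p \<in> U \<and> Ck_on 2 U \<psi> \<and>
        (\<forall>x\<in>U. frechet_derivative \<psi> (at x) \<noteq> (\<lambda>h. 0)) \<and>
        M \<inter> U = {x\<in>U. \<psi> x = 0})"


subsection \<open>Lebesgue and Sobolev spaces\<close>

definition L2 :: "'a::euclidean_space set \<Rightarrow> ('a \<Rightarrow> real) set" where
  "L2 \<Omega> = {u. u \<in> borel_measurable (lebesgue_on \<Omega>) \<and> integrable (lebesgue_on \<Omega>) (\<lambda>x. (u x)\<^sup>2)}"

definition L2_inner :: "'a::euclidean_space set \<Rightarrow> ('a \<Rightarrow> real) \<Rightarrow> ('a \<Rightarrow> real) \<Rightarrow> real" where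
  "L2_inner \<Omega> u v = (\<integral>x. u x * v x \<partial>lebesgue_on \<Omega>)"

definition L2_norm :: "'a::euclidean_space set \<Rightarrow> ('a \<Rightarrow> real) \<Rightarrow> real" where
  "L2_norm \<Omega> u = sqrt (L2_inner \<Omega> u u)"

definition weak_gradient ::
  "(real^'n) set \<Rightarrow> (real^'n \<Rightarrow> real) \<Rightarrow> (real^'n \<Rightarrow> real^'n) \<Rightarrow> bool" where
  "weak_gradient \<Omega> u g \<longleftrightarrow>
     (\<forall>i. (\<lambda>x. g x $ i) \<in> L2 \<Omega>) \<and>
     (\<forall>\<phi>\<in>test_functions \<Omega>. \<forall>i.
        (\<integral>x. u x * frechet_derivative \<phi> (at x) (axis i 1) \<partial>lebesgue_on \<Omega>) =
        - (\<integral>x. g x $ i * \<phi> x \<partial>lebesgue_on \<Omega>))"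

definition H1 :: "(real^'n) set \<Rightarrow> (real^'n \<Rightarrow> real) set" where
  "H1 \<Omega> = {u \<in> L2 \<Omega>. \<exists>g. weak_gradient \<Omega> u g}"

text \<open>Determined by u up to a null set of \<open>\<Omega>\<close>.\<close>

definition wgrad :: "(real^'n) set \<Rightarrow> (real^'n \<Rightarrow> real) \<Rightarrow> real^'n \<Rightarrow> real^'n" where
  "wgrad \<Omega> u = (SOME g. weak_gradient \<Omega> u g)"

definition H1_inner :: "(real^'n) set \<Rightarrow> (real^'n \<Rightarrow> real) \<Rightarrow> (real^'n \<Rightarrow> real) \<Rightarrow> real" where
  "H1_inner \<Omega> u v = L2_inner \<Omega> u v + (\<integral>x. wgrad \<Omega> u x \<bullet> wgrad \<Omega> v x \<partial>lebesgue_on \<Omega>)"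

definition H1_norm :: "(real^'n) set \<Rightarrow> (real^'n \<Rightarrow> real) \<Rightarrow> real" where
  "H1_norm \<Omega> u = sqrt (H1_inner \<Omega> u u)"

definition H10 :: "(real^'n) set \<Rightarrow> (real^'n \<Rightarrow> real) set" where
  "H10 \<Omega> = {u \<in> H1 \<Omega>. \<forall>e>0. \<exists>\<phi>\<in>test_functions \<Omega>. H1_norm \<Omega> (u - \<phi>) < e}"


subsection \<open>Dual spaces\<close>

text \<open>The values of a functional outside X are irrelevant.\<close>

definition dual :: "'a::real_vector set \<Rightarrow> ('a \<Rightarrow> real) \<Rightarrow> ('a \<Rightarrow> real) set" where
  "dual X p =
     {\<Lambda>. (\<forall>u\<in>X. \<forall>v\<in>X. \<Lambda> (u + v) = \<Lambda> u + \<Lambda> v) \<and>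
         (\<forall>c. \<forall>u\<in>X. \<Lambda> (c *\<^sub>R u) = c * \<Lambda> u) \<and>
         (\<exists>C. \<forall>u\<in>X. \<bar>\<Lambda> u\<bar> \<le> C * p u)}"

definition dual_norm :: "'a::real_vector set \<Rightarrow> ('a \<Rightarrow> real) \<Rightarrow> ('a \<Rightarrow> real) \<Rightarrow> real" where
  "dual_norm X p \<Lambda> = Sup {\<bar>\<Lambda> v\<bar> | v. v \<in> X \<and> p v \<le> 1}"

abbreviation Vdual :: "(real^'n) set \<Rightarrow> ((real^'n \<Rightarrow> real) \<Rightarrow> real) set" where
  "Vdual \<Omega> \<equiv> dual (H10 \<Omega>) (H1_norm \<Omega>)"

abbreviation Vdual_norm :: "(real^'n) set \<Rightarrow> ((real^'n \<Rightarrow> real) \<Rightarrow> real) \<Rightarrow> real" where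
  "Vdual_norm \<Omega> \<equiv> dual_norm (H10 \<Omega>) (H1_norm \<Omega>)"

text \<open>The embedding of H into the dual of V obtained by identifying H with its own dual.\<close>

definition H_to_Vdual :: "(real^'n) set \<Rightarrow> (real^'n \<Rightarrow> real) \<Rightarrow> (real^'n \<Rightarrow> real) \<Rightarrow> real" where
  "H_to_Vdual \<Omega> u = (\<lambda>v. L2_inner \<Omega> u v)"

definition diffusion_operator ::
  "(real^'n) set \<Rightarrow> (real^'n \<Rightarrow> real) \<Rightarrow> (real^'n \<Rightarrow> real) \<Rightarrow> (real^'n \<Rightarrow> real) \<Rightarrow> real" where
  "diffusion_operator \<Omega> b u =
     (\<lambda>v. \<integral>x. b x * (wgrad \<Omega> u x \<bullet> wgrad \<Omega> v x) \<partial>lebesgue_on \<Omega>)"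


subsection \<open>Functions of time with values in a seminormed space\<close>

definition strongly_measurable ::
  "'t measure \<Rightarrow> 'a::real_vector set \<Rightarrow> ('a \<Rightarrow> real) \<Rightarrow> ('t \<Rightarrow> 'a) \<Rightarrow> bool" where
  "strongly_measurable M X p f \<longleftrightarrow>
     (\<exists>s. (\<forall>i::nat. simple_function M (s i) \<and> s i ` space M \<subseteq> X) \<and>
          (AE t in M. f t \<in> X \<and> (\<lambda>i. p (f t - s i t)) \<longlonglongrightarrow> 0))"

definition bochner_L2 ::
  "'t measure \<Rightarrow> 'a::real_vector set \<Rightarrow> ('a \<Rightarrow> real) \<Rightarrow> ('t \<Rightarrow> 'a) set" where
  "bochner_L2 M X p = {f. strongly_measurable M X p f \<and> integrable M (\<lambda>t. (p (f t))\<^sup>2)}"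

text \<open>The library notion \<^const>\<open>has_bochner_integral\<close>, for a carrier and a seminorm.\<close>

definition has_bochner_integral_in ::
  "'t measure \<Rightarrow> 'a::real_vector set \<Rightarrow> ('a \<Rightarrow> real) \<Rightarrow> ('t \<Rightarrow> 'a) \<Rightarrow> 'a \<Rightarrow> bool" where
  "has_bochner_integral_in M X p f I \<longleftrightarrow>
     strongly_measurable M X p f \<and> I \<in> X \<and>
     (\<exists>s. (\<forall>i::nat. simple_function M (s i) \<and> s i ` space M \<subseteq> X \<and>
               emeasure M {t \<in> space M. s i t \<noteq> 0} \<noteq> \<infinity>) \<and>
          (\<lambda>i. \<integral>\<^sup>+t. ennreal (p (f t - s i t)) \<partial>M) \<longlonglongrightarrow> 0 \<and>
          (\<lambda>i. p (Bochner_Integration.simple_bochner_integral M (s i) - I)) \<longlonglongrightarrow> 0)"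

abbreviation time_measure :: "real \<Rightarrow> real measure" where
  "time_measure T \<equiv> lebesgue_on {0<..<T}"

definition weak_time_derivative ::
  "real \<Rightarrow> 'a::real_vector set \<Rightarrow> ('a \<Rightarrow> real) \<Rightarrow> (real \<Rightarrow> 'a) \<Rightarrow> (real \<Rightarrow> 'a) \<Rightarrow> bool" where
  "weak_time_derivative T X p g w \<longleftrightarrow>
     (\<forall>\<phi>\<in>test_functions {0<..<T}. \<exists>I.
        has_bochner_integral_in (time_measure T) X p (\<lambda>t. deriv \<phi> t *\<^sub>R g t) I \<and>
        has_bochner_integral_in (time_measure T) X p (\<lambda>t. \<phi> t *\<^sub>R w t) (- I))"

definition continuous_into ::
  "real \<Rightarrow> 'a::real_vector set \<Rightarrow> ('a \<Rightarrow> real) \<Rightarrow> (real \<Rightarrow> 'a) set" where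
  "continuous_into T X p =
     {u. \<forall>t\<in>{0..T}. u t \<in> X \<and> ((\<lambda>s. p (u s - u t)) \<longlongrightarrow> 0) (at t within {0..T})}"


subsection \<open>Weak solutions\<close>

definition equal_ae ::
  "'a::euclidean_space set \<Rightarrow> ('a \<Rightarrow> real) \<Rightarrow> ('a \<Rightarrow> real) \<Rightarrow> bool" where
  "equal_ae \<Omega> u v \<longleftrightarrow> (AE x in lebesgue_on \<Omega>. u x = v x)"

text \<open>
  A solution is only determined for almost every time, so its value at time 0 is the value of a
  representative that is continuous with values in H.  The function w below is du/dt.
\<close>

definition weak_solution ::
  "(real^'n) set \<Rightarrow> (real^'n \<Rightarrow> real) \<Rightarrow> ((real^'n \<Rightarrow> real) \<Rightarrow> real^'n \<Rightarrow> real) \<Rightarrow>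
   real \<Rightarrow> (real^'n \<Rightarrow> real) \<Rightarrow> (real \<Rightarrow> real^'n \<Rightarrow> real) \<Rightarrow> bool" where
  "weak_solution \<Omega> b f T u0 u \<longleftrightarrow>
     u \<in> bochner_L2 (time_measure T) (H10 \<Omega>) (H1_norm \<Omega>) \<and>
     (\<exists>w \<in> bochner_L2 (time_measure T) (Vdual \<Omega>) (Vdual_norm \<Omega>).
        weak_time_derivative T (Vdual \<Omega>) (Vdual_norm \<Omega>) (\<lambda>t. H_to_Vdual \<Omega> (u t)) w \<and>
        (AE t in time_measure T. \<forall>v\<in>H10 \<Omega>.
           (w t + diffusion_operator \<Omega> b (u t)) v = H_to_Vdual \<Omega> (f (u t)) v)) \<and>
     (\<exists>u' \<in> continuous_into T (L2 \<Omega>) (L2_norm \<Omega>).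
        (AE t in time_measure T. equal_ae \<Omega> (u t) (u' t)) \<and> equal_ae \<Omega> (u' 0) u0)"

end

theory Submission
  imports Defs
begin

text \<open>
  Mapping u to the pair of u and \<open>sqrt b\<close> times its gradient embeds V as a closed subspace W of
  a product of L2 spaces, on which the diffusion form is an inner product.  Orthogonal projection
  onto W provides the resolvents of A and hence its Yosida approximations, which are bounded and
  turn the equation into an ordinary differential equation with Lipschitz right-hand side.  As A is
  symmetric, testing with the approximation of Au bounds it in L2 in time whenever the initial value
  lies in V.  This makes the approximate solutions Cauchy in C(0,T;H) and their graphs Cauchy
  in L2(0,T;W); since V is dense in H, a diagonal sequence treats arbitrary initial values, and
  its limit is a weak solution.

  For uniqueness and continuous dependence, apply a resolvent to the difference of two weak
  solutions.  Tested with elements of the range of the resolvent, the equation involves only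
  functions that are continuous in time with values in H, so the result is classically
  differentiable.  The energy estimate is then elementary, and the resolvent parameter
  tends to zero in it.
\<close>

subsection \<open>Smooth bumps and the fundamental lemma of the calculus of variations\<close>

text \<open>Functions stand for classes, gradients are arbitrary choices and Bochner integrals live
  in seminormed carriers, so no Hilbert space is at hand as a type. The analysis is therefore moved
  to a type of square-integrable classes on the whole space, which \<open>\<Omega>\<close> enters by
  extension by zero. Functionals on V are represented by vectors paired with graphs, and L2
  functions of time by limits of continuous ones. The uniform bound \<open>K\<close> makes the
  energy estimate independent of the resolvent parameter: it contributes
  \<open>K\<^sup>2 * T\<close>, and the squared discrepancy between two parameters is a multiple of
  the larger one times the energy. Energies may blow up while initial values in V approach one in H,
  so the diagonal sequence couples the parameter to the energy. Since f is Lipschitz, differences of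
  approximations are estimated directly and all convergence is strong. For a derivative that exists
  only in the dual of V, the identity d/dt |u|^2 = 2 <u', u> would call for a regularisation in
  time. Smoothing in space by resolvents avoids it, as it commutes with the symmetric operator and
  has a sign in the energy estimate.\<close>

lemma Ck_on_SucD: "Ck_on (Suc k) U f \<Longrightarrow> Ck_on k U f"
proof (induction k arbitrary: f)
  case 0
  then show ?case
    by (auto intro!: continuous_at_imp_continuous_on differentiable_imp_continuous_within)
qed auto

lemma Ck_on_const: "Ck_on k U (\<lambda>x. c)"
  by (induction k arbitrary: c) auto

text \<open>Derivatives at a point of an open set depend only on nearby values, so the partial
  derivatives of \<open>f\<close> and \<open>g\<close> agree on \<open>U\<close> and the induction
  continues.\<close>

lemma Ck_on_cong_open:
  assumes "open U" and "\<And>x. x \<in> U \<Longrightarrow> f x = g x" and "Ck_on k U f"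
  shows "Ck_on k U g"
  using assms(2,3)
proof (induction k arbitrary: f g)
  case 0
  then show ?case by (auto cong: continuous_on_cong)
next
  case (Suc k)
  have der: "(g has_derivative frechet_derivative f (at x)) (at x)" if "x \<in> U" for x
    using Suc.prems that assms(1) frechet_derivative_works
    by (metis Ck_on.simps(2) has_derivative_transform_within_open)
  then have "frechet_derivative g (at x) = frechet_derivative f (at x)" if "x \<in> U" for x
    using that frechet_derivative_at by metis
  moreover have "g differentiable (at x)" if "x \<in> U" for x
    using der[OF that] by (rule differentiableI)
  ultimately show ?case using Suc
    by (auto intro!: Suc.IH[of "\<lambda>x. frechet_derivative f (at x) _"])
qed

lemma Ck_on_add:
  assumes "open U" "Ck_on k U f" "Ck_on k U g"
  shows "Ck_on k U (\<lambda>x. f x + g x)"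
  using assms(2,3)
proof (induction k arbitrary: f g)
  case 0
  then show ?case by (auto intro: continuous_intros)
next
  case (Suc k)
  have der: "frechet_derivative (\<lambda>x. f x + g x) (at x) =
      (\<lambda>h. frechet_derivative f (at x) h + frechet_derivative g (at x) h)" if "x \<in> U" for x
    using Suc.prems that
    by (intro frechet_derivative_at[symmetric] has_derivative_add) (auto simp: frechet_derivative_works[symmetric])
  have *: "Ck_on k U (\<lambda>x. frechet_derivative f (at x) i + frechet_derivative g (at x) i)"
    if "i \<in> Basis" for i
    using Suc.prems that by (intro Suc.IH) auto
  have "Ck_on k U (\<lambda>x. frechet_derivative (\<lambda>x. f x + g x) (at x) i)" if "i \<in> Basis" for i
    by (rule Ck_on_cong_open[OF assms(1), rotated, of _ "\<lambda>x. frechet_derivative f (at x) i + frechet_derivative g (at x) i"]) (use der * that in simp_all)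
  with Suc.prems show ?case by (auto intro: differentiable_add)
qed

lemma Ck_on_mult:
  assumes "open U" "Ck_on k U f" "Ck_on k U g"
  shows "Ck_on k U (\<lambda>x. f x * g x)"
  using assms(2,3)
proof (induction k arbitrary: f g)
  case 0
  then show ?case by (auto intro: continuous_intros)
next
  case (Suc k)
  have der: "frechet_derivative (\<lambda>x. f x * g x) (at x) =
      (\<lambda>h. f x * frechet_derivative g (at x) h + frechet_derivative f (at x) h * g x)" if "x \<in> U" for x
    using Suc.prems that
    by (intro frechet_derivative_at[symmetric] has_derivative_mult) (auto simp: frechet_derivative_works[symmetric])
  have *: "Ck_on k U (\<lambda>x. f x * frechet_derivative g (at x) i + frechet_derivative f (at x) i * g x)"
    if "i \<in> Basis" for i
  proof (intro Ck_on_add[OF assms(1)] Suc.IH)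
    show "Ck_on k U f" "Ck_on k U g"
      using Suc.prems Ck_on_SucD by blast+
  qed (use Suc.prems that in auto)
  have "Ck_on k U (\<lambda>x. frechet_derivative (\<lambda>x. f x * g x) (at x) i)" if "i \<in> Basis" for i
    by (rule Ck_on_cong_open[OF assms(1), rotated, of _ "\<lambda>x. f x * frechet_derivative g (at x) i + frechet_derivative f (at x) i * g x"]) (use that der * in simp_all)
  with Suc.prems show ?case by (auto intro: differentiable_mult)
qed

lemma Ck_on_prod:
  assumes "open U" "\<And>i. i \<in> I \<Longrightarrow> Ck_on k U (f i)"
  shows "Ck_on k U (\<lambda>x. \<Prod>i\<in>I. f i x)"
  using assms(2)
  by (induction I rule: infinite_finite_induct) (auto intro!: Ck_on_const Ck_on_mult[OF assms(1)])

lemma Ck_on_real_Suc: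
  fixes f :: "real \<Rightarrow> real"
  assumes "\<And>x. x \<in> U \<Longrightarrow> (f has_real_derivative f' x) (at x)" "open U" "Ck_on k U f'"
  shows "Ck_on (Suc k) U f"
proof -
  have *: "frechet_derivative f (at x) = (\<lambda>h. f' x * h)" if "x \<in> U" for x
    using assms(1)[OF that] by (metis frechet_derivative_at has_field_derivative_def)
  have "f differentiable (at x)" if "x \<in> U" for x
    using assms(1)[OF that] by (metis differentiableI has_field_derivative_def)
  moreover have "Ck_on k U (\<lambda>x. frechet_derivative f (at x) 1)"
    by (rule Ck_on_cong_open[OF assms(2) _ assms(3)]) (simp add: *)
  ultimately show ?thesis by simp
qed

text \<open>\<open>G\<close> lists a function with its successive derivatives. A directional
  derivative of the composite is a constant times the composite with the next member of the list, so
  induction on \<open>k\<close> closes once \<open>j\<close> is arbitrary.\<close>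

lemma Ck_on_compose_inner:
  fixes G :: "nat \<Rightarrow> real \<Rightarrow> real" and v :: "'a::euclidean_space"
  assumes "\<And>j t. (G j has_real_derivative G (Suc j) t) (at t)"
  shows "Ck_on k UNIV (\<lambda>x. G j (x \<bullet> v + d))"
proof (induction k arbitrary: j)
  case 0
  have "continuous_on UNIV (G j)" for j
    using assms by (meson DERIV_isCont continuous_at_imp_continuous_on)
  then have "continuous_on UNIV (\<lambda>x. G j (x \<bullet> v + d))"
    by (rule continuous_on_compose2) (intro continuous_intros, simp)
  then show ?case by simp
next
  case (Suc k)
  have der: "((\<lambda>x. G j (x \<bullet> v + d)) has_derivative (\<lambda>h. G (Suc j) (x \<bullet> v + d) * (h \<bullet> v))) (at x)" for x
  proof -
    have "((\<lambda>x. x \<bullet> v + d) has_derivative (\<lambda>h. h \<bullet> v)) (at x)"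
      by (auto intro!: derivative_eq_intros)
    from has_derivative_compose[OF this assms[unfolded has_field_derivative_def, of j]]
    show ?thesis .
  qed
  have "frechet_derivative (\<lambda>x. G j (x \<bullet> v + d)) (at x) = (\<lambda>h. G (Suc j) (x \<bullet> v + d) * (h \<bullet> v))" for x
    using der frechet_derivative_at by metis
  moreover have "Ck_on k UNIV (\<lambda>x. G (Suc j) (x \<bullet> v + d) * (i \<bullet> v))" for i
    by (intro Ck_on_mult Suc.IH Ck_on_const) auto
  ultimately show ?case
    using der by (auto simp: differentiable_def)
qed

text \<open>The functions \<open>p(1/t) exp(-c/t)\<close>, extended by zero, are closed under differentiation.\<close>

definition flat :: "real \<Rightarrow> real poly \<Rightarrow> real \<Rightarrow> real" where
  "flat c p t = (if t > 0 then poly p (1 / t) * exp (- (c / t)) else 0)"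

text \<open>Describes \<open>flat c p\<close> near 0 in the variable y = 1/t; by linearity monomials
  suffice.\<close>

lemma poly_exp_tendsto_0:
  assumes "c > 0"
  shows "((\<lambda>y. poly p y * exp (- (c * y))) \<longlongrightarrow> (0::real)) at_top"
proof -
  have "((\<lambda>y. (y ^ k) * exp (- (c * y))) \<longlongrightarrow> 0) at_top" for k
  proof -
    have "((\<lambda>y. (c * y) ^ k / exp (c * y)) \<longlongrightarrow> 0) at_top"
      using assms by (intro filterlim_compose[OF tendsto_power_div_exp_0])
        (auto intro!: filterlim_tendsto_pos_mult_at_top filterlim_ident tendsto_const)
    then have "((\<lambda>y. inverse (c ^ k) * ((c * y) ^ k / exp (c * y))) \<longlongrightarrow> 0) at_top"
      by (rule tendsto_mult_right_zero)
    then show ?thesis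
      using assms by (simp add: power_mult_distrib exp_minus field_simps)
  qed
  then have "((\<lambda>y. \<Sum>k\<le>degree p. coeff p k * (y ^ k * exp (- (c * y)))) \<longlongrightarrow> 0) at_top"
    by (intro tendsto_null_sum tendsto_mult_right_zero)
  then show ?thesis by (simp add: poly_altdef sum_distrib_right mult.assoc)
qed

text \<open>With s = 1/t one has ds/dt = -s^2, so p(s) exp(-c s) differentiates to s^2 (c p(s) -
  p'(s)) exp(-c s), and \<open>[:0, 0, 1:]\<close> is the factor s^2. At t = 0 the right difference
  quotient is of the same kind with polynomial s p(s), and tends to 0.\<close>

lemma flat_derivative:
  assumes "c > 0"
  shows "(flat c p has_real_derivative flat c ([:0, 0, 1:] * (smult c p - pderiv p)) t) (at t)"
proof -
  consider "t < 0" | "t > 0" | "t = 0" by linarith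
  then show ?thesis
  proof cases
    case 1
    have "((\<lambda>_. 0) has_real_derivative 0) (at t)" by simp
    then have "(flat c p has_real_derivative 0) (at t)"
      by (rule DERIV_cong_ev[THEN iffD1, rotated -1, OF _ refl _ refl])
        (use 1 in \<open>auto simp: flat_def eventually_nhds intro!: exI[of _ "{..<0}"]\<close>)
    with 1 show ?thesis by (simp add: flat_def)
  next
    case 2
    have "((\<lambda>t. poly p (1 / t) * exp (- (c / t))) has_real_derivative
        flat c ([:0, 0, 1:] * (smult c p - pderiv p)) t) (at t)"
      using 2 by (auto intro!: derivative_eq_intros simp: flat_def field_simps power2_eq_square)
    then show ?thesis
      by (rule DERIV_cong_ev[THEN iffD1, rotated -1, OF _ refl _ refl])
        (use 2 in \<open>auto simp: flat_def eventually_nhds intro!: exI[of _ "{0<..}"]\<close>)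
  next
    case 3
    have right: "((\<lambda>t. flat c p t / t) \<longlongrightarrow> 0) (at_right 0)"
    proof -
      have "((\<lambda>t. poly (pCons 0 p) (inverse t) * exp (- (c * inverse t))) \<longlongrightarrow> 0) (at_right 0)"
        by (rule filterlim_compose[OF poly_exp_tendsto_0[OF assms] filterlim_inverse_at_top_right])
      then show ?thesis
        by (rule Lim_transform_eventually)
          (auto simp: eventually_at_filter flat_def field_simps)
    qed
    have left: "((\<lambda>t. flat c p t / t) \<longlongrightarrow> 0) (at_left 0)"
      by (rule tendsto_eventually) (auto simp: eventually_at_filter flat_def)
    have "((\<lambda>t. flat c p t / t) \<longlongrightarrow> 0) (at 0)"
      using left right by (simp add: filterlim_split_at)
    then show ?thesis using 3
      by (simp add: DERIV_def flat_def)
  qed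
qed

lemma flat_chain:
  assumes "c > 0"
  shows "\<exists>G. G 0 = flat c p \<and> (\<forall>j t. (G j has_real_derivative G (Suc j) t) (at t))"
proof -
  define P where "P = (\<lambda>n. ((\<lambda>p. [:0, 0, 1:] * (smult c p - pderiv p)) ^^ n) p)"
  show ?thesis
    using flat_derivative[OF assms, of "P j" for j]
    by (intro exI[of _ "\<lambda>j. flat c (P j)"]) (auto simp: P_def)
qed

text \<open>Positive exactly on the open box. Increasing \<open>m\<close> shrinks the constant c in
  exp(-c/t), so that the bumps converge pointwise to the indicator of the box.\<close>

definition bump :: "'a::euclidean_space \<Rightarrow> 'a \<Rightarrow> nat \<Rightarrow> 'a \<Rightarrow> real" where
  "bump a b m x = (\<Prod>i\<in>Basis. flat (1 / real (Suc m)) 1 (x \<bullet> i - a \<bullet> i) * flat (1 / real (Suc m)) 1 (b \<bullet> i - x \<bullet> i))"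

lemma Ck_on_flat_inner:
  assumes "c > 0"
  shows "Ck_on k UNIV (\<lambda>x::'a::euclidean_space. flat c p (x \<bullet> v + d))"
proof -
  obtain G where "G 0 = flat c p" "\<And>j t. (G j has_real_derivative G (Suc j) t) (at t)"
    using flat_chain[OF assms] by blast
  then show ?thesis using Ck_on_compose_inner[of G k 0 v d] by simp
qed

lemma Ck_on_bump: "Ck_on k UNIV (bump a b m)"
proof -
  have "Ck_on k UNIV (\<lambda>x. flat (1 / real (Suc m)) 1 (x \<bullet> i - a \<bullet> i))"
       "Ck_on k UNIV (\<lambda>x. flat (1 / real (Suc m)) 1 (b \<bullet> i - x \<bullet> i))" for i :: 'a
    using Ck_on_flat_inner[of "1 / real (Suc m)" k 1 i "- (a \<bullet> i)"]
      Ck_on_flat_inner[of "1 / real (Suc m)" k 1 "- i" "b \<bullet> i"]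
    by (simp_all add: algebra_simps)
  then show ?thesis
    unfolding bump_def[abs_def]
    by (intro Ck_on_prod Ck_on_mult) auto
qed

lemma flat_nonneg: "0 \<le> flat c 1 t" and flat_le_1: "c > 0 \<Longrightarrow> flat c 1 t \<le> 1"
  by (auto simp: flat_def)

lemma bump_nonneg: "0 \<le> bump a b m x"
  unfolding bump_def by (intro prod_nonneg ballI mult_nonneg_nonneg flat_nonneg)

lemma bump_le_1: "bump a b m x \<le> 1"
  unfolding bump_def
  by (intro prod_le_1 conjI mult_nonneg_nonneg flat_nonneg mult_le_one flat_le_1) auto

lemma bump_pos_iff: "0 < bump a b m x \<longleftrightarrow> x \<in> box a b"
proof -
  have *: "flat c 1 t > 0 \<longleftrightarrow> t > 0" "flat c 1 t = 0 \<longleftrightarrow> t \<le> 0" for c t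
    by (auto simp: flat_def)
  show ?thesis
  proof
    assume "0 < bump a b m x"
    then have "bump a b m x \<noteq> 0" by simp
    then show "x \<in> box a b" by (auto simp: bump_def mem_box *)
  next
    assume "x \<in> box a b"
    then show "0 < bump a b m x"
      unfolding bump_def by (intro prod_pos ballI mult_pos_pos) (auto simp: * mem_box)
  qed
qed

lemma bump_eq_0_iff: "bump a b m x = 0 \<longleftrightarrow> x \<notin> box a b"
  using bump_pos_iff[of a b m x] bump_nonneg[of a b m x] by linarith

lemma bump_tendsto: "(\<lambda>m. bump a b m x) \<longlonglongrightarrow> indicator (box a b) x"
proof (cases "x \<in> box a b")
  case True
  have *: "(\<lambda>m. flat (1 / real (Suc m)) 1 t) \<longlonglongrightarrow> 1" if "t > 0" for t
  proof -
    have "(\<lambda>m. exp (- ((1 / real (Suc m)) / t))) \<longlonglongrightarrow> exp (- (0 / t))"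
      using that by (intro tendsto_intros lim_1_over_n[THEN LIMSEQ_Suc]) auto
    then show ?thesis using that by (simp add: flat_def)
  qed
  have "(\<lambda>m. bump a b m x) \<longlonglongrightarrow> (\<Prod>i::'a\<in>Basis. 1 * 1)"
    unfolding bump_def using True by (intro tendsto_prod tendsto_mult *) (auto simp: mem_box)
  with True show ?thesis by simp
next
  case False
  then show ?thesis using bump_eq_0_iff[of a b _ x] by simp
qed

lemma bump_test_function:
  assumes "cbox a b \<subseteq> U"
  shows "bump a b m \<in> test_functions U"
proof -
  have "closure {x. bump a b m x \<noteq> 0} \<subseteq> cbox a b"
    by (rule closure_minimal) (auto simp: bump_eq_0_iff box_subset_cbox[THEN subsetD])
  moreover have "compact (closure {x. bump a b m x \<noteq> 0})"
    unfolding compact_closure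
    by (rule bounded_subset[OF bounded_box[of a b]]) (auto simp: bump_eq_0_iff)
  ultimately show ?thesis
    using assms by (auto simp: test_functions_def Ck_on_bump)
qed

lemma continuous_bump: "continuous_on S (bump a b m)"
  using Ck_on_bump[of 0 a b m] continuous_on_subset by auto

text \<open>Testing with bumps gives vanishing integrals over all boxes; Lebesgue's differentiation
  theorem then recovers the function almost everywhere.\<close>

lemma AE_zero_if_orthogonal_on_cbox:
  fixes g :: "'a::euclidean_space \<Rightarrow> real"
  assumes int: "integrable (lebesgue_on (cbox c d)) g"
    and orth: "\<And>a b m. cbox a b \<subseteq> cbox c d \<Longrightarrow> (\<integral>x. g x * bump a b m x \<partial>lebesgue) = 0"
  shows "AE x in lebesgue. x \<in> box c d \<longrightarrow> g x = 0"
proof -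
  define G where "G = (\<lambda>x. if x \<in> cbox c d then g x else 0)"
  have intG: "integrable lebesgue G"
    using int unfolding G_def by (subst Lebesgue_Measure.integrable_restrict_UNIV) auto
  have zero: "integral (cbox a b) G = 0" if "cbox a b \<subseteq> cbox c d" for a b
  proof -
    have "(\<lambda>m. \<integral>x. G x * bump a b m x \<partial>lebesgue) \<longlonglongrightarrow> (\<integral>x. G x * indicator (box a b) x \<partial>lebesgue)"
    proof (rule integral_dominated_convergence[where w="\<lambda>x. norm (G x)"])
      have "bump a b m \<in> borel_measurable lebesgue" for m
        using continuous_imp_measurable_on_sets_lebesgue[OF continuous_bump, of UNIV] by (auto simp: lebesgue_on_UNIV_eq)
      then show "(\<lambda>x. G x * bump a b m x) \<in> borel_measurable lebesgue" for m
        using intG by (intro borel_measurable_times) auto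
      show "(\<lambda>x. G x * indicat_real (box a b) x) \<in> borel_measurable lebesgue"
        using intG by (intro borel_measurable_times borel_measurable_indicator) auto
      show "AE x in lebesgue. (\<lambda>m. G x * bump a b m x) \<longlonglongrightarrow> G x * indicat_real (box a b) x"
        by (intro AE_I2 tendsto_mult_left bump_tendsto)
      show "AE x in lebesgue. norm (G x * bump a b m x) \<le> norm (G x)" for m
        using bump_nonneg[of a b m] bump_le_1[of a b m]
        by (auto simp: abs_mult intro!: mult_left_le)
    qed (use intG in auto)
    moreover have "(\<integral>x. G x * bump a b m x \<partial>lebesgue) = 0" for m
    proof -
      have "G x * bump a b m x = g x * bump a b m x" for x
        using that bump_eq_0_iff[of a b m x] box_subset_cbox[of a b] by (auto simp: G_def)
      then show ?thesis using orth[OF that, of m] by (simp only:)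
    qed
    ultimately have "(\<integral>x. G x * indicator (box a b) x \<partial>lebesgue) = 0"
      using LIMSEQ_const_iff[of 0] by fastforce
    moreover have "(\<integral>x. G x * indicator (box a b) x \<partial>lebesgue) = integral (box a b) G"
    proof -
      have "set_integrable lebesgue (box a b) G"
        unfolding set_integrable_def by (rule integrable_mult_indicator[OF _ intG]) simp
      from set_lebesgue_integral_eq_integral(2)[OF this] show ?thesis
        by (simp add: set_lebesgue_integral_def mult.commute)
    qed
    ultimately show ?thesis by (simp add: integral_open_interval)
  qed
  have "G integrable_on cbox a b" for a b
    using intG integrable_on_lebesgue by (metis integrable_on_subcbox top_greatest)
  from integrable_ccontinuous_explicit[of G, OF this] obtain N where N: "negligible N"
    "\<And>x e. x \<notin> N \<Longrightarrow> 0 < e \<Longrightarrow> \<exists>d>0. \<forall>h. 0 < h \<and> h < d \<longrightarrow>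
       norm (integral (cbox x (x + h *\<^sub>R One)) G /\<^sub>R h ^ DIM('a) - G x) < e"
    by metis
  have "g x = 0" if x: "x \<in> box c d" "x \<notin> N" for x
  proof (rule ccontr)
    assume "g x \<noteq> 0"
    then have "norm (G x) > 0" using x box_subset_cbox[of c d] by (auto simp: G_def)
    from N(2)[OF x(2) this] obtain e where e: "e > 0"
      "\<And>h. 0 < h \<Longrightarrow> h < e \<Longrightarrow> norm (integral (cbox x (x + h *\<^sub>R One)) G /\<^sub>R h ^ DIM('a) - G x) < norm (G x)"
      by blast
    have "\<forall>\<^sub>F h in at_right 0. h < e" using e(1) by (auto simp: eventually_at_right_field)
    moreover have "\<forall>\<^sub>F h in at_right 0. (0::real) < h" by (simp add: eventually_at_right_less)
    moreover have "\<forall>\<^sub>F h in at_right 0. x + h *\<^sub>R One \<in> box c d"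
    proof -
      have "((\<lambda>h. x + h *\<^sub>R One) \<longlongrightarrow> x + 0 *\<^sub>R One) (at_right 0)" by (intro tendsto_intros)
      then show ?thesis using x(1) open_box topological_tendstoD by fastforce
    qed
    ultimately have "\<forall>\<^sub>F h in at_right 0. h < e \<and> 0 < h \<and> x + h *\<^sub>R One \<in> box c d"
      by (intro eventually_conj)
    then obtain h where h: "h < e" "0 < h" "x + h *\<^sub>R One \<in> box c d"
      using eventually_happens[of _ "at_right (0::real)"] trivial_limit_at_right_real by blast
    \<comment> \<open>Short cubes starting at an interior point stay in the box, where all integrals
      of \<open>G\<close> vanish; the averages then cannot be close to a nonzero value.\<close>
    have "cbox x (x + h *\<^sub>R One) \<subseteq> cbox c d"
      using x(1) h(3) unfolding subset_box by (auto simp: mem_box less_imp_le)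
    from zero[OF this] e(2)[OF h(2,1)] show False by simp
  qed
  then have "{x. \<not> (x \<in> box c d \<longrightarrow> g x = 0)} \<subseteq> N" by auto
  then show ?thesis using N(1)
    by (intro AE_I'[of N]) (auto simp: negligible_iff_null_sets)
qed

text \<open>An open set is a countable union of closed boxes. On the interior of each the previous
  lemma applies, and the frontier of a box is a null set.\<close>

lemma AE_zero_if_orthogonal_to_test_functions:
  fixes g :: "'a::euclidean_space \<Rightarrow> real"
  assumes "open U"
    and int: "\<And>a b. cbox a b \<subseteq> U \<Longrightarrow> integrable (lebesgue_on (cbox a b)) g"
    and orth: "\<And>\<phi>. \<phi> \<in> test_functions U \<Longrightarrow> (\<integral>x. g x * \<phi> x \<partial>lebesgue_on U) = 0"
  shows "AE x in lebesgue_on U. g x = 0"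
proof -
  obtain \<D> where D: "countable \<D>" "\<D> \<subseteq> Pow U" "\<And>X. X \<in> \<D> \<Longrightarrow> \<exists>a b. X = cbox a b" "\<Union>\<D> = U"
    using open_countable_Union_open_cbox[OF assms(1)] by metis
  have U: "U \<in> sets lebesgue" using assms(1) by auto
  have "AE x in lebesgue. x \<in> X \<longrightarrow> g x = 0" if XD: "X \<in> \<D>" for X
  proof -
    obtain c d where X: "X = cbox c d" and sub: "cbox c d \<subseteq> U" using D(2) D(3)[OF XD] XD by blast
    have "(\<integral>x. g x * bump a b m x \<partial>lebesgue) = 0" if ab: "cbox a b \<subseteq> cbox c d" for a b m
    proof -
      have "(\<integral>x. g x * bump a b m x \<partial>lebesgue_on U) = 0"
        by (intro orth bump_test_function) (use ab sub in blast)
      moreover have *: "indicator U x *\<^sub>R (g x * bump a b m x) = g x * bump a b m x" for x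
        using ab sub box_subset_cbox[of a b] bump_eq_0_iff[of a b m x] by (auto simp: indicator_def)
      have "(\<integral>x. g x * bump a b m x \<partial>lebesgue_on U) = (\<integral>x. g x * bump a b m x \<partial>lebesgue)"
        using U by (subst integral_restrict_space) (simp, simp only: *)
      ultimately show ?thesis by simp
    qed
    from AE_zero_if_orthogonal_on_cbox[OF int[OF sub] this]
    have "AE x in lebesgue. x \<in> box c d \<longrightarrow> g x = 0" by blast
    moreover have "AE x in lebesgue. x \<notin> cbox c d - box c d"
      by (rule AE_not_in) (metis negligible_frontier_interval negligible_iff_null_sets)
    ultimately show ?thesis unfolding X by eventually_elim auto
  qed
  then have "AE x in lebesgue. \<forall>X\<in>\<D>. x \<in> X \<longrightarrow> g x = 0"
    using D(1) by (intro AE_ball_countable[THEN iffD2]) auto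
  then show ?thesis using U D(4)
    by (auto simp: AE_restrict_space_iff elim!: eventually_mono)
qed

subsection \<open>Resolvents of a closed form in Hilbert space\<close>

text \<open>A minimising sequence for the distance to \<open>W\<close> is Cauchy by the
  parallelogram law, since midpoints stay in \<open>W\<close>. At the minimiser the first variation
  in every direction of \<open>W\<close> vanishes.\<close>

lemma orthogonal_projection_exists:
  fixes W :: "'a::{real_inner,banach} set"
  assumes "subspace W" "closed W"
  shows "\<exists>p\<in>W. \<forall>y\<in>W. (x - p) \<bullet> y = 0"
proof -
  define N where "N = (\<lambda>y. (norm (x - y))\<^sup>2)"
  define d where "d = Inf (N ` W)"
  have "0 \<in> W" using assms(1) by (rule subspace_0)
  then have ne: "N ` W \<noteq> {}" by auto
  have bdd: "bdd_below (N ` W)" by (rule bdd_belowI[of _ 0]) (auto simp: N_def)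
  have d_le: "d \<le> N y" if "y \<in> W" for y
    unfolding d_def using that bdd by (auto intro: cInf_lower)
  have "\<exists>y\<in>W. N y < d + inverse (real (Suc n))" for n
    using cInf_lessD[OF ne, of "d + inverse (real (Suc n))"] by (auto simp: d_def)
  then obtain Y where Y: "\<And>n. Y n \<in> W" "\<And>n. N (Y n) < d + inverse (real (Suc n))" by metis
  have par: "(norm (Y m - Y n))\<^sup>2 \<le> 2 * inverse (real (Suc m)) + 2 * inverse (real (Suc n))" for m n
  proof -
    have "(1/2) *\<^sub>R (Y m + Y n) \<in> W"
      using Y(1) assms(1) by (simp add: subspace_add subspace_scale)
    then have "d \<le> N ((1/2) *\<^sub>R (Y m + Y n))" by (rule d_le)
    moreover have "(norm (Y m - Y n))\<^sup>2 = 2 * N (Y m) + 2 * N (Y n) - 4 * N ((1/2) *\<^sub>R (Y m + Y n))"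
      unfolding N_def power2_norm_eq_inner by (simp add: inner_diff inner_add inner_commute algebra_simps)
    ultimately show ?thesis using Y(2)[of m] Y(2)[of n] by linarith
  qed
  have "Cauchy Y"
  proof (rule metric_CauchyI)
    fix e :: real assume "e > 0"
    then obtain M where M: "inverse (real (Suc M)) < e\<^sup>2 / 4"
      using reals_Archimedean[of "e\<^sup>2 / 4"] by auto
    show "\<exists>M. \<forall>m\<ge>M. \<forall>n\<ge>M. dist (Y m) (Y n) < e"
    proof (intro exI[of _ M] allI impI)
      fix m n assume "m \<ge> M" "n \<ge> M"
      then have "inverse (real (Suc m)) \<le> inverse (real (Suc M))" "inverse (real (Suc n)) \<le> inverse (real (Suc M))"
        by (auto simp: field_simps)
      with par[of m n] M have "(norm (Y m - Y n))\<^sup>2 < e\<^sup>2" by linarith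
      then show "dist (Y m) (Y n) < e"
        using \<open>e > 0\<close> by (simp add: dist_norm power2_less_imp_less)
    qed
  qed
  then obtain p where p: "Y \<longlonglongrightarrow> p" using Cauchy_convergent_iff convergent_def by blast
  have pW: "p \<in> W" using assms(2) Y(1) p closed_sequentially by blast
  have "(\<lambda>n. N (Y n)) \<longlonglongrightarrow> N p" unfolding N_def by (intro tendsto_intros p)
  moreover have "(\<lambda>n. d + inverse (real (Suc n))) \<longlonglongrightarrow> d + 0"
    by (intro tendsto_intros LIMSEQ_inverse_real_of_nat)
  ultimately have Np: "N p \<le> d"
    using Y(2) by (intro LIMSEQ_le[of "\<lambda>n. N (Y n)" _ "\<lambda>n. d + inverse (real (Suc n))"]) (auto intro: less_imp_le)
  have "(x - p) \<bullet> y = 0" if "y \<in> W" for y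
  proof (cases "y = 0")
    case False
    \<comment> \<open>The minimiser of the quadratic \<open>N (p + t *\<^sub>R y)\<close> in t; a
      nonzero inner product would bring its value below the infimum.\<close>
    define t where "t = (x - p) \<bullet> y / (y \<bullet> y)"
    have "p + t *\<^sub>R y \<in> W" using pW that assms(1) by (simp add: subspace_add subspace_scale)
    then have "N p \<le> N (p + t *\<^sub>R y)" using Np d_le by force
    also have "N (p + t *\<^sub>R y) = N p - 2 * t * ((x - p) \<bullet> y) + t\<^sup>2 * (y \<bullet> y)"
      unfolding N_def power2_norm_eq_inner
      by (simp add: inner_diff inner_add inner_commute algebra_simps power2_eq_square)
    also have "\<dots> = N p - ((x - p) \<bullet> y)\<^sup>2 / (y \<bullet> y)"
      using False by (simp add: t_def field_simps power2_eq_square)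
    finally have "((x - p) \<bullet> y)\<^sup>2 / (y \<bullet> y) \<le> 0" by simp
    moreover have "0 < y \<bullet> y" using False by simp
    ultimately show ?thesis by (simp add: divide_le_0_iff)
  qed simp
  with pW show ?thesis by blast
qed

section \<open>Lipschitz maps and global solvability of ordinary differential equations\<close>

lemma norm_Lipschitz_continuous_on:
  fixes g :: "'a::real_normed_vector \<Rightarrow> 'b::real_normed_vector"
  assumes "\<And>x y. norm (g x - g y) \<le> L * norm (x - y)"
  shows "continuous_on S g"
proof (rule lipschitz_on_continuous_on)
  show "\<bar>L\<bar>-lipschitz_on S g"
    by (rule lipschitz_onI) (auto simp: dist_norm intro!: order_trans[OF assms] mult_right_mono)
qed

text \<open>Picard iteration for the weighted unknown exp(-k t) v(t): the weight makes the integral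
  operator a contraction on the whole interval at once, so no local solutions have to be
  continued.\<close>

lemma global_Lipschitz_ODE:
  fixes G :: "'a::banach \<Rightarrow> 'a"
  assumes lip: "\<And>x y. norm (G x - G y) \<le> L * norm (x - y)" and T: "T > 0"
  shows "\<exists>v. v 0 = x \<and> (\<forall>t\<in>{0..T}. (v has_vector_derivative G (v t)) (at t within {0..T}))"
proof -
  \<comment> \<open>The contraction constant will be \<open>\<bar>L\<bar> / k\<close>, here at most
    1/2; the summand 1 keeps k positive when L is 0.\<close>
  define k where "k = 2 * \<bar>L\<bar> + 1"
  have k: "k > 0" "\<bar>L\<bar> / k \<le> 1/2" by (auto simp: k_def field_simps)
  have lip': "norm (G x - G y) \<le> \<bar>L\<bar> * norm (x - y)" for x y
    by (rule order_trans[OF lip]) (simp add: mult_right_mono)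
  have contG: "continuous_on UNIV G" by (rule norm_Lipschitz_continuous_on[OF lip])
  \<comment> \<open>Clamping time to the interval makes the iterates bounded continuous functions on
    the whole line, which form the complete space of the fixed point argument.\<close>
  define cl where "cl = (\<lambda>t. max 0 (min T t))"
  have cl: "cl t \<in> {0..T}" "t \<in> {0..T} \<Longrightarrow> cl t = t" for t using T by (auto simp: cl_def)
  have cont_cl: "continuous_on S cl" for S unfolding cl_def by (intro continuous_intros)
  define I where "I = (\<lambda>V::real \<Rightarrow>\<^sub>C 'a. \<lambda>s. G (exp (k * s) *\<^sub>R V s))"
  have contI: "continuous_on S (I V)" for V S
    unfolding I_def
    by (rule continuous_on_compose2[OF contG]) (auto intro!: continuous_intros)
  then have intI: "I V integrable_on {a..b}" for V a b by (rule integrable_continuous_real)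
  define P where "P = (\<lambda>V t. exp (- (k * cl t)) *\<^sub>R (x + integral {0..cl t} (I V)))"
  have contP: "continuous_on UNIV (P V)" for V
  proof -
    have "continuous_on {0..T} (\<lambda>t. x + integral {0..t} (I V))"
      by (intro continuous_intros indefinite_integral_continuous_1 intI)
    then have "continuous_on UNIV (\<lambda>t. x + integral {0..cl t} (I V))"
      by (rule continuous_on_compose2[OF _ cont_cl]) (use cl in auto)
    then show ?thesis unfolding P_def by (rule continuous_on_scaleR[rotated]) (intro continuous_intros cont_cl)
  qed
  have Pbc: "P V \<in> bcontfun" for V
  proof -
    have "range (P V) = P V ` {0..T}"
    proof -
      have "P V t = P V (cl t)" for t using cl by (simp add: P_def)
      then show ?thesis using cl by (metis image_subset_iff subsetI subset_antisym image_eqI rangeI)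
    qed
    moreover have "compact (P V ` {0..T})"
      by (intro compact_continuous_image continuous_on_subset[OF contP]) auto
    ultimately show ?thesis using contP by (simp add: bcontfun_def compact_imp_bounded)
  qed
  define Q where "Q = (\<lambda>V. Bcontfun (P V))"
  have Q: "apply_bcontfun (Q V) = P V" for V
    using Pbc by (simp add: Q_def Bcontfun_inverse)
  have "dist (Q V) (Q V') \<le> 1/2 * dist V V'" for V V'
  proof (rule dist_bound)
    fix t
    define \<tau> where "\<tau> = cl t"
    have \<tau>: "\<tau> \<ge> 0" using cl(1)[of t] by (auto simp: \<tau>_def)
    have "norm (integral {0..\<tau>} (\<lambda>s. I V s - I V' s)) \<le> integral {0..\<tau>} (\<lambda>s. \<bar>L\<bar> * dist V V' * exp (k * s))"
    proof (rule integral_norm_bound_integral)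
      show "norm (I V s - I V' s) \<le> \<bar>L\<bar> * dist V V' * exp (k * s)" if "s \<in> {0..\<tau>}" for s
      proof -
        have "norm (V s - V' s) \<le> dist V V'" using dist_bounded[of V s V'] by (simp add: dist_norm)
        then have "\<bar>L\<bar> * norm (exp (k * s) *\<^sub>R V s - exp (k * s) *\<^sub>R V' s) \<le> \<bar>L\<bar> * (exp (k * s) * dist V V')"
          by (intro mult_left_mono) (auto simp: scaleR_diff_right[symmetric])
        then show ?thesis using lip' unfolding I_def
          by (metis (no_types, lifting) mult.assoc mult.commute order_trans)
      qed
    qed (auto intro!: integrable_diff intI integrable_continuous_real continuous_intros contI)
    also have "\<dots> = \<bar>L\<bar> * dist V V' * ((exp (k * \<tau>) - 1) / k)"
    proof -
      have "((\<lambda>s. exp (k * s)) has_integral (exp (k * \<tau>) / k - exp (k * 0) / k)) {0..\<tau>}"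
        using k \<tau> by (intro fundamental_theorem_of_calculus)
          (auto intro!: derivative_eq_intros simp: has_real_derivative_iff_has_vector_derivative[symmetric])
      from integral_unique[OF has_integral_mult_right[OF this, of "\<bar>L\<bar> * dist V V'"]] show ?thesis
        by (simp add: diff_divide_distrib)
    qed
    also have "\<dots> \<le> \<bar>L\<bar> * dist V V' * (exp (k * \<tau>) / k)"
      using k by (intro mult_left_mono divide_right_mono) auto
    finally have *: "norm (integral {0..\<tau>} (I V) - integral {0..\<tau>} (I V')) \<le> \<bar>L\<bar> * dist V V' * (exp (k * \<tau>) / k)"
      by (simp add: integral_diff intI)
    have "dist (P V t) (P V' t) = exp (- (k * \<tau>)) * norm (integral {0..\<tau>} (I V) - integral {0..\<tau>} (I V'))"
      by (simp add: P_def dist_norm \<tau>_def scaleR_diff_right[symmetric])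
    also have "\<dots> \<le> exp (- (k * \<tau>)) * (\<bar>L\<bar> * dist V V' * (exp (k * \<tau>) / k))"
      by (intro mult_left_mono *) auto
    also have "\<dots> = \<bar>L\<bar> / k * dist V V'" by (simp add: exp_minus field_simps)
    also have "\<dots> \<le> 1/2 * dist V V'" by (intro mult_right_mono k) auto
    finally show "dist (Q V t) (Q V' t) \<le> 1/2 * dist V V'" by (simp add: Q)
  qed
  then have "\<exists>!V. V \<in> UNIV \<and> Q V = V"
    by (intro Banach_fix[where c="1/2"] complete_UNIV) auto
  then obtain V where V: "Q V = V" by blast
  define v where "v = (\<lambda>t. x + integral {0..t} (I V))"
  have vV: "v t = exp (k * t) *\<^sub>R V t" if "t \<in> {0..T}" for t
  proof -
    have "V t = P V t" using V Q by metis
    then show ?thesis using cl(2)[OF that] by (simp add: P_def v_def exp_minus)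
  qed
  have "(v has_vector_derivative G (v t)) (at t within {0..T})" if "t \<in> {0..T}" for t
  proof -
    have "(v has_vector_derivative 0 + I V t) (at t within {0..T})"
      unfolding v_def
      by (intro has_vector_derivative_add has_vector_derivative_const
          integral_has_vector_derivative contI that)
    then show ?thesis using vV[OF that] by (simp add: I_def)
  qed
  moreover have "v 0 = x" by (simp add: v_def)
  ultimately show ?thesis by blast
qed

section \<open>Derivatives of inner products and integrated differential inequalities\<close>

lemma has_real_derivative_inner:
  fixes f g :: "real \<Rightarrow> 'a::real_inner"
  assumes "(f has_vector_derivative f') (at t within S)" "(g has_vector_derivative g') (at t within S)"
  shows "((\<lambda>t. f t \<bullet> g t) has_real_derivative (f t \<bullet> g' + f' \<bullet> g t)) (at t within S)"
  using has_derivative_inner[OF assms[unfolded has_vector_derivative_def]]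
  unfolding has_field_derivative_def by (rule has_derivative_eq_rhs) (simp add: fun_eq_iff algebra_simps)

text \<open>The fundamental theorem of calculus supplies the integrability of \<open>f'\<close>, so
  only the majorant \<open>g\<close> has to be integrable.\<close>

lemma derivative_le_imp_integral_bound:
  fixes f :: "real \<Rightarrow> real"
  assumes "0 \<le> t" "\<And>s. s \<in> {0..t} \<Longrightarrow> (f has_real_derivative f' s) (at s within {0..t})"
    and "\<And>s. s \<in> {0..t} \<Longrightarrow> f' s \<le> g s" "g integrable_on {0..t}"
  shows "f t - f 0 \<le> integral {0..t} g"
proof -
  have "(f' has_integral (f t - f 0)) {0..t}"
    using assms(1,2) by (intro fundamental_theorem_of_calculus)
      (auto simp: has_real_derivative_iff_has_vector_derivative[symmetric])
  then show ?thesis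
    using assms(3,4) by (metis has_integral_le integrable_integral)
qed

lemma norm_sum3_sq: "(norm (a + b + c))\<^sup>2 \<le> 3 * ((norm a)\<^sup>2 + (norm b)\<^sup>2 + (norm (c::'a::real_inner))\<^sup>2)"
proof -
  have "0 \<le> (norm (a - b))\<^sup>2 + (norm (b - c))\<^sup>2 + (norm (a - c))\<^sup>2" by simp
  then show ?thesis
    unfolding power2_norm_eq_inner by (simp add: inner_diff inner_add inner_commute algebra_simps)
qed

text \<open>\<open>W\<close> models the graph of a closed operator such as a weighted gradient:
  first components are vectors of H, and the form of two elements is the inner product of their
  second components. Closedness of \<open>W\<close> expresses closedness of the form.\<close>

locale hilbert_form =
  fixes W :: "('h::{real_inner,banach} \<times> 'g::{real_inner,banach}) set"
  assumes subspace_W: "subspace W" and closed_W: "closed W"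
begin

text \<open>Scaling second components by \<open>sqrt l\<close> turns the equation into orthogonality
  in the product space, so the solution comes from projecting \<open>(h, 0)\<close> onto the scaled
  copy of \<open>W\<close>.\<close>

lemma resolvent_exists:
  assumes l: "l > 0"
  shows "\<exists>w\<in>W. \<forall>y\<in>W. fst w \<bullet> fst y + l * (snd w \<bullet> snd y) = h \<bullet> fst y"
proof -
  define f where "f = (\<lambda>z::'h \<times> 'g. (fst z, (1 / sqrt l) *\<^sub>R snd z))"
  have "linear f" by (rule linearI) (auto simp: f_def algebra_simps)
  then have "subspace (f -` W)" using subspace_W by (rule linear_subspace_vimage)
  moreover have "closed (f -` W)"
    by (rule closed_vimage[OF closed_W]) (auto simp: f_def intro!: continuous_intros)
  ultimately obtain p where p: "p \<in> f -` W" "\<And>y. y \<in> f -` W \<Longrightarrow> ((h, 0) - p) \<bullet> y = 0"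
    using orthogonal_projection_exists by metis
  have "fst (f p) \<bullet> fst y + l * (snd (f p) \<bullet> snd y) = h \<bullet> fst y" if "y \<in> W" for y
  proof -
    have "(fst y, sqrt l *\<^sub>R snd y) \<in> f -` W" using that l by (simp add: f_def)
    from p(2)[OF this] have "h \<bullet> fst y = fst p \<bullet> fst y + sqrt l * (snd p \<bullet> snd y)"
      by (simp add: inner_prod_def inner_diff_left)
    moreover have "l * (1 / sqrt l) = sqrt l" using l by (simp add: real_div_sqrt)
    then have "l * ((1 / sqrt l) * r) = sqrt l * r" for r by (metis mult.assoc)
    ultimately show ?thesis by (simp add: f_def)
  qed
  then show ?thesis using p(1) by blast
qed

text \<open>The first component of \<open>Jw l h\<close> is the resolvent \<open>(1 + l A)\<^sup>-\<^sup>1 h\<close>, and \<open>A l\<close> is the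
  Yosida approximation of the operator A associated with the form.\<close>

definition Jw :: "real \<Rightarrow> 'h \<Rightarrow> 'h \<times> 'g" where
  "Jw l h = (SOME w. w \<in> W \<and> (\<forall>y\<in>W. fst w \<bullet> fst y + l * (snd w \<bullet> snd y) = h \<bullet> fst y))"

definition A :: "real \<Rightarrow> 'h \<Rightarrow> 'h" where "A l h = (1 / l) *\<^sub>R (h - fst (Jw l h))"

context
  fixes l :: real
  assumes l: "l > 0"
begin

lemma Jw_mem: "Jw l h \<in> W" and Jw_eq: "y \<in> W \<Longrightarrow> fst (Jw l h) \<bullet> fst y + l * (snd (Jw l h) \<bullet> snd y) = h \<bullet> fst y"
  using someI_ex[OF resolvent_exists[OF l, of h, unfolded Bex_def]] unfolding Jw_def by blast+

text \<open>The Yosida approximation is the operator applied to the resolvent; this identity is what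
  brings the form into the later estimates.\<close>

lemma A_weak: "y \<in> W \<Longrightarrow> A l h \<bullet> fst y = snd (Jw l h) \<bullet> snd y"
  using Jw_eq[of y h] l by (simp add: A_def inner_diff_left field_simps)

lemma Jw_unique:
  assumes "w \<in> W" "\<And>y. y \<in> W \<Longrightarrow> fst w \<bullet> fst y + l * (snd w \<bullet> snd y) = h \<bullet> fst y"
  shows "Jw l h = w"
proof -
  define z where "z = Jw l h - w"
  have "z \<in> W" using assms(1) Jw_mem subspace_W by (simp add: z_def subspace_diff)
  from assms(2)[OF this] Jw_eq[OF this, of h]
  have "fst z \<bullet> fst z + l * (snd z \<bullet> snd z) = 0"
    by (simp add: z_def inner_diff_left algebra_simps)
  moreover have "0 \<le> fst z \<bullet> fst z" "0 \<le> l * (snd z \<bullet> snd z)" using l by auto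
  ultimately have "fst z \<bullet> fst z = 0" "l * (snd z \<bullet> snd z) = 0" by linarith+
  then show ?thesis using l by (simp add: z_def prod_eq_iff)
qed

lemma Jw_linear: "linear (Jw l)"
proof (rule linearI)
  show "Jw l (a + b) = Jw l a + Jw l b" for a b
    using Jw_eq[of _ a] Jw_eq[of _ b]
    by (intro Jw_unique) (auto simp: subspace_add[OF subspace_W] Jw_mem inner_add_left algebra_simps)
  show "Jw l (c *\<^sub>R a) = c *\<^sub>R Jw l a" for c a
    using arg_cong[OF Jw_eq[of _ a], of _ "\<lambda>r. c * r"]
    by (intro Jw_unique) (auto simp: subspace_scale[OF subspace_W] Jw_mem algebra_simps)
qed

lemma Jw_diff: "Jw l (a - b) = Jw l a - Jw l b" using linear_diff[OF Jw_linear] .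

lemma A_linear: "linear (A l)"
  using linear_add[OF Jw_linear] linear_scale[OF Jw_linear]
  by (intro linearI) (auto simp: A_def algebra_simps)

lemma A_diff: "A l (a - b) = A l a - A l b" using linear_diff[OF A_linear] .

lemma decomp: "h = fst (Jw l h) + l *\<^sub>R A l h" using l by (simp add: A_def)

text \<open>Splitting \<open>k\<close> into its resolvent and \<open>l *\<^sub>R A l k\<close>
  exhibits the pairing as a symmetric nonnegative form. Symmetry, positivity, the norm bound 1/l and
  the bound on the gradient part of the resolvent are read off from it.\<close>

lemma A_inner: "A l h \<bullet> k = snd (Jw l h) \<bullet> snd (Jw l k) + l * (A l h \<bullet> A l k)"
  by (subst decomp[of k], simp only: inner_add_right inner_scaleR_right) (simp add: A_weak[OF Jw_mem])

lemma A_sym: "A l h \<bullet> k = h \<bullet> A l k"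
  using A_inner[of h k] A_inner[of k h] by (simp add: inner_commute)

lemma A_nonneg: "0 \<le> A l h \<bullet> h"
  unfolding A_inner[of h h] using l by simp

lemma J_sym: "fst (Jw l h) \<bullet> k = h \<bullet> fst (Jw l k)"
proof -
  have "fst (Jw l h) = h - l *\<^sub>R A l h" for h using decomp[of h] by (simp add: algebra_simps)
  then show ?thesis by (simp add: inner_diff A_sym)
qed

lemma norm_A: "norm (A l h) \<le> norm h / l"
proof -
  have "l * (norm (A l h))\<^sup>2 \<le> A l h \<bullet> h" unfolding A_inner[of h h] by (simp add: power2_norm_eq_inner)
  also have "\<dots> \<le> norm (A l h) * norm h" by (rule norm_cauchy_schwarz)
  finally have "norm (A l h) * (l * norm (A l h)) \<le> norm (A l h) * norm h" by (simp add: power2_eq_square ac_simps)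
  then show ?thesis using l by (cases "A l h = 0") (auto simp: field_simps)
qed

lemma norm_J: "norm (fst (Jw l h)) \<le> norm h"
proof -
  have "(norm (fst (Jw l h)))\<^sup>2 \<le> h \<bullet> fst (Jw l h)"
    unfolding Jw_eq[OF Jw_mem, of h h, symmetric] using l by (simp add: power2_norm_eq_inner)
  also have "\<dots> \<le> norm h * norm (fst (Jw l h))" by (rule norm_cauchy_schwarz)
  finally show ?thesis by (cases "fst (Jw l h) = 0") (auto simp: power2_eq_square)
qed

lemma norm_snd_Jw: "(norm (snd (Jw l h)))\<^sup>2 \<le> A l h \<bullet> h"
  unfolding A_inner[of h h] using l by (simp add: power2_norm_eq_inner)

text \<open>The gradient part of the resolvent is of order 1/sqrt(l): its square is at most
  \<open>A l h \<bullet> h\<close>, hence at most |h|^2 / l.\<close>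

lemma Jw_bounded_linear: "bounded_linear (Jw l)"
proof (rule bounded_linear_intro[of _ "1 + 1 / sqrt l"])
  fix h
  have "(norm (snd (Jw l h)))\<^sup>2 \<le> norm (A l h) * norm h"
    using norm_snd_Jw norm_cauchy_schwarz order_trans by blast
  also have "\<dots> \<le> norm h / l * norm h" by (intro mult_right_mono norm_A) auto
  also have "\<dots> = (norm h / sqrt l)\<^sup>2" using l by (simp add: power_divide power2_eq_square)
  finally have "norm (snd (Jw l h)) \<le> norm h / sqrt l" by (rule power2_le_imp_le) (use l in simp)
  moreover have "norm (Jw l h) \<le> norm (fst (Jw l h)) + norm (snd (Jw l h))"
    using norm_Pair_le[of "fst (Jw l h)" "snd (Jw l h)"] by simp
  ultimately show "norm (Jw l h) \<le> norm h * (1 + 1 / sqrt l)" using norm_J[of h] by (simp add: algebra_simps)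
qed (auto simp: linear_add[OF Jw_linear] linear_scale[OF Jw_linear])

lemma A_bounded_linear: "bounded_linear (A l)"
  by (rule bounded_linear_intro[of _ "1 / l"])
    (use norm_A in \<open>auto simp: linear_add[OF A_linear] linear_scale[OF A_linear]\<close>)

text \<open>Let X be the left side, a the norm of \<open>snd (Jw l (fst z))\<close> and b that of
  \<open>snd z\<close>. Then a^2 \<le> X \<le> a b, and so X \<le> b^2. The bound is uniform in
  \<open>l\<close>, which makes it usable for the energy at time 0.\<close>

lemma A_inner_le: assumes "z \<in> W" shows "A l (fst z) \<bullet> fst z \<le> (norm (snd z))\<^sup>2"
proof -
  let ?a = "norm (snd (Jw l (fst z)))"
  have "A l (fst z) \<bullet> fst z \<le> ?a * norm (snd z)"
    unfolding A_weak[OF assms] by (rule norm_cauchy_schwarz)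
  moreover have "?a\<^sup>2 \<le> A l (fst z) \<bullet> fst z" by (rule norm_snd_Jw)
  moreover have "0 \<le> (?a - norm (snd z))\<^sup>2" by simp
  ultimately show ?thesis by (simp add: power2_eq_square algebra_simps) 
qed

end

text \<open>On the form domain the resolvents converge at rate \<open>sqrt l\<close>; contractivity carries
  convergence over to its closure.\<close>

lemma J_tendsto:
  assumes "h \<in> closure (fst ` W)"
  shows "((\<lambda>l. fst (Jw l h)) \<longlongrightarrow> h) (at_right 0)"
proof (rule tendstoI)
  fix e :: real assume "e > 0"
  then obtain z where z: "z \<in> W" "norm (fst z - h) < e / 3"
    using assms[unfolded closure_approachable, rule_format, of "e / 3"] by (auto simp: dist_norm)
  have "((\<lambda>l. sqrt l * norm (snd z)) \<longlongrightarrow> sqrt 0 * norm (snd z)) (at_right 0)" by (intro tendsto_intros)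
  then have "\<forall>\<^sub>F l in at_right 0. sqrt l * norm (snd z) < e / 3"
    using \<open>e > 0\<close> by (intro order_tendstoD) auto
  moreover have "\<forall>\<^sub>F l in at_right (0::real). 0 < l" by (simp add: eventually_at_right_less)
  ultimately show "\<forall>\<^sub>F l in at_right 0. dist (fst (Jw l h)) h < e"
  proof eventually_elim
    case (elim l)
    have "l * (norm (A l (fst z)))\<^sup>2 \<le> A l (fst z) \<bullet> fst z"
      unfolding A_inner[OF elim(2), of "fst z" "fst z"] by (simp add: power2_norm_eq_inner)
    also have "\<dots> \<le> (norm (snd z))\<^sup>2" by (rule A_inner_le[OF elim(2) z(1)])
    finally have "l * (l * (norm (A l (fst z)))\<^sup>2) \<le> l * (norm (snd z))\<^sup>2"
      using elim(2) by (intro mult_left_mono) auto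
    then have "(l * norm (A l (fst z)))\<^sup>2 \<le> (sqrt l * norm (snd z))\<^sup>2"
      unfolding power_mult_distrib using elim(2) by (simp add: power2_eq_square[of l] mult.assoc)
    then have "l * norm (A l (fst z)) \<le> sqrt l * norm (snd z)"
      by (rule power2_le_imp_le) (use elim(2) in simp)
    moreover have "norm (fst z - fst (Jw l (fst z))) = l * norm (A l (fst z))"
      using elim(2) by (simp add: A_def)
    moreover have "norm (fst (Jw l h) - fst (Jw l (fst z))) \<le> norm (h - fst z)"
      using norm_J[OF elim(2), of "h - fst z"] by (simp add: Jw_diff[OF elim(2)])
    moreover have "norm (fst (Jw l h) - h) \<le> norm (fst (Jw l h) - fst (Jw l (fst z)))
        + norm (fst z - fst (Jw l (fst z))) + norm (fst z - h)"
    proof -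
      have "fst (Jw l h) - h = (fst (Jw l h) - fst (Jw l (fst z))) - (fst z - fst (Jw l (fst z))) + (fst z - h)"
        by simp
      then show ?thesis
        using norm_triangle_ineq[of "fst (Jw l h) - fst (Jw l (fst z)) - (fst z - fst (Jw l (fst z)))" "fst z - h"]
          norm_triangle_ineq4[of "fst (Jw l h) - fst (Jw l (fst z))" "fst z - fst (Jw l (fst z))"] by simp
    qed
    ultimately show ?case using z(2) elim(1) by (simp add: dist_norm norm_minus_commute)
  qed
qed

end

subsection \<open>Yosida approximation of the semilinear evolution equation\<close>

locale semilinear = hilbert_form W
  for W :: "('h::{real_inner,banach} \<times> 'g::{real_inner,banach}) set" +
  fixes F :: "'h \<Rightarrow> 'h" and L K T :: real
  assumes F_lip: "norm (F x - F y) \<le> L * norm (x - y)" and L: "0 \<le> L"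
    and F_bound: "norm (F x) \<le> K" and T: "0 < T"
begin

lemma continuous_F: "continuous_on UNIV F"
  by (rule norm_Lipschitz_continuous_on[OF F_lip])

definition yosida :: "real \<Rightarrow> 'h \<Rightarrow> real \<Rightarrow> 'h" where
  "yosida l x = (SOME v. v 0 = x \<and>
     (\<forall>t\<in>{0..T}. (v has_vector_derivative (F (v t) - A l (v t))) (at t within {0..T})))"

context
  fixes l :: real
  assumes l: "l > 0"
begin

lemma yosida_0: "yosida l x 0 = x"
  and yosida_deriv: "t \<in> {0..T} \<Longrightarrow>
    (yosida l x has_vector_derivative (F (yosida l x t) - A l (yosida l x t))) (at t within {0..T})"
proof -
  have "norm ((F x - A l x) - (F y - A l y)) \<le> (L + 1 / l) * norm (x - y)" for x y
  proof -
    have "norm ((F x - A l x) - (F y - A l y)) \<le> norm (F x - F y) + norm (A l (x - y))"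
      unfolding A_diff[OF l] by (metis (no_types, lifting) diff_diff_eq2 add_diff_eq diff_add_eq
        diff_diff_add norm_triangle_ineq4 add.commute)
    also have "\<dots> \<le> L * norm (x - y) + norm (x - y) / l"
      by (intro add_mono F_lip norm_A l)
    finally show ?thesis by (simp add: algebra_simps)
  qed
  from global_Lipschitz_ODE[of "\<lambda>x. F x - A l x", OF this T, of x]
  have "yosida l x 0 = x \<and>
     (\<forall>t\<in>{0..T}. (yosida l x has_vector_derivative (F (yosida l x t) - A l (yosida l x t))) (at t within {0..T}))"
    unfolding yosida_def by (rule someI_ex)
  then show "yosida l x 0 = x" "t \<in> {0..T} \<Longrightarrow>
    (yosida l x has_vector_derivative (F (yosida l x t) - A l (yosida l x t))) (at t within {0..T})"
    by blast+
qed

lemma continuous_yosida: "continuous_on {0..T} (yosida l x)"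
  unfolding continuous_on_eq_continuous_within
  using yosida_deriv has_vector_derivative_continuous by blast

lemma continuous_Jw_yosida: "continuous_on {0..T} (\<lambda>t. Jw l (yosida l x t))"
  by (rule bounded_linear.continuous_on[OF Jw_bounded_linear[OF l] continuous_yosida])

lemma continuous_A_yosida: "continuous_on {0..T} (\<lambda>t. A l (yosida l x t))"
  by (rule bounded_linear.continuous_on[OF A_bounded_linear[OF l] continuous_yosida])

lemma continuous_F_yosida: "continuous_on {0..T} (\<lambda>t. F (yosida l x t))"
  by (rule continuous_on_compose2[OF continuous_F continuous_yosida]) simp

text \<open>Test the equation with \<open>A l v\<close>: since \<open>A l\<close> is symmetric, this controls the energy.\<close>

lemma yosida_energy:
  assumes "z \<in> W"
  shows "integral {0..T} (\<lambda>t. (norm (A l (yosida l (fst z) t)))\<^sup>2) \<le> (norm (snd z))\<^sup>2 + K\<^sup>2 * T"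
proof -
  let ?v = "yosida l (fst z)"
  let ?a = "\<lambda>t. (norm (A l (?v t)))\<^sup>2"
  define D where "D = (\<lambda>t. F (?v t) - A l (?v t))"
  \<comment> \<open>By symmetry the derivative of \<open>A l v \<bullet> v\<close> is twice
    \<open>A l v \<bullet> v'\<close>. The equation turns this into 2 (A v).(F v) - 2 |A v|^2, and
    Young's inequality gives away one of the two squares.\<close>
  have "A l (?v T) \<bullet> ?v T - A l (?v 0) \<bullet> ?v 0 \<le> integral {0..T} (\<lambda>t. K\<^sup>2 - ?a t)"
  proof (rule derivative_le_imp_integral_bound)
    fix t assume t: "t \<in> {0..T}"
    have "((\<lambda>t. A l (?v t)) has_vector_derivative A l (D t)) (at t within {0..T})"
      unfolding D_def
      by (rule bounded_linear.has_vector_derivative[OF A_bounded_linear[OF l] yosida_deriv[OF t]])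
    from has_real_derivative_inner[OF this yosida_deriv[OF t]]
    show "((\<lambda>t. A l (?v t) \<bullet> ?v t) has_real_derivative A l (?v t) \<bullet> D t + A l (D t) \<bullet> ?v t) (at t within {0..T})"
      unfolding D_def .
    have "A l (D t) \<bullet> ?v t = A l (?v t) \<bullet> D t" by (simp add: A_sym[OF l] inner_commute)
    moreover have "A l (?v t) \<bullet> D t = A l (?v t) \<bullet> F (?v t) - ?a t"
      by (simp add: D_def inner_diff_right power2_norm_eq_inner)
    moreover have "2 * (A l (?v t) \<bullet> F (?v t)) \<le> ?a t + K\<^sup>2"
    proof -
      have "A l (?v t) \<bullet> F (?v t) \<le> norm (A l (?v t)) * norm (F (?v t))" by (rule norm_cauchy_schwarz)
      also have "2 * (norm (A l (?v t)) * norm (F (?v t))) \<le> ?a t + (norm (F (?v t)))\<^sup>2"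
        using sum_squares_bound[of "norm (A l (?v t))" "norm (F (?v t))"] by (simp add: ac_simps)
      also have "(norm (F (?v t)))\<^sup>2 \<le> K\<^sup>2" using F_bound by (intro power_mono) auto
      finally show ?thesis by simp
    qed
    ultimately show "A l (?v t) \<bullet> D t + A l (D t) \<bullet> ?v t \<le> K\<^sup>2 - ?a t" by linarith
  qed (use T in \<open>auto intro!: integrable_continuous_real continuous_intros continuous_A_yosida\<close>)
  also have "\<dots> = K\<^sup>2 * T - integral {0..T} ?a"
    using T by (subst integral_diff)
      (auto intro!: integrable_continuous_real continuous_intros continuous_A_yosida)
  finally have "integral {0..T} ?a \<le> A l (?v 0) \<bullet> ?v 0 - A l (?v T) \<bullet> ?v T + K\<^sup>2 * T" by simp
  also have "A l (?v 0) \<bullet> ?v 0 \<le> (norm (snd z))\<^sup>2"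
    unfolding yosida_0 by (rule A_inner_le[OF l assms])
  finally show ?thesis using A_nonneg[OF l, of "?v T"] by linarith
qed

end

text \<open>A vector is its resolvent plus \<open>l\<close> times its Yosida term. Pairing the
  difference of the two Yosida terms with the difference of the solutions hence yields the squared
  difference of the gradient parts plus a cross term of the order of the parameters. The cross term
  is left abstract through its bound \<open>r\<close>; the squared difference stays on the good
  side, so one Gronwall argument bounds both quantities.\<close>

lemma yosida_compare:
  fixes x y :: 'h
  assumes l: "l > 0" and m: "m > 0"
    and r: "continuous_on {0..T} r"
      "\<And>t. t \<in> {0..T} \<Longrightarrow> 0 \<le> r t"
      "\<And>t. t \<in> {0..T} \<Longrightarrow> - (2 * ((A l (yosida l x t) - A m (yosida m y t)) \<bullet>
        (l *\<^sub>R A l (yosida l x t) - m *\<^sub>R A m (yosida m y t)))) \<le> r t"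
  defines "B \<equiv> exp (2 * L * T) * ((norm (x - y))\<^sup>2 + integral {0..T} r)"
  shows "t \<in> {0..T} \<Longrightarrow> (norm (yosida l x t - yosida m y t))\<^sup>2 \<le> B"
    and "integral {0..T} (\<lambda>t. (norm (snd (Jw l (yosida l x t) - Jw m (yosida m y t))))\<^sup>2) \<le> B"
proof -
  let ?u = "yosida l x" and ?v = "yosida m y"
  define D where "D = (\<lambda>t. ?u t - ?v t)"
  define P where "P = (\<lambda>t. (norm (snd (Jw l (?u t) - Jw m (?v t))))\<^sup>2)"
  define D' where "D' = (\<lambda>t. F (?u t) - A l (?u t) - (F (?v t) - A m (?v t)))"
  \<comment> \<open>The smallest value of the integrating factor exp(-2 L t) on the
    interval.\<close>
  define c where "c = exp (- (2 * L * T))"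
  have c: "c > 0" by (simp add: c_def)
  have contP: "continuous_on {0..T} P"
    unfolding P_def by (intro continuous_intros continuous_Jw_yosida l m)
  have der: "(D has_vector_derivative D' t) (at t within {0..T})" if "t \<in> {0..T}" for t
    unfolding D_def D'_def by (intro has_vector_derivative_diff yosida_deriv l m that)
  have key: "D t \<bullet> D' t \<le> L * (D t \<bullet> D t) + r t / 2 - P t" if t: "t \<in> {0..T}" for t
  proof -
    let ?a = "A l (?u t)" and ?b = "A m (?v t)"
    have "(?a - ?b) \<bullet> D t = (?a - ?b) \<bullet> fst (Jw l (?u t) - Jw m (?v t)) + (?a - ?b) \<bullet> (l *\<^sub>R ?a - m *\<^sub>R ?b)"
      unfolding D_def using decomp[OF l, of "?u t"] decomp[OF m, of "?v t"]
      by (metis (no_types, opaque_lifting) add_diff_add fst_diff inner_add_right)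
    \<comment> \<open>The difference of the two resolvent vectors lies in \<open>W\<close>, so both
      Yosida terms may be tested with it.\<close>
    moreover have "(?a - ?b) \<bullet> fst (Jw l (?u t) - Jw m (?v t)) = P t"
    proof -
      have *: "Jw l (?u t) - Jw m (?v t) \<in> W"
        by (intro subspace_diff subspace_W Jw_mem l m)
      show ?thesis
        unfolding inner_diff_left A_weak[OF l *] A_weak[OF m *] P_def power2_norm_eq_inner
        by (simp add: inner_diff_left)
    qed
    moreover have "(F (?u t) - F (?v t)) \<bullet> D t \<le> L * (D t \<bullet> D t)"
    proof -
      have "(F (?u t) - F (?v t)) \<bullet> D t \<le> norm (F (?u t) - F (?v t)) * norm (D t)" by (rule norm_cauchy_schwarz)
      also have "\<dots> \<le> L * norm (D t) * norm (D t)" unfolding D_def by (intro mult_right_mono F_lip) auto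
      finally show ?thesis by (simp add: power2_norm_eq_inner[symmetric] power2_eq_square ac_simps)
    qed
    moreover have "D t \<bullet> D' t = (F (?u t) - F (?v t)) \<bullet> D t - (?a - ?b) \<bullet> D t"
      by (simp add: D'_def inner_diff inner_commute algebra_simps)
    ultimately show ?thesis using r(3)[OF t] by linarith
  qed
  have main: "exp (- (2 * L * t)) * (D t \<bullet> D t) - (norm (x - y))\<^sup>2 \<le> integral {0..t} (\<lambda>s. r s - 2 * c * P s)"
    if t: "t \<in> {0..T}" for t
  proof -
    have "exp (- (2 * L * t)) * (D t \<bullet> D t) - exp (- (2 * L * 0)) * (D 0 \<bullet> D 0) \<le> integral {0..t} (\<lambda>s. r s - 2 * c * P s)"
    proof (rule derivative_le_imp_integral_bound)
      fix s assume "s \<in> {0..t}"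
      then have s: "s \<in> {0..T}" using t by auto
      have "(D has_vector_derivative D' s) (at s within {0..t})"
        by (rule has_vector_derivative_within_subset[OF der[OF s]]) (use t in auto)
      from has_real_derivative_inner[OF this this]
      have "((\<lambda>t. D t \<bullet> D t) has_real_derivative 2 * (D s \<bullet> D' s)) (at s within {0..t})"
        by (simp add: inner_commute)
      then show "((\<lambda>t. exp (- (2 * L * t)) * (D t \<bullet> D t)) has_real_derivative
          exp (- (2 * L * s)) * (2 * (D s \<bullet> D' s) - 2 * L * (D s \<bullet> D s))) (at s within {0..t})"
        by (auto intro!: derivative_eq_intros simp: algebra_simps)
      have "exp (- (2 * L * s)) * (2 * (D s \<bullet> D' s) - 2 * L * (D s \<bullet> D s)) \<le> exp (- (2 * L * s)) * (r s - 2 * P s)"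
        using key[OF s] by (intro mult_left_mono) auto
      then have "exp (- (2 * L * s)) * (2 * (D s \<bullet> D' s) - 2 * L * (D s \<bullet> D s)) \<le> exp (- (2 * L * s)) * r s - 2 * (exp (- (2 * L * s)) * P s)" by (simp add: algebra_simps)
      \<comment> \<open>Both \<open>r\<close> and \<open>P\<close> are nonnegative: the integrating
        factor is replaced by its upper bound 1 in front of \<open>r\<close> and by its lower bound
        \<open>c\<close> in front of \<open>P\<close>.\<close>
      moreover have "exp (- (2 * L * s)) * r s \<le> 1 * r s"
        using s L r(2)[OF s] by (intro mult_right_mono) auto
      moreover have "c * P s \<le> exp (- (2 * L * s)) * P s"
        using s L unfolding c_def by (intro mult_right_mono) (auto simp: P_def mult_left_mono)
      ultimately show "exp (- (2 * L * s)) * (2 * (D s \<bullet> D' s) - 2 * L * (D s \<bullet> D s)) \<le> r s - 2 * c * P s"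
        by simp
    next
      show "(\<lambda>s. r s - 2 * c * P s) integrable_on {0..t}"
        by (rule integrable_continuous_real, rule continuous_on_subset[of "{0..T}"])
          (use t in \<open>auto intro!: continuous_intros r contP\<close>)
    qed (use t in auto)
    then show ?thesis by (simp add: D_def yosida_0[OF l] yosida_0[OF m] power2_norm_eq_inner)
  qed
  have intr: "r integrable_on {0..t}" and intP: "P integrable_on {0..t}" if "t \<in> {0..T}" for t
    by (rule integrable_continuous_real, rule continuous_on_subset[of "{0..T}"],
        use that r contP in auto)+
  have int_le: "exp (- (2 * L * t)) * (D t \<bullet> D t) + 2 * c * integral {0..t} P \<le> (norm (x - y))\<^sup>2 + integral {0..T} r"
    if t: "t \<in> {0..T}" for t
  proof -
    have "integral {0..t} (\<lambda>s. r s - 2 * c * P s) = integral {0..t} r - 2 * c * integral {0..t} P"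
      using intr[OF t] intP[OF t] by (subst integral_diff) (auto intro: integrable_on_mult_right)
    moreover have "integral {0..t} r \<le> integral {0..T} r"
      using t r(2) by (intro integral_subset_le intr) auto
    ultimately show ?thesis using main[OF t] by linarith
  qed
  have c_inv: "c * exp (2 * L * T) = 1" by (simp add: c_def exp_minus)
  show "(norm (?u t - ?v t))\<^sup>2 \<le> B" if t: "t \<in> {0..T}" for t
  proof -
    have "c * (D t \<bullet> D t) \<le> exp (- (2 * L * t)) * (D t \<bullet> D t)"
      using t L unfolding c_def by (intro mult_right_mono) (auto simp: mult_left_mono)
    moreover have "0 \<le> 2 * c * integral {0..t} P"
      using c by (intro mult_nonneg_nonneg integral_nonneg intP t) (auto simp: P_def)
    ultimately have "c * (D t \<bullet> D t) \<le> (norm (x - y))\<^sup>2 + integral {0..T} r" using int_le[OF t] by linarith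
    then have "exp (2 * L * T) * (c * (D t \<bullet> D t)) \<le> B" unfolding B_def by (intro mult_left_mono) auto
    then show ?thesis using c_inv
      by (simp add: D_def power2_norm_eq_inner mult.assoc[symmetric] mult.commute[of _ c])
  qed
  have "0 \<le> exp (- (2 * L * T)) * (D T \<bullet> D T)" by simp
  moreover have "0 \<le> integral {0..T} P" using T by (intro integral_nonneg intP) (auto simp: P_def)
  then have "0 \<le> c * integral {0..T} P" using c by simp
  ultimately have "c * integral {0..T} P \<le> (norm (x - y))\<^sup>2 + integral {0..T} r"
    using int_le[of T, unfolded atLeastAtMost_iff] T by linarith
  then have "exp (2 * L * T) * (c * integral {0..T} P) \<le> B" unfolding B_def by (intro mult_left_mono) auto
  then show "integral {0..T} (\<lambda>t. (norm (snd (Jw l (yosida l x t) - Jw m (yosida m y t))))\<^sup>2) \<le> B"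
    using c_inv by (simp add: P_def mult.assoc[symmetric] mult.commute[of _ c])
qed

text \<open>The right side of the energy estimate for the initial value \<open>fst z\<close>, the
  same for all resolvent parameters.\<close>

definition energy :: "'h \<times> 'g \<Rightarrow> real" where "energy z = (norm (snd z))\<^sup>2 + K\<^sup>2 * T"

text \<open>For Yosida terms a and b the cross term obeys -2 (a - b).(l a - m b) \<le> (l + m)(|a|^2
  + |b|^2) \<le> 2 l (|a|^2 + |b|^2). Integrating and using the energy estimate for each of the two
  gives \<open>4 * l * energy z\<close>.\<close>

lemma yosida_compare_parameter:
  assumes l: "l > 0" and m: "0 < m" "m \<le> l" and z: "z \<in> W"
  defines "B \<equiv> exp (2 * L * T) * (4 * l * energy z)"
  shows "t \<in> {0..T} \<Longrightarrow> (norm (yosida l (fst z) t - yosida m (fst z) t))\<^sup>2 \<le> B" (is "?p \<Longrightarrow> ?q")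
    and "integral {0..T} (\<lambda>t. (norm (snd (Jw l (yosida l (fst z) t) - Jw m (yosida m (fst z) t))))\<^sup>2) \<le> B"
proof -
  let ?a = "\<lambda>t. A l (yosida l (fst z) t)" and ?b = "\<lambda>t. A m (yosida m (fst z) t)"
  define r where "r = (\<lambda>t. 2 * l * ((norm (?a t))\<^sup>2 + (norm (?b t))\<^sup>2))"
  have cont: "continuous_on {0..T} (\<lambda>t. (norm (?a t))\<^sup>2)" "continuous_on {0..T} (\<lambda>t. (norm (?b t))\<^sup>2)"
    by (intro continuous_intros continuous_A_yosida l m)+
  have "continuous_on {0..T} r" unfolding r_def by (intro continuous_intros cont)
  moreover have "0 \<le> r t" for t using l by (simp add: r_def)
  moreover have "- (2 * ((?a t - ?b t) \<bullet> (l *\<^sub>R ?a t - m *\<^sub>R ?b t))) \<le> r t" for t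
  proof -
    let ?n = "norm (?a t)" and ?k = "norm (?b t)"
    have "(?a t - ?b t) \<bullet> (l *\<^sub>R ?a t - m *\<^sub>R ?b t) = l * ?n\<^sup>2 + m * ?k\<^sup>2 - (l + m) * (?a t \<bullet> ?b t)"
      unfolding power2_norm_eq_inner by (simp add: inner_diff inner_commute algebra_simps)
    moreover have "(l + m) * (?a t \<bullet> ?b t) \<le> (l + m) * (?n * ?k)"
      using l m by (intro mult_left_mono norm_cauchy_schwarz) auto
    moreover have "(l + m) * (2 * (?n * ?k)) \<le> (l + m) * (?n\<^sup>2 + ?k\<^sup>2)"
      using l m sum_squares_bound[of ?n ?k] by (intro mult_left_mono) (auto simp: ac_simps)
    moreover have "(l + m) * (?n\<^sup>2 + ?k\<^sup>2) \<le> (2 * l) * (?n\<^sup>2 + ?k\<^sup>2)"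
      using l m by (intro mult_right_mono) auto
    moreover have "0 \<le> l * ?n\<^sup>2" "0 \<le> m * ?k\<^sup>2" using l m by auto
    ultimately show ?thesis unfolding r_def by argo
  qed
  ultimately have *: "t \<in> {0..T} \<Longrightarrow> (norm (yosida l (fst z) t - yosida m (fst z) t))\<^sup>2 \<le>
        exp (2 * L * T) * ((norm (fst z - fst z))\<^sup>2 + integral {0..T} r)"
     "integral {0..T} (\<lambda>t. (norm (snd (Jw l (yosida l (fst z) t) - Jw m (yosida m (fst z) t))))\<^sup>2)
        \<le> exp (2 * L * T) * ((norm (fst z - fst z))\<^sup>2 + integral {0..T} r)" for t
    by (intro yosida_compare[OF l m(1)]; simp)+
  have "integral {0..T} r = 2 * l * (integral {0..T} (\<lambda>t. (norm (?a t))\<^sup>2) + integral {0..T} (\<lambda>t. (norm (?b t))\<^sup>2))"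
    unfolding r_def by (simp add: integral_add integrable_continuous_real cont)
  also have "\<dots> \<le> 2 * l * (energy z + energy z)"
    unfolding energy_def using l by (intro mult_left_mono add_mono yosida_energy z m) auto
  finally have "exp (2 * L * T) * ((norm (fst z - fst z))\<^sup>2 + integral {0..T} r) \<le> B"
    unfolding B_def by (intro mult_left_mono) auto
  with * show "?p \<Longrightarrow> ?q"
    "integral {0..T} (\<lambda>t. (norm (snd (Jw l (yosida l (fst z) t) - Jw m (yosida m (fst z) t))))\<^sup>2) \<le> B"
    by force+
qed

text \<open>For equal parameters the cross term is \<open>l\<close> times a squared norm, so the
  bound \<open>r\<close> can be taken to be 0.\<close>

lemma yosida_compare_initial:
  fixes x y :: 'h
  assumes l: "l > 0"
  defines "B \<equiv> exp (2 * L * T) * (norm (x - y))\<^sup>2"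
  shows "t \<in> {0..T} \<Longrightarrow> (norm (yosida l x t - yosida l y t))\<^sup>2 \<le> B" (is "?p \<Longrightarrow> ?q")
    and "integral {0..T} (\<lambda>t. (norm (snd (Jw l (yosida l x t) - Jw l (yosida l y t))))\<^sup>2) \<le> B"
proof -
  have "- (2 * ((a - b) \<bullet> (l *\<^sub>R a - l *\<^sub>R b))) \<le> 0" for a b :: 'h
    using l by (simp add: scaleR_diff_right[symmetric])
  then have *: "t \<in> {0..T} \<Longrightarrow> (norm (yosida l x t - yosida l y t))\<^sup>2 \<le>
        exp (2 * L * T) * ((norm (x - y))\<^sup>2 + integral {0..T} (\<lambda>_. 0))"
     "integral {0..T} (\<lambda>t. (norm (snd (Jw l (yosida l x t) - Jw l (yosida l y t))))\<^sup>2)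
        \<le> exp (2 * L * T) * ((norm (x - y))\<^sup>2 + integral {0..T} (\<lambda>_. 0))" for t
    by (intro yosida_compare[OF l l]; simp)+
  then show "?p \<Longrightarrow> ?q" "integral {0..T} (\<lambda>t. (norm (snd (Jw l (yosida l x t) - Jw l (yosida l y t))))\<^sup>2) \<le> B"
    by (simp_all add: B_def)
qed

text \<open>Comparing two different parameters costs the energy of the common initial value times the
  larger parameter.  Changing the initial values at the smaller parameter therefore keeps each
  energy paired with its own parameter.\<close>

lemma yosida_estimate:
  assumes l: "0 < l" "l \<le> 1" and m: "0 < m" "m \<le> 1" and z: "z \<in> W" "z' \<in> W"
  defines "\<delta> \<equiv> l * energy z + m * energy z' + (norm (fst z - fst z'))\<^sup>2"
  defines "C \<equiv> 12 * exp (2 * L * T)"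
  shows "t \<in> {0..T} \<Longrightarrow> (norm (yosida l (fst z) t - yosida m (fst z') t))\<^sup>2 \<le> C * \<delta>"
    and "integral {0..T} (\<lambda>t. (norm (Jw l (yosida l (fst z) t) - Jw m (yosida m (fst z') t)))\<^sup>2)
      \<le> (3 * T * C + 3 + C) * \<delta>"
proof -
  define n where "n = min l m"
  have n: "0 < n" "n \<le> l" "n \<le> m" using l m by (auto simp: n_def)
  let ?x = "fst z" and ?y = "fst z'"
  have en: "0 \<le> energy z" "0 \<le> energy z'" using T by (auto simp: energy_def)
  \<comment> \<open>The constant 12 is 3, from squaring a sum of three terms, times 4, from the
    comparison of parameters. The term with the initial values carries only the factor 3, which
    leaves the slack of 9.\<close>
  have chain: "3 * (exp (2 * L * T) * (4 * l * energy z) + exp (2 * L * T) * (norm (?x - ?y))\<^sup>2 +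
      exp (2 * L * T) * (4 * m * energy z')) \<le> C * \<delta>"
  proof -
    have "C * \<delta> - 3 * (exp (2 * L * T) * (4 * l * energy z) + exp (2 * L * T) * (norm (?x - ?y))\<^sup>2 +
      exp (2 * L * T) * (4 * m * energy z')) = 9 * exp (2 * L * T) * (norm (?x - ?y))\<^sup>2"
      by (simp add: C_def \<delta>_def algebra_simps)
    then show ?thesis by (smt (verit) mult_nonneg_nonneg exp_ge_zero zero_le_power2)
  qed
  show A: "(norm (yosida l ?x t - yosida m ?y t))\<^sup>2 \<le> C * \<delta>" if t: "t \<in> {0..T}" for t
  proof -
    have "(norm (yosida l ?x t - yosida m ?y t))\<^sup>2 \<le> 3 * ((norm (yosida l ?x t - yosida n ?x t))\<^sup>2 +
        (norm (yosida n ?x t - yosida n ?y t))\<^sup>2 + (norm (yosida n ?y t - yosida m ?y t))\<^sup>2)"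
      using norm_sum3_sq[of "yosida l ?x t - yosida n ?x t" "yosida n ?x t - yosida n ?y t" "yosida n ?y t - yosida m ?y t"]
      by simp
    also have "\<dots> \<le> 3 * (exp (2 * L * T) * (4 * l * energy z) + exp (2 * L * T) * (norm (?x - ?y))\<^sup>2 +
      exp (2 * L * T) * (4 * m * energy z'))"
      using yosida_compare_parameter(1)[OF l(1) n(1,2) z(1) t] yosida_compare_initial(1)[OF n(1) t, of ?x ?y]
        yosida_compare_parameter(1)[OF m(1) n(1,3) z(2) t]
      by (intro mult_left_mono add_mono) (auto simp: norm_minus_commute)
    finally show ?thesis using chain by linarith
  qed
  let ?J = "\<lambda>l x t. Jw l (yosida l x t)"
  have int: "(\<lambda>t. (norm (fst (?J l x t - ?J m y t)))\<^sup>2) integrable_on {0..T}"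
    "(\<lambda>t. (norm (snd (?J l x t - ?J m y t)))\<^sup>2) integrable_on {0..T}"
    "(\<lambda>t. (norm (yosida l x t - yosida m y t))\<^sup>2) integrable_on {0..T}"
    "(\<lambda>t. (norm (A l (yosida l x t)))\<^sup>2) integrable_on {0..T}"
    if "0 < l" "0 < m" for l m x y
    using that by (auto intro!: integrable_continuous_real continuous_intros continuous_Jw_yosida
        continuous_yosida continuous_A_yosida simp del: fst_diff snd_diff)
  have "integral {0..T} (\<lambda>t. (norm (snd (?J l ?x t - ?J m ?y t)))\<^sup>2) \<le> integral {0..T} (\<lambda>t. 3 * (
      (norm (snd (?J l ?x t - ?J n ?x t)))\<^sup>2 + (norm (snd (?J n ?x t - ?J n ?y t)))\<^sup>2 + (norm (snd (?J m ?y t - ?J n ?y t)))\<^sup>2))"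
  proof (rule integral_le)
    show "(norm (snd (?J l ?x t - ?J m ?y t)))\<^sup>2 \<le> 3 * (
      (norm (snd (?J l ?x t - ?J n ?x t)))\<^sup>2 + (norm (snd (?J n ?x t - ?J n ?y t)))\<^sup>2 + (norm (snd (?J m ?y t - ?J n ?y t)))\<^sup>2)" for t
      using norm_sum3_sq[of "snd (?J l ?x t - ?J n ?x t)" "snd (?J n ?x t - ?J n ?y t)" "snd (?J n ?y t - ?J m ?y t)"]
      by (simp add: norm_minus_commute)
  qed (intro integrable_on_mult_right integrable_add int l m n)+
  also have "\<dots> = 3 * (integral {0..T} (\<lambda>t. (norm (snd (?J l ?x t - ?J n ?x t)))\<^sup>2) +
      integral {0..T} (\<lambda>t. (norm (snd (?J n ?x t - ?J n ?y t)))\<^sup>2) + integral {0..T} (\<lambda>t. (norm (snd (?J m ?y t - ?J n ?y t)))\<^sup>2))"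
    unfolding integral_mult_right by (simp only: integral_add integrable_add int l m n)
  also have "\<dots> \<le> 3 * (exp (2 * L * T) * (4 * l * energy z) + exp (2 * L * T) * (norm (?x - ?y))\<^sup>2 +
      exp (2 * L * T) * (4 * m * energy z'))"
    by (intro mult_left_mono add_mono yosida_compare_parameter(2) yosida_compare_initial(2) l m n z) auto
  also note chain
  finally have snd_le: "integral {0..T} (\<lambda>t. (norm (snd (?J l ?x t - ?J m ?y t)))\<^sup>2) \<le> C * \<delta>" .
  \<comment> \<open>The first component of the resolvent of v is v - l A v. As \<open>l\<close> is
    at most 1, l^2 may be replaced by l, and the energy estimate again produces
    \<open>l * energy z\<close>.\<close>
  have "integral {0..T} (\<lambda>t. (norm (fst (?J l ?x t - ?J m ?y t)))\<^sup>2) \<le> integral {0..T} (\<lambda>t. 3 * (C * \<delta> +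
      l * (norm (A l (yosida l ?x t)))\<^sup>2 + m * (norm (A m (yosida m ?y t)))\<^sup>2))"
  proof (rule integral_le)
    fix t assume t: "t \<in> {0..T}"
    have "fst (Jw l x) = x + - (l *\<^sub>R A l x)" if "0 < l" for l x using decomp[OF that, of x] by (simp add: algebra_simps)
    then have *: "fst (?J l ?x t - ?J m ?y t) = (yosida l ?x t - yosida m ?y t) + - (l *\<^sub>R A l (yosida l ?x t))
        + m *\<^sub>R A m (yosida m ?y t)"
      using l m by simp
    have "(norm (fst (?J l ?x t - ?J m ?y t)))\<^sup>2 \<le> 3 * ((norm (yosida l ?x t - yosida m ?y t))\<^sup>2 +
        l\<^sup>2 * (norm (A l (yosida l ?x t)))\<^sup>2 + m\<^sup>2 * (norm (A m (yosida m ?y t)))\<^sup>2)"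
      unfolding * by (rule order_trans[OF norm_sum3_sq]) (simp add: power_mult_distrib)
    also have "\<dots> \<le> 3 * (C * \<delta> + l * (norm (A l (yosida l ?x t)))\<^sup>2 + m * (norm (A m (yosida m ?y t)))\<^sup>2)"
      using l m by (intro mult_left_mono add_mono mult_right_mono A t) (auto simp: power2_eq_square mult_left_le)
    finally show "(norm (fst (?J l ?x t - ?J m ?y t)))\<^sup>2 \<le> 3 * (C * \<delta> + l * (norm (A l (yosida l ?x t)))\<^sup>2 + m * (norm (A m (yosida m ?y t)))\<^sup>2)" .
  qed (intro integrable_on_mult_right integrable_add int[OF l(1) m(1)] int[OF l(1) l(1)] int[OF m(1) m(1)] integrable_const_ivl)+
  also have "\<dots> = 3 * (C * \<delta> * T + l * integral {0..T} (\<lambda>t. (norm (A l (yosida l ?x t)))\<^sup>2) + m * integral {0..T} (\<lambda>t. (norm (A m (yosida m ?y t)))\<^sup>2))"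
  proof (rule integral_unique)
    have "((\<lambda>_. C * \<delta>) has_integral C * \<delta> * T) {0..T}"
      using has_integral_const_real[of "C * \<delta>" 0 T] T by (simp add: mult.commute)
    then show "((\<lambda>t. 3 * (C * \<delta> + l * (norm (A l (yosida l ?x t)))\<^sup>2 + m * (norm (A m (yosida m ?y t)))\<^sup>2)) has_integral
        3 * (C * \<delta> * T + l * integral {0..T} (\<lambda>t. (norm (A l (yosida l ?x t)))\<^sup>2) + m * integral {0..T} (\<lambda>t. (norm (A m (yosida m ?y t)))\<^sup>2))) {0..T}"
      by (intro has_integral_mult_right has_integral_add integrable_integral int[OF l(1) l(1)] int[OF m(1) m(1)])
  qed
  also have "\<dots> \<le> 3 * (C * \<delta> * T + l * energy z + m * energy z')"
  proof -
    have "3 * (c + a + b) \<le> 3 * (c + a' + b')" if "a \<le> a'" "b \<le> b'" for a b a' b' c :: real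
      using that by simp
    from this[OF mult_left_mono[OF yosida_energy[OF l(1) z(1)] less_imp_le[OF l(1)]]
      mult_left_mono[OF yosida_energy[OF m(1) z(2)] less_imp_le[OF m(1)]]]
    show ?thesis unfolding energy_def .
  qed
  also have "\<dots> \<le> 3 * (C * \<delta> * T + \<delta>)" by (simp add: \<delta>_def)
  finally have fst_le: "integral {0..T} (\<lambda>t. (norm (fst (?J l ?x t - ?J m ?y t)))\<^sup>2) \<le> (3 * T * C + 3) * \<delta>"
    by (simp add: algebra_simps)
  have "(norm w)\<^sup>2 = (norm (fst w))\<^sup>2 + (norm (snd w))\<^sup>2" for w :: "'h \<times> 'g"
    by (simp add: norm_prod_def)
  then have "integral {0..T} (\<lambda>t. (norm (?J l ?x t - ?J m ?y t))\<^sup>2) =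
      integral {0..T} (\<lambda>t. (norm (fst (?J l ?x t - ?J m ?y t)))\<^sup>2) + integral {0..T} (\<lambda>t. (norm (snd (?J l ?x t - ?J m ?y t)))\<^sup>2)"
    by (simp only: integral_add int l m)
  with fst_le snd_le show "integral {0..T} (\<lambda>t. (norm (?J l ?x t - ?J m ?y t))\<^sup>2) \<le> (3 * T * C + 3 + C) * \<delta>"
    by (simp only: distrib_right)
qed

text \<open>What the abstract theory hands to the concrete problem: \<open>v\<close> are the
  approximate solutions, \<open>w\<close> elements of \<open>W\<close> that carry their gradients,
  and \<open>d\<close> the time derivatives. By the last clause \<open>v\<close> and the first
  components of \<open>w\<close> have the same limit, so the limit of \<open>w\<close> lifts the
  limit of \<open>v\<close> to \<open>W\<close>.\<close>

definition approximates :: "(nat \<Rightarrow> real \<Rightarrow> 'h) \<Rightarrow> (nat \<Rightarrow> real \<Rightarrow> 'h \<times> 'g) \<Rightarrow> (nat \<Rightarrow> real \<Rightarrow> 'h) \<Rightarrow> 'h \<Rightarrow> bool" where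
  "approximates v w d x \<longleftrightarrow>
     (\<forall>n. continuous_on {0..T} (w n) \<and> w n ` {0..T} \<subseteq> W \<and> continuous_on {0..T} (d n) \<and>
       (\<forall>t\<in>{0..T}. (v n has_vector_derivative d n t) (at t within {0..T}) \<and>
          (\<forall>y\<in>W. d n t \<bullet> fst y = F (v n t) \<bullet> fst y - snd (w n t) \<bullet> snd y))) \<and>
     (\<lambda>n. v n 0) \<longlonglongrightarrow> x \<and>
     (\<forall>e>0. \<exists>N. \<forall>m\<ge>N. \<forall>n\<ge>N. \<forall>t\<in>{0..T}. (norm (v m t - v n t))\<^sup>2 \<le> e) \<and>
     (\<forall>e>0. \<exists>N. \<forall>m\<ge>N. \<forall>n\<ge>N. integral {0..T} (\<lambda>t. (norm (w m t - w n t))\<^sup>2) \<le> e) \<and>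
     (\<lambda>n. integral {0..T} (\<lambda>t. (norm (fst (w n t) - v n t))\<^sup>2)) \<longlonglongrightarrow> 0"

text \<open>Initial values in the form domain approach \<open>x\<close> while their energies may
  grow; the parameters are taken so small that parameter times energy still tends to 0.\<close>

theorem approximate_solutions_exist:
  assumes x: "x \<in> closure (fst ` W)"
  shows "\<exists>v w d. approximates v w d x"
proof -
  have "\<exists>z\<in>W. norm (fst z - x) < inverse (real (Suc n))" for n
    using x[unfolded closure_approachable, rule_format, of "inverse (real (Suc n))"] by (auto simp: dist_norm)
  then obtain z where z: "\<And>n. z n \<in> W" "\<And>n. norm (fst (z n) - x) < inverse (real (Suc n))" by metis
  \<comment> \<open>Dividing by 1 plus the energy bounds both \<open>l n\<close> and
    \<open>l n * energy (z n)\<close> by 1/(n+1).\<close>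
  define l where "l = (\<lambda>n. 1 / (real (Suc n) * (1 + energy (z n))))"
  have en: "0 \<le> energy y" for y using T by (simp add: energy_def)
  have l: "0 < l n" for n using en[of "z n"] by (simp add: l_def)
  have le: "l n * energy (z n) \<le> inverse (real (Suc n))" "l n \<le> inverse (real (Suc n))" for n
  proof -
    have *: "l n * r \<le> inverse (real (Suc n))" if "r \<le> 1 + energy (z n)" for r
    proof -
      have "r / (1 + energy (z n)) \<le> 1" using that en[of "z n"] by (simp add: divide_le_eq_1)
      then have "inverse (real (Suc n)) * (r / (1 + energy (z n))) \<le> inverse (real (Suc n)) * 1"
        by (intro mult_left_mono) auto
      then show ?thesis by (simp add: l_def divide_inverse ac_simps)
    qed
    show "l n * energy (z n) \<le> inverse (real (Suc n))" "l n \<le> inverse (real (Suc n))"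
      using *[of "energy (z n)"] *[of 1] en[of "z n"] by simp_all
  qed
  have l1: "l n \<le> 1" for n by (rule order_trans[OF le(2)]) (simp add: field_simps)
  define v where "v = (\<lambda>n. yosida (l n) (fst (z n)))"
  define w where "w = (\<lambda>n t. Jw (l n) (v n t))"
  define d where "d = (\<lambda>n t. F (v n t) - A (l n) (v n t))"
  define C where "C = 12 * exp (2 * L * T) + (3 * T * (12 * exp (2 * L * T)) + 3 + 12 * exp (2 * L * T))"
  have C: "C > 0" using T by (auto simp: C_def intro!: add_pos_pos)
  define \<delta> where "\<delta> = (\<lambda>m n. l m * energy (z m) + l n * energy (z n) + (norm (fst (z m) - fst (z n)))\<^sup>2)"
  have \<delta>: "0 \<le> \<delta> m n" for m n using en l[THEN less_imp_le] by (simp add: \<delta>_def)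
  have est: "t \<in> {0..T} \<Longrightarrow> (norm (v m t - v n t))\<^sup>2 \<le> C * \<delta> m n"
    "integral {0..T} (\<lambda>t. (norm (w m t - w n t))\<^sup>2) \<le> C * \<delta> m n" for m n t
  proof -
    have "12 * exp (2 * L * T) * \<delta> m n \<le> C * \<delta> m n" "(3 * T * (12 * exp (2 * L * T)) + 3 + 12 * exp (2 * L * T)) * \<delta> m n \<le> C * \<delta> m n"
      using T by (intro mult_right_mono \<delta>, simp add: C_def)+
    note le = this[unfolded \<delta>_def]
      and est = yosida_estimate[OF l[of m] l1[of m] l[of n] l1[of n] z(1)[of m] z(1)[of n]]
    show "(norm (v m t - v n t))\<^sup>2 \<le> C * \<delta> m n" if "t \<in> {0..T}"
      unfolding v_def \<delta>_def by (rule order_trans[OF est(1)[OF that] le(1)])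
    show "integral {0..T} (\<lambda>t. (norm (w m t - w n t))\<^sup>2) \<le> C * \<delta> m n"
      unfolding v_def w_def \<delta>_def by (rule order_trans[OF est(2) le(2)])
  qed
  \<comment> \<open>The constant 6 collects one unit from each energy term and four from the squared
    distance of the initial values, which is at most (2/(N+1))^2.\<close>
  have small: "\<exists>N. \<forall>m\<ge>N. \<forall>n\<ge>N. C * \<delta> m n \<le> e" if e: "e > 0" for e
  proof -
    obtain N where N: "inverse (real (Suc N)) < e / (6 * C)"
      using reals_Archimedean[of "e / (6 * C)"] e C by auto
    have "C * \<delta> m n \<le> e" if "m \<ge> N" "n \<ge> N" for m n
    proof -
      have inv: "inverse (real (Suc m)) \<le> inverse (real (Suc N))" "inverse (real (Suc n)) \<le> inverse (real (Suc N))"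
        using that by (auto simp: field_simps)
      have "norm (fst (z m) - fst (z n)) \<le> inverse (real (Suc m)) + inverse (real (Suc n))"
        using z(2)[of m] z(2)[of n] norm_triangle_ineq4[of "fst (z m) - x" "fst (z n) - x"] by simp
      then have "norm (fst (z m) - fst (z n)) \<le> 2 * inverse (real (Suc N))" using inv by linarith
      then have "(norm (fst (z m) - fst (z n)))\<^sup>2 \<le> (2 * inverse (real (Suc N)))\<^sup>2"
        by (rule power_mono) auto
      also have "\<dots> = 4 * (inverse (real (Suc N)) * inverse (real (Suc N)))" by (simp add: power2_eq_square)
      also have "\<dots> \<le> 4 * (inverse (real (Suc N)) * 1)"
        by (intro mult_left_mono) (auto simp: field_simps)
      finally have "\<delta> m n \<le> 6 * inverse (real (Suc N))"
        using le(1)[of m] le(1)[of n] inv unfolding \<delta>_def by linarith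
      also have "\<dots> < e / C" using N by simp
      finally show ?thesis using C by (simp add: field_simps)
    qed
    then show ?thesis by blast
  qed
  have "approximates v w d x"
    unfolding approximates_def
  proof (intro conjI allI ballI impI)
    fix n
    show "continuous_on {0..T} (w n)" unfolding w_def v_def by (rule continuous_Jw_yosida[OF l])
    show "w n ` {0..T} \<subseteq> W" using Jw_mem[OF l] by (auto simp: w_def)
    show "continuous_on {0..T} (d n)"
      unfolding d_def v_def by (intro continuous_intros continuous_F_yosida continuous_A_yosida l)
    show "(v n has_vector_derivative d n t) (at t within {0..T})" if "t \<in> {0..T}" for t
      unfolding d_def v_def by (rule yosida_deriv[OF l that])
    show "d n t \<bullet> fst y = F (v n t) \<bullet> fst y - snd (w n t) \<bullet> snd y" if "y \<in> W" for t y
      unfolding d_def w_def by (simp add: inner_diff_left A_weak[OF l that])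
  next
    have "(\<lambda>n. fst (z n) - x) \<longlonglongrightarrow> 0"
      by (rule Lim_null_comparison[OF _ LIMSEQ_inverse_real_of_nat]) (use z(2)[THEN less_imp_le] in auto)
    then show "(\<lambda>n. v n 0) \<longlonglongrightarrow> x" unfolding v_def by (simp add: yosida_0[OF l] LIM_zero_iff)
  next
    fix e :: real assume e: "e > 0"
    show "\<exists>N. \<forall>m\<ge>N. \<forall>n\<ge>N. \<forall>t\<in>{0..T}. (norm (v m t - v n t))\<^sup>2 \<le> e"
      using small[OF e] est(1) order_trans by meson
    show "\<exists>N. \<forall>m\<ge>N. \<forall>n\<ge>N. integral {0..T} (\<lambda>t. (norm (w m t - w n t))\<^sup>2) \<le> e"
      using small[OF e] est(2) order_trans by meson
  next
    show "(\<lambda>n. integral {0..T} (\<lambda>t. (norm (fst (w n t) - v n t))\<^sup>2)) \<longlonglongrightarrow> 0"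
    proof (rule Lim_null_comparison[OF _ LIMSEQ_inverse_real_of_nat], intro always_eventually allI)
      fix n
      \<comment> \<open>The gap is \<open>l n\<close> times the Yosida term, so its squared L2 norm
        is at most (l n)^2 times the energy.\<close>
      have "fst (w n t) - v n t = - (l n *\<^sub>R A (l n) (v n t))" for t
        unfolding w_def using decomp[OF l, of "v n t" n] by (simp add: algebra_simps)
      then have "integral {0..T} (\<lambda>t. (norm (fst (w n t) - v n t))\<^sup>2) = (l n)\<^sup>2 * integral {0..T} (\<lambda>t. (norm (A (l n) (v n t)))\<^sup>2)"
        by (simp add: power_mult_distrib)
      also have "\<dots> \<le> (l n)\<^sup>2 * energy (z n)"
        unfolding energy_def v_def by (intro mult_left_mono yosida_energy l z) auto
      also have "\<dots> \<le> l n * energy (z n)"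
        using l[of n] l1[of n] en[of "z n"] by (intro mult_right_mono) (auto simp: power2_eq_square mult_left_le)
      also have "\<dots> \<le> inverse (real (Suc n))" by (rule le)
      finally show "norm (integral {0..T} (\<lambda>t. (norm (fst (w n t) - v n t))\<^sup>2)) \<le> inverse (real (Suc n))"
        by (simp add: integral_nonneg integrable_continuous_real w_def v_def continuous_Jw_yosida[OF l] continuous_yosida[OF l] continuous_intros)
    qed
  qed
  then show ?thesis by blast
qed

text \<open>The resolvent of the difference of two weak solutions is classically differentiable in
  time, so the usual energy argument applies to it; then let the resolvent parameter vanish.\<close>

lemma weak_solutions_stable:
  assumes cont: "continuous_on {0..T} u" "continuous_on {0..T} v"
    and cl: "\<And>t. t \<in> {0..T} \<Longrightarrow> u t \<in> closure (fst ` W)" "\<And>t. t \<in> {0..T} \<Longrightarrow> v t \<in> closure (fst ` W)"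
    and eq: "\<And>l h t. 0 < l \<Longrightarrow> t \<in> {0..T} \<Longrightarrow> (u t - u 0) \<bullet> fst (Jw l h) =
        integral {0..t} (\<lambda>s. F (u s) \<bullet> fst (Jw l h) - u s \<bullet> A l h)"
      "\<And>l h t. 0 < l \<Longrightarrow> t \<in> {0..T} \<Longrightarrow> (v t - v 0) \<bullet> fst (Jw l h) =
        integral {0..t} (\<lambda>s. F (v s) \<bullet> fst (Jw l h) - v s \<bullet> A l h)"
    and t: "t \<in> {0..T}"
  shows "(norm (u t - v t))\<^sup>2 \<le> exp (2 * L * T) * (norm (u 0 - v 0))\<^sup>2"
proof -
  define z where "z = (\<lambda>t. u t - v t)"
  define g where "g = (\<lambda>t. F (u t) - F (v t))"
  have contz: "continuous_on {0..T} z" unfolding z_def by (intro continuous_intros cont)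
  have contg: "continuous_on {0..T} g" unfolding g_def
    by (intro continuous_on_diff continuous_on_compose2[OF continuous_F] cont) auto
  have est: "(norm (fst (Jw l (z t))))\<^sup>2 - (norm (fst (Jw l (z 0))))\<^sup>2 \<le> integral {0..t} (\<lambda>s. 2 * L * (norm (z s))\<^sup>2)"
    if l: "0 < l" and t: "t \<in> {0..T}" for l t
  proof -
    define y where "y = (\<lambda>t. fst (Jw l (z t)))"
    define y' where "y' = (\<lambda>t. fst (Jw l (g t)) - A l (z t))"
    have blJ: "bounded_linear (\<lambda>x. fst (Jw l x))"
      by (rule bounded_linear_compose[OF bounded_linear_fst Jw_bounded_linear[OF l]])
    have conty': "continuous_on {0..T} y'" unfolding y'_def
      by (intro continuous_on_diff bounded_linear.continuous_on[OF blJ contg]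
          bounded_linear.continuous_on[OF A_bounded_linear[OF l] contz])
    \<comment> \<open>Symmetry moves the resolvent onto the test vector, where the assumed
      identities apply. As \<open>h\<close> is arbitrary, the scalar identities combine into a
      vector identity with a continuous integrand, whence the classical derivative of
      \<open>y\<close>.\<close>
    have y_eq: "y t = y 0 + integral {0..t} y'" if t: "t \<in> {0..T}" for t
    proof -
      have int: "y' integrable_on {0..t}"
        by (rule integrable_continuous_real, rule continuous_on_subset[OF conty']) (use t in auto)
      have "(y t - y 0) \<bullet> h = integral {0..t} y' \<bullet> h" for h
      proof -
        have ints: "(\<lambda>s. F (f s) \<bullet> fst (Jw l h) - f s \<bullet> A l h) integrable_on {0..t}"
          if "continuous_on {0..T} f" for f
        proof (rule integrable_continuous_real)
          have *: "continuous_on {0..t} f" by (rule continuous_on_subset[OF that]) (use t in auto)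
          show "continuous_on {0..t} (\<lambda>s. F (f s) \<bullet> fst (Jw l h) - f s \<bullet> A l h)"
            by (intro continuous_intros continuous_on_compose2[OF continuous_F *] *) auto
        qed
        have "(y t - y 0) \<bullet> h = (z t - z 0) \<bullet> fst (Jw l h)"
          by (simp add: y_def inner_diff_left J_sym[OF l])
        also have "\<dots> = (u t - u 0) \<bullet> fst (Jw l h) - (v t - v 0) \<bullet> fst (Jw l h)"
          by (simp add: z_def inner_diff_left)
        also have "\<dots> = integral {0..t} (\<lambda>s. (F (u s) \<bullet> fst (Jw l h) - u s \<bullet> A l h) - (F (v s) \<bullet> fst (Jw l h) - v s \<bullet> A l h))"
          unfolding eq(1)[OF l t] eq(2)[OF l t] by (rule integral_diff[symmetric]) (intro ints cont)+
        also have "\<dots> = integral {0..t} (\<lambda>s. y' s \<bullet> h)"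
          by (rule arg_cong[of _ _ "integral {0..t}"])
            (simp add: fun_eq_iff y'_def g_def z_def inner_diff_left inner_diff_right J_sym[OF l] A_sym[OF l])
        also have "\<dots> = integral {0..t} y' \<bullet> h"
          using integral_linear[OF int bounded_linear_inner_left, of h] by (simp add: o_def)
        finally show ?thesis .
      qed
      then have "y t - y 0 = integral {0..t} y'" by (metis inner_commute vector_eq_ldot)
      then show ?thesis by (simp add: algebra_simps)
    qed
    have dery: "(y has_vector_derivative y' s) (at s within {0..t})" if s: "s \<in> {0..t}" for s
    proof -
      have "((\<lambda>t. y 0 + integral {0..t} y') has_vector_derivative 0 + y' s) (at s within {0..T})"
        using s t by (intro has_vector_derivative_add has_vector_derivative_const integral_has_vector_derivative conty') auto
      then have "(y has_vector_derivative y' s) (at s within {0..T})"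
        using s t by (intro has_vector_derivative_transform[OF _ y_eq]) auto
      then show ?thesis by (rule has_vector_derivative_within_subset) (use t in auto)
    qed
    have "y t \<bullet> y t - y 0 \<bullet> y 0 \<le> integral {0..t} (\<lambda>s. 2 * L * (norm (z s))\<^sup>2)"
    proof (rule derivative_le_imp_integral_bound)
      fix s assume s: "s \<in> {0..t}"
      from has_real_derivative_inner[OF dery[OF s] dery[OF s]]
      show "((\<lambda>t. y t \<bullet> y t) has_real_derivative 2 * (y s \<bullet> y' s)) (at s within {0..t})"
        by (simp add: inner_commute)
      have "y s \<bullet> y' s = y s \<bullet> fst (Jw l (g s)) - A l (z s) \<bullet> fst (Jw l (z s))"
        by (simp add: y'_def y_def inner_diff_right inner_commute)
      \<comment> \<open>The discarded term is the squared norm of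
        \<open>snd (Jw l (z s))\<close>.\<close>
      also have "\<dots> \<le> y s \<bullet> fst (Jw l (g s))" using A_weak[OF l Jw_mem[OF l]] by simp
      also have "\<dots> \<le> norm (y s) * norm (fst (Jw l (g s)))" by (rule norm_cauchy_schwarz)
      also have "\<dots> \<le> norm (z s) * (L * norm (z s))"
      proof (intro mult_mono)
        show "norm (y s) \<le> norm (z s)" unfolding y_def by (rule norm_J[OF l])
        show "norm (fst (Jw l (g s))) \<le> L * norm (z s)"
          using norm_J[OF l, of "g s"] F_lip[of "u s" "v s"] by (simp add: g_def z_def)
      qed auto
      finally show "2 * (y s \<bullet> y' s) \<le> 2 * L * (norm (z s))\<^sup>2" by (simp add: power2_eq_square ac_simps)
    next
      show "(\<lambda>s. 2 * L * (norm (z s))\<^sup>2) integrable_on {0..t}"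
        by (rule integrable_continuous_real, intro continuous_intros continuous_on_subset[OF contz]) (use t in auto)
    qed (use t in auto)
    then show ?thesis by (simp add: y_def power2_norm_eq_inner)
  qed
  \<comment> \<open>Convergence of the resolvents is known at \<open>u t\<close> and
    \<open>v t\<close>, which lie in the closure of the form domain; linearity transfers it to the
    difference.\<close>
  have z_cl: "((\<lambda>l. fst (Jw l (z t))) \<longlongrightarrow> z t) (at_right 0)" if "t \<in> {0..T}" for t
  proof (rule Lim_transform_eventually)
    show "((\<lambda>l. fst (Jw l (u t)) - fst (Jw l (v t))) \<longlongrightarrow> z t) (at_right 0)"
      unfolding z_def using that by (intro tendsto_diff J_tendsto cl)
    show "\<forall>\<^sub>F l in at_right 0. fst (Jw l (u t)) - fst (Jw l (v t)) = fst (Jw l (z t))"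
      using eventually_at_right_less[of 0] by eventually_elim (simp add: z_def Jw_diff)
  qed
  define p where "p = (\<lambda>t. (norm (z t))\<^sup>2)"
  have contp: "continuous_on {0..T} p" unfolding p_def by (intro continuous_intros contz)
  have gron: "p t \<le> p 0 + integral {0..t} (\<lambda>s. 2 * L * p s)" if t: "t \<in> {0..T}" for t
  proof -
    have "((\<lambda>l. (norm (fst (Jw l (z t))))\<^sup>2 - (norm (fst (Jw l (z 0))))\<^sup>2) \<longlongrightarrow> p t - p 0) (at_right 0)"
      unfolding p_def using t by (intro tendsto_intros z_cl) auto
    moreover have "\<forall>\<^sub>F l in at_right 0. (norm (fst (Jw l (z t))))\<^sup>2 - (norm (fst (Jw l (z 0))))\<^sup>2 \<le> integral {0..t} (\<lambda>s. 2 * L * p s)"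
      unfolding p_def using eventually_at_right_less[of 0] by eventually_elim (rule est[OF _ t])
    ultimately have "p t - p 0 \<le> integral {0..t} (\<lambda>s. 2 * L * p s)"
      by (intro tendsto_upperbound[of _ "p t - p 0" "at_right 0"]) auto
    then show ?thesis by linarith
  qed
  \<comment> \<open>Gronwall in integral form: the majorant q is differentiable by construction, and
    q' = 2 L p \<le> 2 L q.\<close>
  define q where "q = (\<lambda>t. p 0 + integral {0..t} (\<lambda>s. 2 * L * p s))"
  have "exp (- (2 * L * t)) * q t - exp (- (2 * L * 0)) * q 0 \<le> integral {0..t} (\<lambda>_. 0)"
  proof (rule derivative_le_imp_integral_bound)
    fix s assume s: "s \<in> {0..t}"
    have "(q has_vector_derivative 0 + 2 * L * p s) (at s within {0..T})"
      unfolding q_def using s t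
      by (intro has_vector_derivative_add has_vector_derivative_const integral_has_vector_derivative continuous_intros contp) auto
    then have "(q has_real_derivative 2 * L * p s) (at s within {0..t})"
      unfolding has_real_derivative_iff_has_vector_derivative
      using has_vector_derivative_within_subset[of q "2 * L * p s" s "{0..T}" "{0..t}"] t by auto
    then show "((\<lambda>t. exp (- (2 * L * t)) * q t) has_real_derivative exp (- (2 * L * s)) * (2 * L * (p s - q s))) (at s within {0..t})"
      by (auto intro!: derivative_eq_intros simp: algebra_simps)
    have "p s \<le> q s" unfolding q_def using s t by (intro gron) auto
    then show "exp (- (2 * L * s)) * (2 * L * (p s - q s)) \<le> 0"
      using L by (simp add: mult_nonneg_nonpos)
  qed (use t in auto)
  then have "exp (- (2 * L * t)) * q t \<le> p 0" by (simp add: q_def)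
  then have "exp (2 * L * t) * (exp (- (2 * L * t)) * q t) \<le> exp (2 * L * t) * p 0" by (intro mult_left_mono) auto
  then have "q t \<le> exp (2 * L * t) * p 0" by (simp add: mult.assoc[symmetric] exp_minus)
  also have "\<dots> \<le> exp (2 * L * T) * p 0"
    using t L by (intro mult_right_mono) (auto simp: p_def mult_left_mono)
  finally show ?thesis using gron[OF t] by (simp add: q_def p_def z_def)
qed

end

subsection \<open>The Hilbert space L2\<close>

text \<open>Only distances between members are assumed measurable, because the target is not assumed
  separable; this serves both the completeness of L2 and functions of time with values in a Hilbert
  space. A fast subsequence converges almost everywhere, and Fatou's lemma turns this into L2
  convergence of the whole sequence.\<close>

lemma L2_Cauchy_imp_limit:
  fixes g :: "nat \<Rightarrow> 'a \<Rightarrow> 'b::banach"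
  assumes meas: "\<And>m n. (\<lambda>t. norm (g m t - g n t)) \<in> borel_measurable M"
    and Cauchy: "\<And>e. e > 0 \<Longrightarrow> \<exists>N. \<forall>m\<ge>N. \<forall>n\<ge>N. (\<integral>\<^sup>+t. ennreal ((norm (g m t - g n t))\<^sup>2) \<partial>M) \<le> ennreal e"
  shows "\<exists>h r. strict_mono (r :: nat \<Rightarrow> nat) \<and> (AE t in M. (\<lambda>k. g (r k) t) \<longlonglongrightarrow> h t) \<and>
    (\<forall>e>0. \<exists>N. \<forall>n\<ge>N. (\<integral>\<^sup>+t. ennreal ((norm (g n t - h t))\<^sup>2) \<partial>M) \<le> ennreal e)"
proof -
  have "\<exists>N. \<forall>m\<ge>N. \<forall>n\<ge>N. (\<integral>\<^sup>+t. ennreal ((norm (g m t - g n t))\<^sup>2) \<partial>M) \<le> ennreal ((1/4) ^ k)" for k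
    by (rule Cauchy) simp
  then obtain N where N: "\<And>k m n. m \<ge> N k \<Longrightarrow> n \<ge> N k \<Longrightarrow>
      (\<integral>\<^sup>+t. ennreal ((norm (g m t - g n t))\<^sup>2) \<partial>M) \<le> ennreal ((1/4) ^ k)" by metis
  \<comment> \<open>Summing the thresholds, each raised by 1, makes \<open>r\<close> strictly
    increasing and keeps \<open>r k\<close> above \<open>N k\<close>.\<close>
  define r where "r = (\<lambda>k. \<Sum>i\<le>k. Suc (N i))"
  have r: "strict_mono r" by (auto simp: r_def strict_mono_Suc_iff)
  have rN: "r k \<ge> N k" for k by (cases k) (auto simp: r_def)
  have rN': "r (Suc k) \<ge> N k" for k using rN[of k] strict_monoD[OF r, of k "Suc k"] by simp
  let ?d = "\<lambda>k t. (norm (g (r (Suc k)) t - g (r k) t))\<^sup>2"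
  have meas2: "(\<lambda>t. ennreal ((norm (g m t - g n t))\<^sup>2)) \<in> borel_measurable M" for m n
    by (intro measurable_compose[OF _ measurable_ennreal] borel_measurable_power meas)
  have "(\<integral>\<^sup>+t. (\<Sum>k. ennreal (2 ^ k) * ennreal (?d k t)) \<partial>M) = (\<Sum>k. \<integral>\<^sup>+t. ennreal (2 ^ k) * ennreal (?d k t) \<partial>M)"
    by (intro nn_integral_suminf borel_measurable_times_ennreal meas2) simp
  also have "\<dots> = (\<Sum>k. ennreal (2 ^ k) * (\<integral>\<^sup>+t. ennreal (?d k t) \<partial>M))"
    by (intro suminf_cong nn_integral_cmult meas2)
  also have "\<dots> \<le> (\<Sum>k. ennreal (2 ^ k) * ennreal ((1/4) ^ k))"
    by (intro suminf_le mult_left_mono N rN rN') auto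
  also have "\<dots> = (\<Sum>k. ennreal ((1/2) ^ k))"
    by (simp add: ennreal_mult[symmetric] power_mult_distrib[symmetric])
  also have "\<dots> = ennreal (\<Sum>k. (1/2) ^ k)"
    by (intro suminf_ennreal2) (auto intro: summable_geometric)
  also have "\<dots> < \<infinity>" by simp
  \<comment> \<open>Weights 2^k against integrals of size (1/4)^k leave a finite total. Where the
    weighted sum is finite, consecutive distances decay like 2^(-k/2), so the subsequence converges
    there.\<close>
  finally have "AE t in M. (\<Sum>k. ennreal (2 ^ k) * ennreal (?d k t)) \<noteq> \<infinity>"
    by (intro nn_integral_noteq_infinite borel_measurable_suminf_order borel_measurable_times_ennreal meas2) auto
  then have AE_conv: "AE t in M. convergent (\<lambda>k. g (r k) t)"
  proof eventually_elim
    case (elim t)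
    then obtain c where c: "(\<Sum>k. ennreal (2 ^ k) * ennreal (?d k t)) = ennreal c" "c \<ge> 0"
      by (cases "\<Sum>k. ennreal (2 ^ k) * ennreal (?d k t)") auto
    have bound: "norm (g (r (Suc k)) t - g (r k) t) \<le> sqrt c * (1 / sqrt 2) ^ k" for k
    proof -
      have "ennreal (2 ^ k) * ennreal (?d k t) \<le> (\<Sum>k. ennreal (2 ^ k) * ennreal (?d k t))"
        using sum_le_suminf[of "\<lambda>k. ennreal (2 ^ k) * ennreal (?d k t)" "{k}"] by simp
      then have "2 ^ k * ?d k t \<le> c" using c by (simp add: ennreal_mult[symmetric] ennreal_le_iff)
      then have "?d k t \<le> c * (1/2) ^ k" by (simp add: field_simps)
      also have "\<dots> = (sqrt c * (1 / sqrt 2) ^ k)\<^sup>2"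
      proof -
        have "((1 / sqrt 2) ^ k)\<^sup>2 = ((1 / sqrt 2)\<^sup>2) ^ k" by (simp only: power_mult[symmetric] mult.commute)
        then show ?thesis using c(2) by (simp add: power_mult_distrib power_divide)
      qed
      finally show ?thesis by (rule power2_le_imp_le) (use c(2) in simp)
    qed
    have "summable (\<lambda>k. sqrt c * (1 / sqrt 2) ^ k)"
      by (intro summable_mult summable_geometric) simp
    then have "summable (\<lambda>k. g (r (Suc k)) t - g (r k) t)"
      by (rule summable_comparison_test'[where N=0]) (rule bound)
    then show "convergent (\<lambda>k. g (r k) t)"
      unfolding summable_iff_convergent sum_lessThan_telescope[of "\<lambda>k. g (r k) t"]
      by (simp only: convergent_diff_const_right_iff)
  qed
  define h where "h = (\<lambda>t. lim (\<lambda>k. g (r k) t))"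
  have lim: "AE t in M. (\<lambda>k. g (r k) t) \<longlonglongrightarrow> h t"
    using AE_conv by eventually_elim (simp add: h_def convergent_LIMSEQ_iff)
  have "\<exists>N. \<forall>n\<ge>N. (\<integral>\<^sup>+t. ennreal ((norm (g n t - h t))\<^sup>2) \<partial>M) \<le> ennreal e" if "e > 0" for e
  proof -
    obtain N where N: "\<And>m n. m \<ge> N \<Longrightarrow> n \<ge> N \<Longrightarrow> (\<integral>\<^sup>+t. ennreal ((norm (g m t - g n t))\<^sup>2) \<partial>M) \<le> ennreal e"
      using Cauchy[OF \<open>e > 0\<close>] by blast
    have "(\<integral>\<^sup>+t. ennreal ((norm (g n t - h t))\<^sup>2) \<partial>M) \<le> ennreal e" if n: "n \<ge> N" for n
    proof -
      have "AE t in M. ennreal ((norm (g n t - h t))\<^sup>2) = liminf (\<lambda>k. ennreal ((norm (g n t - g (r k) t))\<^sup>2))"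
        using lim
      proof eventually_elim
        case (elim t)
        then have "(\<lambda>k. ennreal ((norm (g n t - g (r k) t))\<^sup>2)) \<longlonglongrightarrow> ennreal ((norm (g n t - h t))\<^sup>2)"
          by (intro tendsto_ennrealI tendsto_intros)
        from lim_imp_Liminf[OF _ this] show ?case by simp
      qed
      then have "(\<integral>\<^sup>+t. ennreal ((norm (g n t - h t))\<^sup>2) \<partial>M) = (\<integral>\<^sup>+t. liminf (\<lambda>k. ennreal ((norm (g n t - g (r k) t))\<^sup>2)) \<partial>M)"
        by (rule nn_integral_cong_AE)
      also have "\<dots> \<le> liminf (\<lambda>k. \<integral>\<^sup>+t. ennreal ((norm (g n t - g (r k) t))\<^sup>2) \<partial>M)"
        by (rule nn_integral_liminf) (rule meas2)
      also have "\<dots> \<le> ennreal e"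
      proof (rule Liminf_le)
        show "\<forall>\<^sub>F k in sequentially. (\<integral>\<^sup>+t. ennreal ((norm (g n t - g (r k) t))\<^sup>2) \<partial>M) \<le> ennreal e"
          using eventually_ge_at_top[of N]
        proof eventually_elim
          case (elim k)
          then have "r k \<ge> N" using seq_suble[OF r, of k] by simp
          with n show ?case by (rule N)
        qed
      qed simp
      finally show ?thesis .
    qed
    then show ?thesis by blast
  qed
  with r lim show ?thesis by blast
qed

section \<open>Square-integrable functions and the Hilbert space of their classes\<close>

lemma L2_measurable: "u \<in> L2 \<Omega> \<Longrightarrow> u \<in> borel_measurable (lebesgue_on \<Omega>)"
  and L2_integrable_power2: "u \<in> L2 \<Omega> \<Longrightarrow> integrable (lebesgue_on \<Omega>) (\<lambda>x. (u x)\<^sup>2)"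
  by (auto simp: L2_def)

lemma L2_integrable_mult:
  assumes "u \<in> L2 \<Omega>" "v \<in> L2 \<Omega>"
  shows "integrable (lebesgue_on \<Omega>) (\<lambda>x. u x * v x)"
proof (rule Bochner_Integration.integrable_bound)
  show "integrable (lebesgue_on \<Omega>) (\<lambda>x. (u x)\<^sup>2 + (v x)\<^sup>2)"
    using assms by (intro Bochner_Integration.integrable_add L2_integrable_power2)
  show "(\<lambda>x. u x * v x) \<in> borel_measurable (lebesgue_on \<Omega>)"
    using assms by (intro borel_measurable_times L2_measurable)
  have "\<bar>a * b\<bar> \<le> a\<^sup>2 + b\<^sup>2" for a b :: real
  proof -
    have "0 \<le> \<bar>a\<bar> * \<bar>b\<bar>" by simp
    with sum_squares_bound[of "\<bar>a\<bar>" "\<bar>b\<bar>"] show ?thesis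
      unfolding abs_mult power2_abs mult.assoc by linarith
  qed
  then show "AE x in lebesgue_on \<Omega>. norm (u x * v x) \<le> norm ((u x)\<^sup>2 + (v x)\<^sup>2)"
    by simp
qed

lemma L2_add: "u \<in> L2 \<Omega> \<Longrightarrow> v \<in> L2 \<Omega> \<Longrightarrow> (\<lambda>x. u x + v x) \<in> L2 \<Omega>"
  using L2_integrable_mult[of u \<Omega> v]
  by (auto simp: L2_def power2_sum mult.assoc intro!: Bochner_Integration.integrable_add borel_measurable_add)

lemma L2_scale: "u \<in> L2 \<Omega> \<Longrightarrow> (\<lambda>x. c * u x) \<in> L2 \<Omega>"
  by (auto simp: L2_def power_mult_distrib)

lemma L2_diff: "u \<in> L2 \<Omega> \<Longrightarrow> v \<in> L2 \<Omega> \<Longrightarrow> (\<lambda>x. u x - v x) \<in> L2 \<Omega>"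
  using L2_add[OF _ L2_scale[of v \<Omega> "-1"], of u] by simp

lemma L2_zero: "(\<lambda>x. 0) \<in> L2 \<Omega>" by (simp add: L2_def)

lemma L2_cong_AE:
  assumes "u \<in> L2 \<Omega>" "AE x in lebesgue_on \<Omega>. u x = v x" "v \<in> borel_measurable (lebesgue_on \<Omega>)"
  shows "v \<in> L2 \<Omega>"
proof -
  have "integrable (lebesgue_on \<Omega>) (\<lambda>x. (u x)\<^sup>2) \<longleftrightarrow> integrable (lebesgue_on \<Omega>) (\<lambda>x. (v x)\<^sup>2)"
    using assms by (intro integrable_cong_AE) (auto simp: L2_def intro: borel_measurable_power)
  with assms show ?thesis by (simp add: L2_def)
qed

\<comment> \<open>The classes live on the whole space because a type cannot depend on a domain. The
  relation is partial since only square-integrable functions represent a class.\<close>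
quotient_type (overloaded) 'a l2 = "'a::euclidean_space \<Rightarrow> real" / partial:
  "\<lambda>u v. u \<in> L2 UNIV \<and> v \<in> L2 UNIV \<and> (AE x in lebesgue_on UNIV. u x = v x)"
  by (rule part_equivpI) (auto intro: L2_zero sympI transpI elim: AE_mp)

instantiation l2 :: (euclidean_space) real_vector
begin

lift_definition zero_l2 :: "'a l2" is "\<lambda>x. 0" by (simp add: L2_zero)
lift_definition plus_l2 :: "'a l2 \<Rightarrow> 'a l2 \<Rightarrow> 'a l2" is "\<lambda>u v x. u x + v x"
  by (auto intro: L2_add)
lift_definition minus_l2 :: "'a l2 \<Rightarrow> 'a l2 \<Rightarrow> 'a l2" is "\<lambda>u v x. u x - v x"
  by (auto intro: L2_diff)
lift_definition uminus_l2 :: "'a l2 \<Rightarrow> 'a l2" is "\<lambda>u x. - u x"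
  using L2_scale[of _ _ "-1"] by auto
lift_definition scaleR_l2 :: "real \<Rightarrow> 'a l2 \<Rightarrow> 'a l2" is "\<lambda>c u x. c * u x"
  by (auto intro: L2_scale)

instance
  by standard (transfer; auto simp: L2_add L2_scale L2_zero algebra_simps L2_diff L2_scale[of _ _ "-1", simplified]; fail)+

end

instantiation l2 :: (euclidean_space) real_inner
begin

lift_definition inner_l2 :: "'a l2 \<Rightarrow> 'a l2 \<Rightarrow> real" is "\<lambda>u v. L2_inner UNIV u v"
  unfolding L2_inner_def
  by (intro integral_cong_AE borel_measurable_times L2_measurable) auto

definition norm_l2 :: "'a l2 \<Rightarrow> real" where "norm_l2 x = sqrt (x \<bullet> x)"
definition sgn_l2 :: "'a l2 \<Rightarrow> 'a l2" where "sgn_l2 x = x /\<^sub>R norm x"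
definition dist_l2 :: "'a l2 \<Rightarrow> 'a l2 \<Rightarrow> real" where "dist_l2 x y = norm (x - y)"
definition uniformity_l2 :: "('a l2 \<times> 'a l2) filter"
  where "uniformity_l2 = (INF e\<in>{0<..}. principal {(x, y). dist x y < e})"
definition open_l2 :: "'a l2 set \<Rightarrow> bool"
  where "open_l2 S = (\<forall>x\<in>S. \<forall>\<^sub>F (x', y) in uniformity. x' = x \<longrightarrow> y \<in> S)"

instance
proof
  fix x y z :: "'a l2" and r :: real
  show "x \<bullet> y = y \<bullet> x" by transfer (simp add: L2_inner_def mult.commute)
  show "(x + y) \<bullet> z = x \<bullet> z + y \<bullet> z"
    by transfer (simp add: L2_inner_def distrib_right L2_integrable_mult Bochner_Integration.integral_add del: lebesgue_on_UNIV_eq)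
  show "r *\<^sub>R x \<bullet> y = r * (x \<bullet> y)" by transfer (simp add: L2_inner_def mult.assoc)
  show "0 \<le> x \<bullet> x" by transfer (simp add: L2_inner_def)
  show "x \<bullet> x = 0 \<longleftrightarrow> x = 0"
  proof (transfer, goal_cases)
    case (1 u)
    then have "integrable (lebesgue_on UNIV) (\<lambda>x. u x * u x)" by (intro L2_integrable_mult) auto
    from integral_nonneg_eq_0_iff_AE[OF this]
    have "L2_inner UNIV u u = 0 \<longleftrightarrow> (AE x in lebesgue_on UNIV. u x = 0)" by (simp add: L2_inner_def)
    with 1 show ?case by (auto intro: L2_zero)
  qed
qed (simp_all add: norm_l2_def sgn_l2_def dist_l2_def uniformity_l2_def open_l2_def)

end

lemma abs_l2_eq_iff:
  assumes "u \<in> L2 UNIV" "v \<in> L2 UNIV"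
  shows "abs_l2 u = abs_l2 v \<longleftrightarrow> (AE x in lebesgue_on UNIV. u x = v x)"
  using Quotient3_rel[OF Quotient3_l2, of u v] assms by auto

lemma rep_l2: "rep_l2 h \<in> L2 UNIV" "abs_l2 (rep_l2 h) = h"
  using Quotient3_rep_reflp[OF Quotient3_l2, of h] Quotient3_abs_rep[OF Quotient3_l2, of h] by auto

lemma norm_l2_power2:
  assumes "u \<in> L2 UNIV" "v \<in> L2 UNIV"
  shows "(norm (abs_l2 u - abs_l2 v))\<^sup>2 = (\<integral>x. (u x - v x)\<^sup>2 \<partial>lebesgue_on UNIV)"
  using assms unfolding power2_norm_eq_inner
  by (simp add: minus_l2.abs_eq inner_l2.abs_eq L2_diff L2_inner_def power2_eq_square)

instance l2 :: (euclidean_space) banach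
proof
  fix X :: "nat \<Rightarrow> 'a l2"
  assume X: "Cauchy X"
  define g where "g = (\<lambda>n. rep_l2 (X n))"
  have g: "g n \<in> L2 UNIV" "abs_l2 (g n) = X n" for n by (auto simp: g_def rep_l2)
  have nn: "(\<integral>\<^sup>+x. ennreal ((norm (g m x - g n x))\<^sup>2) \<partial>lebesgue_on UNIV) = ennreal ((norm (X m - X n))\<^sup>2)" for m n
    using norm_l2_power2[OF g(1)[of m] g(1)[of n]] L2_integrable_power2[OF L2_diff[OF g(1)[of m] g(1)[of n]]]
    by (simp add: g(2) nn_integral_eq_integral)
  have "\<exists>h r. strict_mono (r :: nat \<Rightarrow> nat) \<and> (AE t in lebesgue_on UNIV. (\<lambda>k. g (r k) t) \<longlonglongrightarrow> h t) \<and>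
    (\<forall>e>0. \<exists>N. \<forall>n\<ge>N. (\<integral>\<^sup>+t. ennreal ((norm (g n t - h t))\<^sup>2) \<partial>lebesgue_on UNIV) \<le> ennreal e)"
  proof (rule L2_Cauchy_imp_limit)
    show "(\<lambda>t. norm (g m t - g n t)) \<in> borel_measurable (lebesgue_on UNIV)" for m n
      by (rule measurable_compose[OF borel_measurable_diff[OF L2_measurable[OF g(1)] L2_measurable[OF g(1)]] borel_measurable_norm])
    fix e :: real assume e: "e > 0"
    then obtain N where N: "\<And>m n. m \<ge> N \<Longrightarrow> n \<ge> N \<Longrightarrow> dist (X m) (X n) < sqrt e"
      using metric_CauchyD[OF X, of "sqrt e"] by auto
    have "(norm (X m - X n))\<^sup>2 \<le> e" if "m \<ge> N" "n \<ge> N" for m n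
    proof -
      have "(norm (X m - X n))\<^sup>2 \<le> (sqrt e)\<^sup>2"
        using N[OF that] by (intro power_mono) (auto simp: dist_norm)
      then show ?thesis using e by simp
    qed
    then show "\<exists>N. \<forall>m\<ge>N. \<forall>n\<ge>N. (\<integral>\<^sup>+t. ennreal ((norm (g m t - g n t))\<^sup>2) \<partial>lebesgue_on UNIV) \<le> ennreal e"
      unfolding nn by (intro exI[of _ N]) (auto intro: ennreal_leI)
  qed
  then obtain h and r :: "nat \<Rightarrow> nat" where r: "strict_mono r" and AE: "AE t in lebesgue_on UNIV. (\<lambda>k. g (r k) t) \<longlonglongrightarrow> h t"
    and h: "\<And>e. e > 0 \<Longrightarrow> \<exists>N. \<forall>n\<ge>N. (\<integral>\<^sup>+t. ennreal ((norm (g n t - h t))\<^sup>2) \<partial>lebesgue_on UNIV) \<le> ennreal e"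
    by blast
  \<comment> \<open>The limit obtained above is determined only almost everywhere; taking
    \<open>lim\<close> at every point gives a measurable version of it.\<close>
  define h' where "h' = (\<lambda>t. lim (\<lambda>k. g (r k) t))"
  have hh': "AE t in lebesgue_on UNIV. h t = h' t"
    using AE by eventually_elim (simp add: h'_def limI)
  have meas: "h' \<in> borel_measurable (lebesgue_on UNIV)"
    unfolding h'_def by (rule borel_measurable_lim_metric[OF L2_measurable[OF g(1)]])
  have nn': "(\<integral>\<^sup>+t. ennreal ((norm (g n t - h t))\<^sup>2) \<partial>lebesgue_on UNIV) = (\<integral>\<^sup>+t. ennreal ((g n t - h' t)\<^sup>2) \<partial>lebesgue_on UNIV)" for n
    by (rule nn_integral_cong_AE) (use hh' in eventually_elim, simp)
  have meas_d: "(\<lambda>t. g n t - h' t) \<in> borel_measurable (lebesgue_on UNIV)" for n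
    by (rule borel_measurable_diff[OF L2_measurable[OF g(1)] meas])
  obtain n where "(\<integral>\<^sup>+t. ennreal ((g n t - h' t)\<^sup>2) \<partial>lebesgue_on UNIV) \<le> ennreal 1"
    using h[of 1] nn' by auto
  then have "(\<integral>\<^sup>+t. ennreal ((g n t - h' t)\<^sup>2) \<partial>lebesgue_on UNIV) < \<infinity>"
    by (rule order_le_less_trans) simp
  then have "(\<lambda>t. g n t - h' t) \<in> L2 UNIV"
    using meas_d[of n] by (auto simp: L2_def intro!: integrableI_bounded borel_measurable_power)
  from L2_diff[OF g(1)[of n] this] have h'L2: "h' \<in> L2 UNIV" by simp
  have "X \<longlonglongrightarrow> abs_l2 h'"
  proof (rule LIMSEQ_I)
    fix e :: real assume e: "e > 0"
    obtain N where N: "\<And>n. n \<ge> N \<Longrightarrow> (\<integral>\<^sup>+t. ennreal ((g n t - h' t)\<^sup>2) \<partial>lebesgue_on UNIV) \<le> ennreal ((e/2)\<^sup>2)"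
      using h[of "(e/2)\<^sup>2"] nn' e by auto
    have "norm (X n - abs_l2 h') < e" if "n \<ge> N" for n
    proof -
      have "ennreal ((norm (X n - abs_l2 h'))\<^sup>2) \<le> ennreal ((e/2)\<^sup>2)"
        using N[OF that] norm_l2_power2[OF g(1)[of n] h'L2] L2_integrable_power2[OF L2_diff[OF g(1)[of n] h'L2]]
        by (simp add: g(2) nn_integral_eq_integral)
      then have "(norm (X n - abs_l2 h'))\<^sup>2 \<le> (e/2)\<^sup>2" by (simp add: ennreal_le_iff)
      then have "norm (X n - abs_l2 h') \<le> e/2" by (rule power2_le_imp_le) (use e in simp)
      with e show ?thesis by simp
    qed
    then show "\<exists>N. \<forall>n\<ge>N. norm (X n - abs_l2 h') < e" by blast
  qed
  then show "convergent X" by (rule convergentI)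
qed

text \<open>For a measurable domain this is the isometric embedding of its L2 space, whose range
  consists of the classes that vanish almost everywhere outside the domain.\<close>

definition ext :: "'a::euclidean_space set \<Rightarrow> ('a \<Rightarrow> real) \<Rightarrow> 'a l2" where
  "ext \<Omega> u = abs_l2 (\<lambda>x. if x \<in> \<Omega> then u x else 0)"

context
  fixes \<Omega> :: "'a::euclidean_space set"
  assumes meas: "\<Omega> \<in> sets lebesgue"
begin

lemma L2_ext: "u \<in> L2 \<Omega> \<Longrightarrow> (\<lambda>x. if x \<in> \<Omega> then u x else 0) \<in> L2 UNIV"
proof -
  assume u: "u \<in> L2 \<Omega>"
  have "(\<lambda>x. if x \<in> \<Omega> then u x else 0) \<in> borel_measurable lebesgue"
    using L2_measurable[OF u] meas by (simp add: borel_measurable_if)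
  moreover have "integrable lebesgue (\<lambda>x. if x \<in> \<Omega> then (u x)\<^sup>2 else 0)"
    using L2_integrable_power2[OF u] meas by (subst Lebesgue_Measure.integrable_restrict_UNIV)
  then have "integrable lebesgue (\<lambda>x. (if x \<in> \<Omega> then u x else 0)\<^sup>2)"
    by (rule Bochner_Integration.integrable_cong[THEN iffD1, rotated -1]) auto
  ultimately show ?thesis by (simp add: L2_def lebesgue_on_UNIV_eq)
qed

lemma L2_restrict: assumes "u \<in> L2 UNIV" shows "u \<in> L2 \<Omega>"
proof -
  have u: "u \<in> borel_measurable lebesgue" "integrable lebesgue (\<lambda>x. (u x)\<^sup>2)"
    using assms by (auto simp: L2_def lebesgue_on_UNIV_eq)
  have "integrable lebesgue (\<lambda>x. indicator \<Omega> x *\<^sub>R (u x)\<^sup>2)"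
    by (rule integrable_mult_indicator[OF meas u(2)])
  then have "integrable (lebesgue_on \<Omega>) (\<lambda>x. (u x)\<^sup>2)"
    using meas by (subst integrable_restrict_space) auto
  then show ?thesis using u(1) by (simp add: L2_def measurable_restrict_space1)
qed

lemma integral_ext: "(\<integral>x. (if x \<in> \<Omega> then u x else 0) \<partial>lebesgue_on UNIV) = (\<integral>x. u x \<partial>lebesgue_on \<Omega>)"
  for u :: "'a \<Rightarrow> real"
  using meas by (simp add: lebesgue_on_UNIV_eq Lebesgue_Measure.integral_restrict_UNIV)

lemma ext_add: "u \<in> L2 \<Omega> \<Longrightarrow> v \<in> L2 \<Omega> \<Longrightarrow> ext \<Omega> (\<lambda>x. u x + v x) = ext \<Omega> u + ext \<Omega> v"
  unfolding ext_def by (simp add: plus_l2.abs_eq L2_ext) (rule arg_cong[of _ _ abs_l2], auto)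

lemma ext_diff: "u \<in> L2 \<Omega> \<Longrightarrow> v \<in> L2 \<Omega> \<Longrightarrow> ext \<Omega> (\<lambda>x. u x - v x) = ext \<Omega> u - ext \<Omega> v"
  unfolding ext_def by (simp add: minus_l2.abs_eq L2_ext) (rule arg_cong[of _ _ abs_l2], auto)

lemma ext_scale: "u \<in> L2 \<Omega> \<Longrightarrow> ext \<Omega> (\<lambda>x. c * u x) = c *\<^sub>R ext \<Omega> u"
  unfolding ext_def by (simp add: scaleR_l2.abs_eq L2_ext) (rule arg_cong[of _ _ abs_l2], auto)

lemma inner_ext: "u \<in> L2 \<Omega> \<Longrightarrow> v \<in> L2 \<Omega> \<Longrightarrow> ext \<Omega> u \<bullet> ext \<Omega> v = L2_inner \<Omega> u v"
  unfolding ext_def L2_inner_def integral_ext[symmetric]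
  by (simp add: inner_l2.abs_eq L2_ext L2_inner_def) (rule Bochner_Integration.integral_cong, auto)

lemma norm_ext: "u \<in> L2 \<Omega> \<Longrightarrow> norm (ext \<Omega> u) = L2_norm \<Omega> u"
  by (simp add: norm_l2_def L2_norm_def inner_ext)

lemma ext_eq_iff:
  assumes "u \<in> L2 \<Omega>" "v \<in> L2 \<Omega>"
  shows "ext \<Omega> u = ext \<Omega> v \<longleftrightarrow> (AE x in lebesgue_on \<Omega>. u x = v x)"
proof -
  have "(AE x in lebesgue_on \<Omega>. u x = v x) \<longleftrightarrow> (AE x in lebesgue. x \<in> \<Omega> \<longrightarrow> u x = v x)"
    using meas by (intro AE_restrict_space_iff) simp
  also have "\<dots> \<longleftrightarrow> (AE x in lebesgue. (if x \<in> \<Omega> then u x else 0) = (if x \<in> \<Omega> then v x else 0))"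
    by (intro AE_cong) auto
  finally show ?thesis using abs_l2_eq_iff[OF L2_ext[OF assms(1)] L2_ext[OF assms(2)]]
    by (simp only: ext_def lebesgue_on_UNIV_eq)
qed

lemma rep_l2_L2: "rep_l2 h \<in> L2 \<Omega>" by (intro L2_restrict rep_l2)

text \<open>\<open>ext\<close> after \<open>rep_l2\<close> is the restriction of a class to the
  domain, a projection that fixes the classes supported there. The chosen representative may still
  be nonzero on a null set outside.\<close>

lemma ext_rep_ext:
  assumes "u \<in> L2 \<Omega>"
  shows "ext \<Omega> (rep_l2 (ext \<Omega> u)) = ext \<Omega> u"
proof -
  have "abs_l2 (rep_l2 (ext \<Omega> u)) = abs_l2 (\<lambda>x. if x \<in> \<Omega> then u x else 0)"
    by (simp add: rep_l2 ext_def)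
  then have "AE x in lebesgue. rep_l2 (ext \<Omega> u) x = (if x \<in> \<Omega> then u x else 0)"
    using abs_l2_eq_iff[OF rep_l2(1) L2_ext[OF assms]] unfolding lebesgue_on_UNIV_eq by blast
  then have "AE x in lebesgue. x \<in> \<Omega> \<longrightarrow> rep_l2 (ext \<Omega> u) x = u x" by eventually_elim auto
  then show ?thesis
    using meas by (simp add: ext_eq_iff[OF rep_l2_L2 assms] AE_restrict_space_iff)
qed

text \<open>Restricting to the domain discards a nonnegative part of the integral. The resulting
  continuity of the restriction makes the set of classes supported in the domain closed.\<close>

lemma norm_ext_rep_diff: "norm (ext \<Omega> (rep_l2 h) - ext \<Omega> (rep_l2 k)) \<le> norm (h - k)"
proof (rule power2_le_imp_le)
  let ?d = "\<lambda>x. rep_l2 h x - rep_l2 k x"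
  have d: "?d \<in> L2 UNIV" by (intro L2_diff rep_l2)
  have "(norm (ext \<Omega> (rep_l2 h) - ext \<Omega> (rep_l2 k)))\<^sup>2 = L2_inner \<Omega> ?d ?d"
    unfolding power2_norm_eq_inner ext_diff[OF rep_l2_L2 rep_l2_L2, symmetric]
    by (intro inner_ext L2_diff rep_l2_L2)
  also have "\<dots> = (\<integral>x. (if x \<in> \<Omega> then ?d x * ?d x else 0) \<partial>lebesgue_on UNIV)"
    by (simp only: L2_inner_def integral_ext)
  also have "\<dots> \<le> (\<integral>x. ?d x * ?d x \<partial>lebesgue_on UNIV)"
    using L2_integrable_mult[OF d d] L2_integrable_mult[OF L2_restrict[OF d] L2_restrict[OF d]] meas
    by (intro integral_mono) (auto simp: lebesgue_on_UNIV_eq Lebesgue_Measure.integrable_restrict_UNIV)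
  also have "\<dots> = (norm (h - k))\<^sup>2"
    using norm_l2_power2[OF rep_l2(1) rep_l2(1), of h k] by (simp add: rep_l2 power2_eq_square)
  finally show "(norm (ext \<Omega> (rep_l2 h) - ext \<Omega> (rep_l2 k)))\<^sup>2 \<le> (norm (h - k))\<^sup>2" .
qed simp

end

subsection \<open>Test functions\<close>

lemma test_functionsD:
  assumes "\<phi> \<in> test_functions U"
  shows "Ck_on k UNIV \<phi>" "compact (closure {x. \<phi> x \<noteq> 0})" "closure {x. \<phi> x \<noteq> 0} \<subseteq> U"
  using assms by (auto simp: test_functions_def)

lemma test_function_continuous: "\<phi> \<in> test_functions U \<Longrightarrow> continuous_on S \<phi>"
  using test_functionsD(1)[of \<phi> U 0] continuous_on_subset by auto

lemma test_function_has_derivative: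
  "\<phi> \<in> test_functions U \<Longrightarrow> (\<phi> has_derivative frechet_derivative \<phi> (at x)) (at x)"
  using test_functionsD(1)[of \<phi> U 1] by (simp add: frechet_derivative_works[symmetric])

lemma test_functions_I:
  fixes \<phi> :: "'a::euclidean_space \<Rightarrow> real"
  assumes "\<And>k. Ck_on k UNIV \<phi>" "{x. \<phi> x \<noteq> 0} \<subseteq> K" "compact K" "K \<subseteq> U"
  shows "\<phi> \<in> test_functions U"
proof -
  have "closure {x. \<phi> x \<noteq> 0} \<subseteq> K" using assms(2,3) by (intro closure_minimal compact_imp_closed)
  moreover have "compact (closure {x. \<phi> x \<noteq> 0})"
    unfolding compact_closure using assms(2,3) bounded_subset compact_imp_bounded by blast
  ultimately show ?thesis using assms by (auto simp: test_functions_def)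
qed

lemma test_functions_add:
  assumes \<phi>: "\<phi> \<in> test_functions U" and \<psi>: "\<psi> \<in> test_functions U"
  shows "(\<lambda>x. \<phi> x + \<psi> x) \<in> test_functions U"
proof (rule test_functions_I)
  show "{x. \<phi> x + \<psi> x \<noteq> 0} \<subseteq> closure {x. \<phi> x \<noteq> 0} \<union> closure {x. \<psi> x \<noteq> 0}"
    using closure_subset[of "{x. \<phi> x \<noteq> 0}"] closure_subset[of "{x. \<psi> x \<noteq> 0}"] by force
  show "Ck_on k UNIV (\<lambda>x. \<phi> x + \<psi> x)" for k
    by (intro Ck_on_add open_UNIV test_functionsD(1)[OF \<phi>] test_functionsD(1)[OF \<psi>])
  show "closure {x. \<phi> x \<noteq> 0} \<union> closure {x. \<psi> x \<noteq> 0} \<subseteq> U"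
    using test_functionsD(3)[OF \<phi>] test_functionsD(3)[OF \<psi>] by simp
  show "compact (closure {x. \<phi> x \<noteq> 0} \<union> closure {x. \<psi> x \<noteq> 0})"
    by (intro compact_Un test_functionsD(2)[OF \<phi>] test_functionsD(2)[OF \<psi>])
qed

lemma test_functions_mult_left:
  assumes \<phi>: "\<phi> \<in> test_functions U" and g: "\<And>k. Ck_on k UNIV g"
  shows "(\<lambda>x. g x * \<phi> x) \<in> test_functions U"
proof (rule test_functions_I)
  show "{x. g x * \<phi> x \<noteq> 0} \<subseteq> closure {x. \<phi> x \<noteq> 0}"
    using closure_subset[of "{x. \<phi> x \<noteq> 0}"] by force
  show "Ck_on k UNIV (\<lambda>x. g x * \<phi> x)" for k
    by (intro Ck_on_mult open_UNIV test_functionsD(1)[OF \<phi>] g)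
qed (intro test_functionsD(2,3)[OF \<phi>])+

lemma test_functions_scale: "\<phi> \<in> test_functions U \<Longrightarrow> (\<lambda>x. c * \<phi> x) \<in> test_functions U"
  by (rule test_functions_mult_left) (auto intro: Ck_on_const)

lemma test_functions_mult:
  "\<phi> \<in> test_functions U \<Longrightarrow> \<psi> \<in> test_functions V \<Longrightarrow> (\<lambda>x. \<psi> x * \<phi> x) \<in> test_functions U"
  by (rule test_functions_mult_left) (auto intro: test_functionsD)

lemma test_functions_zero: "(\<lambda>x. 0) \<in> test_functions U"
  by (rule test_functions_I[of _ "{}"]) (auto intro: Ck_on_const)

text \<open>Off the support the function vanishes on an open set, so its derivatives vanish there
  too and the support does not grow.\<close>

lemma test_functions_derivative:
  assumes "\<phi> \<in> test_functions U" "e \<in> Basis"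
  shows "(\<lambda>x. frechet_derivative \<phi> (at x) e) \<in> test_functions U"
proof (rule test_functions_I)
  let ?K = "closure {x. \<phi> x \<noteq> 0}"
  show "Ck_on k UNIV (\<lambda>x. frechet_derivative \<phi> (at x) e)" for k
    using test_functionsD(1)[OF assms(1), of "Suc k"] assms(2) by auto
  have "frechet_derivative \<phi> (at x) = (\<lambda>h. 0)" if "x \<notin> ?K" for x
  proof (rule frechet_derivative_at[symmetric], rule has_derivative_transform_within_open)
    show "((\<lambda>x. 0) has_derivative (\<lambda>h. 0)) (at x)" by simp
    show "open (- ?K)" "x \<in> - ?K" using that by auto
    show "0 = \<phi> y" if "y \<in> - ?K" for y using that closure_subset[of "{x. \<phi> x \<noteq> 0}"] by auto
  qed
  then show "{x. frechet_derivative \<phi> (at x) e \<noteq> 0} \<subseteq> ?K" by force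
qed (intro test_functionsD(2,3)[OF assms(1)])+

lemma test_function_bounded:
  assumes "\<phi> \<in> test_functions U"
  obtains B where "\<And>x. \<bar>\<phi> x\<bar> \<le> B" "0 \<le> B"
proof -
  let ?K = "closure {x. \<phi> x \<noteq> 0}"
  have "compact (\<phi> ` ?K)"
    by (intro compact_continuous_image test_function_continuous[OF assms] test_functionsD(2)[OF assms])
  then obtain B where B: "\<And>y. y \<in> \<phi> ` ?K \<Longrightarrow> norm y \<le> B"
    using compact_imp_bounded bounded_iff by metis
  have "\<bar>\<phi> x\<bar> \<le> max B 0" for x
    using B[of "\<phi> x"] closure_subset[of "{x. \<phi> x \<noteq> 0}"] by (cases "\<phi> x = 0") fastforce+
  then show ?thesis by (intro that[of "max B 0"]) auto
qed

lemma continuous_compact_support_integrable: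
  fixes f :: "'a::euclidean_space \<Rightarrow> real"
  assumes "continuous_on UNIV f" "{x. f x \<noteq> 0} \<subseteq> K" "compact K"
  shows "integrable lborel f"
proof -
  have "integrable lborel (\<lambda>x. indicator K x *\<^sub>R f x)"
    by (rule borel_integrable_compact) (use assms continuous_on_subset[OF assms(1)] in auto)
  moreover have "(\<lambda>x. indicator K x *\<^sub>R f x) = f" using assms(2) by (auto simp: indicator_def fun_eq_iff)
  ultimately show ?thesis by simp
qed

lemma test_function_integrable: "\<phi> \<in> test_functions U \<Longrightarrow> integrable lborel \<phi>"
  by (rule continuous_compact_support_integrable[OF test_function_continuous closure_subset test_functionsD(2)])

lemma test_function_L2:
  assumes "\<phi> \<in> test_functions U" "\<Omega> \<in> sets lebesgue"
  shows "\<phi> \<in> L2 \<Omega>"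
proof -
  have "integrable lborel (\<lambda>x. \<phi> x * \<phi> x)"
    using test_function_integrable[OF test_functions_mult[OF assms(1,1)]] .
  then have "integrable lebesgue (\<lambda>x. (\<phi> x)\<^sup>2)"
    by (simp add: power2_eq_square integrable_completion)
  moreover have "\<phi> \<in> borel_measurable lebesgue"
    using test_function_integrable[OF assms(1)] by (simp add: measurable_completion)
  ultimately have "\<phi> \<in> L2 UNIV" by (simp add: L2_def lebesgue_on_UNIV_eq)
  then show ?thesis by (rule L2_restrict[OF assms(2)])
qed

text \<open>By translation invariance the integral of a difference quotient vanishes.\<close>

lemma integral_test_function_derivative:
  fixes \<phi> :: "'a::euclidean_space \<Rightarrow> real"
  assumes \<phi>: "\<phi> \<in> test_functions U" and e: "e \<in> Basis"
  shows "(\<integral>x. frechet_derivative \<phi> (at x) e \<partial>lborel) = 0"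
proof -
  define h where "h = (\<lambda>n. inverse (real (Suc n)))"
  have h: "0 < h n" "h n \<le> 1" "h \<longlonglongrightarrow> 0" for n
    using LIMSEQ_inverse_real_of_nat by (auto simp: h_def field_simps)
  let ?K = "closure {x. \<phi> x \<noteq> 0}"
  obtain B where B: "\<And>x. \<bar>frechet_derivative \<phi> (at x) e\<bar> \<le> B" "0 \<le> B"
    using test_function_bounded[OF test_functions_derivative[OF \<phi> e]] by metis
  obtain R where R: "?K \<subseteq> cball 0 R"
    using compact_imp_bounded[OF test_functionsD(2)[OF \<phi>]] by (auto simp: bounded_iff subset_iff)
  have meas: "\<phi> \<in> borel_measurable borel"
    by (rule borel_measurable_continuous_onI) (rule test_function_continuous[OF \<phi>])
  define q where "q = (\<lambda>n x. (\<phi> (h n *\<^sub>R e + x) - \<phi> x) / h n)"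
  have int_shift: "integrable lborel (\<lambda>x. \<phi> (c + x))" "(\<integral>x. \<phi> (c + x) \<partial>lborel) = (\<integral>x. \<phi> x \<partial>lborel)" for c
  proof -
    have "integrable (distr lborel borel ((+) c)) \<phi>"
      using test_function_integrable[OF \<phi>] by (simp add: lborel_distr_plus)
    then show "integrable lborel (\<lambda>x. \<phi> (c + x))" by (subst (asm) integrable_distr_eq) (auto simp: meas)
    have "(\<integral>x. \<phi> (c + x) \<partial>lborel) = (\<integral>x. \<phi> x \<partial>distr lborel borel ((+) c))"
      by (subst integral_distr) (auto simp: meas)
    then show "(\<integral>x. \<phi> (c + x) \<partial>lborel) = (\<integral>x. \<phi> x \<partial>lborel)" by (simp add: lborel_distr_plus)
  qed
  have "(\<integral>x. q n x \<partial>lborel) = 0" for n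
    unfolding q_def using int_shift test_function_integrable[OF \<phi>] by simp
  moreover have "(\<lambda>n. \<integral>x. q n x \<partial>lborel) \<longlonglongrightarrow> (\<integral>x. frechet_derivative \<phi> (at x) e \<partial>lborel)"
  \<comment> \<open>The increments \<open>h n\<close> are at most 1, so all quotients vanish outside
    the ball enlarged by 1; inside, the mean value theorem bounds them by \<open>B\<close>.\<close>
  proof (rule integral_dominated_convergence[where w="\<lambda>x. B * indicator (cball 0 (R + 1)) x"])
    show "(\<lambda>x. frechet_derivative \<phi> (at x) e) \<in> borel_measurable lborel"
      using test_function_integrable[OF test_functions_derivative[OF \<phi> e]] by auto
    show "q n \<in> borel_measurable lborel" for n
      unfolding q_def using int_shift(1) test_function_integrable[OF \<phi>]
      by (intro borel_measurable_divide borel_measurable_diff borel_measurable_integrable) auto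
    show "integrable lborel (\<lambda>x. B * indicat_real (cball 0 (R + 1)) x)"
      by (intro integrable_mult_right integrable_real_indicator) (use emeasure_bounded_finite[OF bounded_cball] in auto)
    show "AE x in lborel. (\<lambda>n. q n x) \<longlonglongrightarrow> frechet_derivative \<phi> (at x) e"
    proof (rule AE_I2)
      fix x
      have "((\<lambda>t. \<phi> (t *\<^sub>R e + x)) has_derivative (\<lambda>t. frechet_derivative \<phi> (at x) (t *\<^sub>R e))) (at 0)"
      proof (rule has_derivative_compose[of "\<lambda>t. t *\<^sub>R e + x"])
        show "((\<lambda>t. t *\<^sub>R e + x) has_derivative (\<lambda>t. t *\<^sub>R e)) (at 0)"
          by (auto intro!: derivative_eq_intros)
        show "(\<phi> has_derivative frechet_derivative \<phi> (at x)) (at (0 *\<^sub>R e + x))"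
          using test_function_has_derivative[OF \<phi>, of x] by simp
      qed
      moreover have "(\<lambda>t. frechet_derivative \<phi> (at x) (t *\<^sub>R e)) = (*) (frechet_derivative \<phi> (at x) e)"
        using linear_scale[OF linear_frechet_derivative, of \<phi> "at x"] test_functionsD(1)[OF \<phi>, of 1]
        by (auto simp: fun_eq_iff mult.commute)
      ultimately have "DERIV (\<lambda>t. \<phi> (t *\<^sub>R e + x)) 0 :> frechet_derivative \<phi> (at x) e"
        by (simp add: has_field_derivative_def)
      then have "((\<lambda>t. (\<phi> (t *\<^sub>R e + x) - \<phi> x) / t) \<longlongrightarrow> frechet_derivative \<phi> (at x) e) (at 0)"
        by (simp add: DERIV_def)
      moreover have "filterlim h (at 0) sequentially"
        unfolding filterlim_at using h(3) h(1) by (auto intro!: always_eventually simp: less_imp_neq[symmetric])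
      ultimately show "(\<lambda>n. q n x) \<longlonglongrightarrow> frechet_derivative \<phi> (at x) e"
        unfolding q_def by (rule filterlim_compose)
    qed
    show "AE x in lborel. norm (q n x) \<le> B * indicat_real (cball 0 (R + 1)) x" for n
    proof (rule AE_I2)
      fix x
      show "norm (q n x) \<le> B * indicat_real (cball 0 (R + 1)) x"
      proof (cases "x \<in> cball 0 (R + 1)")
        case True
        have "\<bar>\<phi> (h n *\<^sub>R e + x) - \<phi> x\<bar> \<le> B * h n"
        proof -
          have der: "((\<lambda>t. \<phi> (t *\<^sub>R e + x)) has_real_derivative frechet_derivative \<phi> (at (t *\<^sub>R e + x)) e) (at t)" for t
          proof -
            have "((\<lambda>t. \<phi> (t *\<^sub>R e + x)) has_derivative (\<lambda>s. frechet_derivative \<phi> (at (t *\<^sub>R e + x)) (s *\<^sub>R e))) (at t)"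
              by (rule has_derivative_compose[of "\<lambda>t. t *\<^sub>R e + x", OF _ test_function_has_derivative[OF \<phi>]])
                (auto intro!: derivative_eq_intros)
            moreover have "(\<lambda>s. frechet_derivative \<phi> (at (t *\<^sub>R e + x)) (s *\<^sub>R e)) = (*) (frechet_derivative \<phi> (at (t *\<^sub>R e + x)) e)"
              using linear_scale[OF linear_frechet_derivative, of \<phi> "at (t *\<^sub>R e + x)"] test_functionsD(1)[OF \<phi>, of 1]
              by (auto simp: fun_eq_iff mult.commute)
            ultimately show ?thesis by (simp add: has_field_derivative_def)
          qed
          obtain z where "\<phi> (h n *\<^sub>R e + x) - \<phi> (0 *\<^sub>R e + x) = (h n - 0) * frechet_derivative \<phi> (at (z *\<^sub>R e + x)) e"
            using MVT2[OF h(1)[of n] der] by metis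
          then show ?thesis using B(1)[of "z *\<^sub>R e + x"] h(1)[of n] by (simp add: abs_mult mult.commute)
        qed
        then show ?thesis using True h(1)[of n] by (simp add: q_def field_simps)
      next
        case False
        have "x \<notin> ?K" "h n *\<^sub>R e + x \<notin> ?K"
        proof -
          have "norm x > R + 1" using False by simp
          moreover have "norm (h n *\<^sub>R e) \<le> 1" using h(1,2)[of n] e by simp
          moreover have "norm x \<le> norm (h n *\<^sub>R e + x) + norm (h n *\<^sub>R e)"
            using norm_triangle_ineq4[of "h n *\<^sub>R e + x" "h n *\<^sub>R e"] by simp
          ultimately have "norm x > R" "norm (h n *\<^sub>R e + x) > R" by linarith+
          then show "x \<notin> ?K" "h n *\<^sub>R e + x \<notin> ?K" using R by auto
        qed
        then have "\<phi> x = 0" "\<phi> (h n *\<^sub>R e + x) = 0" using closure_subset[of "{x. \<phi> x \<noteq> 0}"] by auto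
        then show ?thesis using False by (simp add: q_def)
      qed
    qed
  qed
  ultimately have "(\<lambda>n::nat. 0) \<longlonglongrightarrow> (\<integral>x. frechet_derivative \<phi> (at x) e \<partial>lborel)" by simp
  then show ?thesis by (simp add: LIMSEQ_const_iff)
qed

lemma integral_lebesgue_on_support:
  fixes f :: "'a::euclidean_space \<Rightarrow> real"
  assumes "{x. f x \<noteq> 0} \<subseteq> \<Omega>" "\<Omega> \<in> sets lebesgue" "f \<in> borel_measurable borel"
  shows "(\<integral>x. f x \<partial>lebesgue_on \<Omega>) = (\<integral>x. f x \<partial>lborel)"
proof -
  have "(\<lambda>x. indicator \<Omega> x *\<^sub>R f x) = f" using assms(1) by (auto simp: indicator_def fun_eq_iff)
  then show ?thesis
    using assms(2,3) by (simp add: integral_restrict_space integral_completion)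
qed

text \<open>The product is itself a test function, so its partial derivative has integral zero; the
  product rule splits that integral in two.\<close>

lemma integration_by_parts_test_functions:
  fixes \<phi> \<psi> :: "'a::euclidean_space \<Rightarrow> real"
  assumes \<phi>: "\<phi> \<in> test_functions \<Omega>" and \<psi>: "\<psi> \<in> test_functions \<Omega>" and e: "e \<in> Basis" and "\<Omega> \<in> sets lebesgue"
  shows "(\<integral>x. \<phi> x * frechet_derivative \<psi> (at x) e \<partial>lebesgue_on \<Omega>) =
    - (\<integral>x. frechet_derivative \<phi> (at x) e * \<psi> x \<partial>lebesgue_on \<Omega>)"
proof -
  let ?d = "\<lambda>f x. frechet_derivative f (at x) e"
  have prods: "(\<lambda>x. \<phi> x * ?d \<psi> x) \<in> test_functions \<Omega>" "(\<lambda>x. ?d \<phi> x * \<psi> x) \<in> test_functions \<Omega>"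
    by (intro test_functions_mult[OF test_functions_derivative[OF \<psi> e] \<phi>]
      test_functions_mult[OF \<psi> test_functions_derivative[OF \<phi> e]])+
  have eq: "(\<integral>x. f x \<partial>lebesgue_on \<Omega>) = (\<integral>x. f x \<partial>lborel)" if f: "f \<in> test_functions \<Omega>" for f :: "'a \<Rightarrow> real"
    using test_functionsD(3)[OF f] closure_subset[of "{x. f x \<noteq> 0}"] test_function_integrable[OF f]
    by (intro integral_lebesgue_on_support assms) auto
  have "?d (\<lambda>x. \<phi> x * \<psi> x) x = \<phi> x * ?d \<psi> x + ?d \<phi> x * \<psi> x" for x
  proof -
    have "((\<lambda>x. \<phi> x * \<psi> x) has_derivative (\<lambda>h. \<phi> x * frechet_derivative \<psi> (at x) h + frechet_derivative \<phi> (at x) h * \<psi> x)) (at x)"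
      by (intro has_derivative_mult test_function_has_derivative[OF \<phi>] test_function_has_derivative[OF \<psi>])
    from frechet_derivative_at[OF this, symmetric] show ?thesis by simp
  qed
  then have "(\<integral>x. \<phi> x * ?d \<psi> x + ?d \<phi> x * \<psi> x \<partial>lborel) = 0"
    using integral_test_function_derivative[OF test_functions_mult[OF \<psi> \<phi>] e] by simp
  then have "(\<integral>x. \<phi> x * ?d \<psi> x \<partial>lborel) + (\<integral>x. ?d \<phi> x * \<psi> x \<partial>lborel) = 0"
    using prods by (simp add: Bochner_Integration.integral_add test_function_integrable)
  then show ?thesis using eq[OF prods(1)] eq[OF prods(2)] by simp
qed

subsection \<open>The form domain as a closed subspace of L2\<close>

lemma L2_mult_bounded:
  assumes "u \<in> L2 \<Omega>" "m \<in> borel_measurable (lebesgue_on \<Omega>)" "\<And>x. x \<in> \<Omega> \<Longrightarrow> \<bar>m x\<bar> \<le> B"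
  shows "(\<lambda>x. m x * u x) \<in> L2 \<Omega>"
proof -
  have "integrable (lebesgue_on \<Omega>) (\<lambda>x. (m x * u x)\<^sup>2)"
  proof (rule Bochner_Integration.integrable_bound)
    show "integrable (lebesgue_on \<Omega>) (\<lambda>x. B\<^sup>2 * (u x)\<^sup>2)"
      using assms(1) by (intro integrable_mult_right L2_integrable_power2)
    show "(\<lambda>x. (m x * u x)\<^sup>2) \<in> borel_measurable (lebesgue_on \<Omega>)"
      by (rule borel_measurable_power[OF borel_measurable_times[OF assms(2) L2_measurable[OF assms(1)]]])
    show "AE x in lebesgue_on \<Omega>. norm ((m x * u x)\<^sup>2) \<le> norm (B\<^sup>2 * (u x)\<^sup>2)"
    proof (rule AE_I2)
      fix x assume "x \<in> space (lebesgue_on \<Omega>)"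
      then have "\<bar>m x\<bar> \<le> \<bar>B\<bar>" using assms(3)[of x] by simp
      then have "(m x)\<^sup>2 \<le> B\<^sup>2" by (simp only: abs_le_square_iff)
      then show "norm ((m x * u x)\<^sup>2) \<le> norm (B\<^sup>2 * (u x)\<^sup>2)"
        by (simp add: power_mult_distrib mult_right_mono)
    qed
  qed
  moreover have "(\<lambda>x. m x * u x) \<in> borel_measurable (lebesgue_on \<Omega>)"
    by (rule borel_measurable_times[OF assms(2) L2_measurable[OF assms(1)]])
  ultimately show ?thesis by (simp add: L2_def)
qed

lemma subspace_closure:
  fixes S :: "'a::real_normed_vector set"
  assumes "subspace S" shows "subspace (closure S)"
proof (rule subspaceI)
  show "0 \<in> closure S" using subspace_0[OF assms] closure_subset by blast
  show "x + y \<in> closure S" if xy: "x \<in> closure S" "y \<in> closure S" for x y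
  proof -
    obtain X Y where "\<And>n. X n \<in> S" "X \<longlonglongrightarrow> x" "\<And>n. Y n \<in> S" "Y \<longlonglongrightarrow> y"
      using xy unfolding closure_sequential by blast
    then show ?thesis unfolding closure_sequential
      using subspace_add[OF assms] by (intro exI[of _ "\<lambda>n. X n + Y n"]) (auto intro: tendsto_add)
  qed
  show "c *\<^sub>R x \<in> closure S" if x: "x \<in> closure S" for c x
  proof -
    obtain X where "\<And>n. X n \<in> S" "X \<longlonglongrightarrow> x"
      using x unfolding closure_sequential by blast
    then show ?thesis unfolding closure_sequential
      using subspace_scale[OF assms] by (intro exI[of _ "\<lambda>n. c *\<^sub>R X n"]) (auto intro: tendsto_scaleR)
  qed
qed

text \<open>Positive two-sided bounds on a measurable weight make the weighted norm of the gradient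
  equivalent to the plain one. The weight 1 is a second instance, used to treat the H1 norm
  itself.\<close>

locale weighted_domain =
  fixes \<Omega> :: "(real^'n) set" and b :: "real^'n \<Rightarrow> real" and c C :: real
  assumes open_\<Omega>: "open \<Omega>" and b_meas: "b \<in> borel_measurable (lebesgue_on \<Omega>)"
    and b_bounds: "x \<in> \<Omega> \<Longrightarrow> c \<le> b x" "x \<in> \<Omega> \<Longrightarrow> b x \<le> C" and c: "0 < c"
begin

lemma meas_\<Omega>: "\<Omega> \<in> sets lebesgue" using open_\<Omega> by simp

lemmas L2_test = test_function_L2[OF _ meas_\<Omega>]
lemmas ext_simps = ext_add[OF meas_\<Omega>] ext_diff[OF meas_\<Omega>] ext_scale[OF meas_\<Omega>]

lemma axis_Basis: "axis i (1::real) \<in> Basis" by (simp add: axis_in_Basis_iff)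

abbreviation partial :: "'n \<Rightarrow> (real^'n \<Rightarrow> real) \<Rightarrow> real^'n \<Rightarrow> real" where
  "partial i \<phi> x \<equiv> frechet_derivative \<phi> (at x) (axis i 1)"

lemma partial_test: "\<phi> \<in> test_functions \<Omega> \<Longrightarrow> partial i \<phi> \<in> test_functions \<Omega>"
  by (rule test_functions_derivative[OF _ axis_Basis])

text \<open>Closed boxes have finite measure, so square integrability yields the integrability on
  boxes that the fundamental lemma asks of the difference.\<close>

lemma ext_eq_if_orthogonal_to_test_functions:
  assumes u: "u \<in> L2 \<Omega>" and v: "v \<in> L2 \<Omega>"
    and orth: "\<And>\<phi>. \<phi> \<in> test_functions \<Omega> \<Longrightarrow> L2_inner \<Omega> u \<phi> = L2_inner \<Omega> v \<phi>"
  shows "AE x in lebesgue_on \<Omega>. u x = v x"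
proof -
  have d: "(\<lambda>x. u x - v x) \<in> L2 \<Omega>" by (rule L2_diff[OF u v])
  have "AE x in lebesgue_on \<Omega>. u x - v x = 0"
  proof (rule AE_zero_if_orthogonal_to_test_functions[OF open_\<Omega>])
    fix a b assume ab: "cbox a b \<subseteq> \<Omega>"
    have "(\<lambda>x. u x - v x) \<in> L2 (cbox a b)"
    proof -
      have "integrable (lebesgue_on (cbox a b)) (\<lambda>x. (u x - v x)\<^sup>2)"
      proof -
        have 1: "integrable lebesgue (\<lambda>x. indicator \<Omega> x *\<^sub>R (u x - v x)\<^sup>2)"
          using L2_integrable_power2[OF d] meas_\<Omega> by (subst (asm) integrable_restrict_space) auto
        have "integrable lebesgue (\<lambda>x. indicator (cbox a b) x *\<^sub>R (indicator \<Omega> x *\<^sub>R (u x - v x)\<^sup>2))"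
          by (rule integrable_mult_indicator[OF _ 1]) simp
        moreover have "indicator (cbox a b) x *\<^sub>R (indicator \<Omega> x *\<^sub>R (u x - v x)\<^sup>2) = indicator (cbox a b) x *\<^sub>R (u x - v x)\<^sup>2" for x
          using ab by (auto simp: indicator_def)
        ultimately show ?thesis by (subst integrable_restrict_space) (simp, simp only:)
      qed
      moreover have "(\<lambda>x. u x - v x) \<in> borel_measurable (lebesgue_on (cbox a b))"
        using measurable_restrict_mono[OF L2_measurable[OF d] ab] .
      ultimately show ?thesis by (simp add: L2_def)
    qed
    moreover have "(\<lambda>x. 1) \<in> L2 (cbox a b)" by (simp add: L2_def finite_measure.integrable_const[OF finite_measure_lebesgue_on])
    ultimately show "integrable (lebesgue_on (cbox a b)) (\<lambda>x. u x - v x)"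
      using L2_integrable_mult[of "\<lambda>x. u x - v x" "cbox a b" "\<lambda>x. 1"] by simp
  next
    fix \<phi> assume \<phi>: "\<phi> \<in> test_functions \<Omega>"
    have "(\<integral>x. (u x - v x) * \<phi> x \<partial>lebesgue_on \<Omega>) = L2_inner \<Omega> u \<phi> - L2_inner \<Omega> v \<phi>"
      unfolding L2_inner_def left_diff_distrib
      by (intro Bochner_Integration.integral_diff L2_integrable_mult u v L2_test[OF \<phi>])
    then show "(\<integral>x. (u x - v x) * \<phi> x \<partial>lebesgue_on \<Omega>) = 0" using orth[OF \<phi>] by simp
  qed
  then show ?thesis by simp
qed

section \<open>Weak gradients and graphs of Sobolev functions\<close>

lemma weak_gradient_alt:
  assumes "u \<in> L2 \<Omega>"
  shows "weak_gradient \<Omega> u g \<longleftrightarrow> (\<forall>i. (\<lambda>x. g x $ i) \<in> L2 \<Omega>) \<and>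
    (\<forall>\<phi>\<in>test_functions \<Omega>. \<forall>i. L2_inner \<Omega> u (partial i \<phi>) = - L2_inner \<Omega> (\<lambda>x. g x $ i) \<phi>)"
  by (simp add: weak_gradient_def L2_inner_def)

text \<open>A weak gradient is determined by its integrals against test functions, and these do not
  change when \<open>u\<close> is altered on a null set; the gradient thus belongs to the class of
  \<open>u\<close>.\<close>

lemma weak_gradient_unique:
  assumes "weak_gradient \<Omega> u g" "weak_gradient \<Omega> u' g'" and eq: "AE x in lebesgue_on \<Omega>. u x = u' x"
    and u: "u \<in> L2 \<Omega>" "u' \<in> L2 \<Omega>"
  shows "AE x in lebesgue_on \<Omega>. g x $ i = g' x $ i"
proof (rule ext_eq_if_orthogonal_to_test_functions)
  fix \<phi> assume \<phi>: "\<phi> \<in> test_functions \<Omega>"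
  have "L2_inner \<Omega> u (partial i \<phi>) = L2_inner \<Omega> u' (partial i \<phi>)"
    unfolding inner_ext[OF meas_\<Omega> u(1) L2_test[OF partial_test[OF \<phi>]], symmetric]
      inner_ext[OF meas_\<Omega> u(2) L2_test[OF partial_test[OF \<phi>]], symmetric]
      ext_eq_iff[OF meas_\<Omega> u, THEN iffD2, OF eq] ..
  then show "L2_inner \<Omega> (\<lambda>x. g x $ i) \<phi> = L2_inner \<Omega> (\<lambda>x. g' x $ i) \<phi>"
    using assms(1,2) \<phi> unfolding weak_gradient_alt[OF u(1)] weak_gradient_alt[OF u(2)] by simp
qed (use assms in \<open>auto simp: weak_gradient_def\<close>)

lemma weak_gradient_add:
  assumes "weak_gradient \<Omega> u g" "weak_gradient \<Omega> v h" "u \<in> L2 \<Omega>" "v \<in> L2 \<Omega>"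
  shows "weak_gradient \<Omega> (\<lambda>x. u x + v x) (\<lambda>x. g x + h x)"
proof -
  have *: "L2_inner \<Omega> (\<lambda>x. u x + v x) w = L2_inner \<Omega> u w + L2_inner \<Omega> v w"
    if "u \<in> L2 \<Omega>" "v \<in> L2 \<Omega>" "w \<in> L2 \<Omega>" for u v w
    using that unfolding L2_inner_def distrib_right
    by (intro Bochner_Integration.integral_add L2_integrable_mult)
  note g = assms(1)[unfolded weak_gradient_alt[OF assms(3)]] and h = assms(2)[unfolded weak_gradient_alt[OF assms(4)]]
  show ?thesis unfolding weak_gradient_alt[OF L2_add[OF assms(3,4)]]
  proof (intro conjI allI ballI)
    show "(\<lambda>x. (g x + h x) $ i) \<in> L2 \<Omega>" for i using g h by (simp add: L2_add)
    fix \<phi> i assume \<phi>: "\<phi> \<in> test_functions \<Omega>"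
    have "L2_inner \<Omega> (\<lambda>x. u x + v x) (partial i \<phi>) = - L2_inner \<Omega> (\<lambda>x. g x $ i) \<phi> - L2_inner \<Omega> (\<lambda>x. h x $ i) \<phi>"
      using g h \<phi> by (subst *[OF assms(3,4) L2_test[OF partial_test[OF \<phi>]]]) simp
    also have "\<dots> = - L2_inner \<Omega> (\<lambda>x. (g x + h x) $ i) \<phi>"
      using g h by (simp add: *[OF _ _ L2_test[OF \<phi>]])
    finally show "L2_inner \<Omega> (\<lambda>x. u x + v x) (partial i \<phi>) = - L2_inner \<Omega> (\<lambda>x. (g x + h x) $ i) \<phi>" .
  qed
qed

lemma weak_gradient_scale:
  assumes "weak_gradient \<Omega> u g" "u \<in> L2 \<Omega>"
  shows "weak_gradient \<Omega> (\<lambda>x. r * u x) (\<lambda>x. r *\<^sub>R g x)"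
proof -
  have *: "L2_inner \<Omega> (\<lambda>x. r * u x) w = r * L2_inner \<Omega> u w" for u w
    by (simp add: L2_inner_def mult.assoc)
  show ?thesis using assms by (auto simp: weak_gradient_alt L2_scale *)
qed

lemma test_weak_gradient:
  assumes "\<phi> \<in> test_functions \<Omega>"
  shows "weak_gradient \<Omega> \<phi> (\<lambda>x. \<chi> i. partial i \<phi> x)"
  using integration_by_parts_test_functions[OF assms _ axis_Basis meas_\<Omega>] L2_test[OF partial_test[OF assms]]
  by (simp add: weak_gradient_def)

lemma H1_L2: "u \<in> H1 \<Omega> \<Longrightarrow> u \<in> L2 \<Omega>" and H1_wgrad: "u \<in> H1 \<Omega> \<Longrightarrow> weak_gradient \<Omega> u (wgrad \<Omega> u)"
  unfolding H1_def wgrad_def using someI[of "weak_gradient \<Omega> u"] by blast+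

lemma H1_I: "u \<in> L2 \<Omega> \<Longrightarrow> weak_gradient \<Omega> u g \<Longrightarrow> u \<in> H1 \<Omega>" by (auto simp: H1_def)

lemma test_H1: "\<phi> \<in> test_functions \<Omega> \<Longrightarrow> \<phi> \<in> H1 \<Omega>"
  by (rule H1_I[OF L2_test test_weak_gradient])

lemma H1_add: "u \<in> H1 \<Omega> \<Longrightarrow> v \<in> H1 \<Omega> \<Longrightarrow> (\<lambda>x. u x + v x) \<in> H1 \<Omega>"
  by (rule H1_I[OF L2_add weak_gradient_add]) (auto intro: H1_L2 H1_wgrad)

lemma H1_scale: "u \<in> H1 \<Omega> \<Longrightarrow> (\<lambda>x. r * u x) \<in> H1 \<Omega>"
  by (rule H1_I[OF L2_scale weak_gradient_scale]) (auto intro: H1_L2 H1_wgrad)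

lemma b_sqrt_meas: "(\<lambda>x. sqrt (b x)) \<in> borel_measurable (lebesgue_on \<Omega>)"
  "(\<lambda>x. 1 / sqrt (b x)) \<in> borel_measurable (lebesgue_on \<Omega>)"
  using b_meas by measurable

lemma L2_sqrt_mult: "u \<in> L2 \<Omega> \<Longrightarrow> (\<lambda>x. sqrt (b x) * u x) \<in> L2 \<Omega>"
  by (rule L2_mult_bounded[OF _ b_sqrt_meas(1), of _ "sqrt C"]) (use b_bounds c in force)+

lemma L2_sqrt_divide: "u \<in> L2 \<Omega> \<Longrightarrow> (\<lambda>x. 1 / sqrt (b x) * u x) \<in> L2 \<Omega>"
proof (rule L2_mult_bounded[OF _ b_sqrt_meas(2), of _ "1 / sqrt c"])
  fix x assume "x \<in> \<Omega>"
  then have "sqrt c \<le> sqrt (b x)" "0 < sqrt c" using b_bounds c by auto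
  then show "\<bar>1 / sqrt (b x)\<bar> \<le> 1 / sqrt c" by (simp add: frac_le)
qed

text \<open>The weight is absorbed into the gradient, so that the diffusion form becomes an inner
  product.\<close>

definition flux :: "(real^'n \<Rightarrow> real^'n) \<Rightarrow> (real^'n) l2 ^ 'n" where
  "flux g = (\<chi> i. ext \<Omega> (\<lambda>x. sqrt (b x) * g x $ i))"

definition graph :: "(real^'n \<Rightarrow> real) \<Rightarrow> (real^'n) l2 \<times> ((real^'n) l2 ^ 'n)" where
  "graph u = (ext \<Omega> u, flux (wgrad \<Omega> u))"

lemma flux_inner:
  assumes "\<And>i. (\<lambda>x. g x $ i) \<in> L2 \<Omega>" "\<And>i. (\<lambda>x. h x $ i) \<in> L2 \<Omega>"
  shows "flux g \<bullet> flux h = (\<integral>x. b x * (g x \<bullet> h x) \<partial>lebesgue_on \<Omega>)"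
    and "integrable (lebesgue_on \<Omega>) (\<lambda>x. b x * (g x \<bullet> h x))"
    and "integrable (lebesgue_on \<Omega>) (\<lambda>x. g x \<bullet> h x)"
proof -
  have int: "integrable (lebesgue_on \<Omega>) (\<lambda>x. (sqrt (b x) * g x $ i) * (sqrt (b x) * h x $ i))" for i
    by (intro L2_integrable_mult L2_sqrt_mult assms)
  have eq: "(\<Sum>i\<in>UNIV. (sqrt (b x) * g x $ i) * (sqrt (b x) * h x $ i)) = b x * (g x \<bullet> h x)" if "x \<in> \<Omega>" for x
  proof -
    have "sqrt (b x) * sqrt (b x) = b x" using b_bounds(1)[OF that] c by simp
    then have "(sqrt (b x) * g x $ i) * (sqrt (b x) * h x $ i) = b x * (g x $ i * h x $ i)" for i
      by (metis mult.assoc mult.left_commute)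
    then show ?thesis by (simp only: inner_vec_def sum_distrib_left inner_real_def)
  qed
  have "flux g \<bullet> flux h = (\<Sum>i\<in>UNIV. L2_inner \<Omega> (\<lambda>x. sqrt (b x) * g x $ i) (\<lambda>x. sqrt (b x) * h x $ i))"
    unfolding flux_def inner_vec_def by (simp add: inner_ext[OF meas_\<Omega>] L2_sqrt_mult assms)
  also have "\<dots> = (\<integral>x. (\<Sum>i\<in>UNIV. (sqrt (b x) * g x $ i) * (sqrt (b x) * h x $ i)) \<partial>lebesgue_on \<Omega>)"
    unfolding L2_inner_def by (rule Bochner_Integration.integral_sum[symmetric]) (rule int)
  also have "\<dots> = (\<integral>x. b x * (g x \<bullet> h x) \<partial>lebesgue_on \<Omega>)"
    by (rule Bochner_Integration.integral_cong) (auto simp: eq)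
  finally show "flux g \<bullet> flux h = (\<integral>x. b x * (g x \<bullet> h x) \<partial>lebesgue_on \<Omega>)" .
  have "integrable (lebesgue_on \<Omega>) (\<lambda>x. \<Sum>i\<in>UNIV. (sqrt (b x) * g x $ i) * (sqrt (b x) * h x $ i))"
    by (intro Bochner_Integration.integrable_sum int)
  then show "integrable (lebesgue_on \<Omega>) (\<lambda>x. b x * (g x \<bullet> h x))"
    by (rule Bochner_Integration.integrable_cong[THEN iffD1, rotated -1]) (auto simp: eq)
  have "integrable (lebesgue_on \<Omega>) (\<lambda>x. \<Sum>i\<in>UNIV. g x $ i * h x $ i)"
    by (intro Bochner_Integration.integrable_sum L2_integrable_mult assms)
  then show "integrable (lebesgue_on \<Omega>) (\<lambda>x. g x \<bullet> h x)" by (simp add: inner_vec_def)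
qed

lemma wgrad_L2: "u \<in> H1 \<Omega> \<Longrightarrow> (\<lambda>x. wgrad \<Omega> u x $ i) \<in> L2 \<Omega>"
  using H1_wgrad by (auto simp: weak_gradient_def)

lemma diffusion_eq: "u \<in> H1 \<Omega> \<Longrightarrow> v \<in> H1 \<Omega> \<Longrightarrow> diffusion_operator \<Omega> b u v = snd (graph u) \<bullet> snd (graph v)"
  by (simp add: diffusion_operator_def graph_def flux_inner(1)[OF wgrad_L2 wgrad_L2])

lemma flux_cong:
  assumes "\<And>i. (\<lambda>x. g x $ i) \<in> L2 \<Omega>" "\<And>i. (\<lambda>x. h x $ i) \<in> L2 \<Omega>" "\<And>i. AE x in lebesgue_on \<Omega>. g x $ i = h x $ i"
  shows "flux g = flux h"
  unfolding flux_def vec_eq_iff vec_lambda_beta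
proof
  fix i
  have "AE x in lebesgue_on \<Omega>. sqrt (b x) * g x $ i = sqrt (b x) * h x $ i"
    using assms(3)[of i] by eventually_elim simp
  then show "ext \<Omega> (\<lambda>x. sqrt (b x) * g x $ i) = ext \<Omega> (\<lambda>x. sqrt (b x) * h x $ i)"
    by (simp add: ext_eq_iff[OF meas_\<Omega>] L2_sqrt_mult assms)
qed

text \<open>\<open>wgrad\<close> is an arbitrary choice, but two weak gradients agree almost
  everywhere, so the graph may be computed with whichever gradient is at hand.\<close>

lemma graph_eq:
  assumes "u \<in> L2 \<Omega>" "weak_gradient \<Omega> u g"
  shows "graph u = (ext \<Omega> u, flux g)"
proof -
  have "u \<in> H1 \<Omega>" using assms by (rule H1_I)
  then have "flux (wgrad \<Omega> u) = flux g"
    using assms by (intro flux_cong weak_gradient_unique[OF H1_wgrad assms(2)]) (auto simp: weak_gradient_def wgrad_L2)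
  then show ?thesis by (simp add: graph_def)
qed

lemma graph_add:
  assumes "u \<in> H1 \<Omega>" "v \<in> H1 \<Omega>" shows "graph (\<lambda>x. u x + v x) = graph u + graph v"
proof -
  have "graph (\<lambda>x. u x + v x) = (ext \<Omega> (\<lambda>x. u x + v x), flux (\<lambda>x. wgrad \<Omega> u x + wgrad \<Omega> v x))"
    using assms by (intro graph_eq L2_add weak_gradient_add) (auto simp: H1_L2 H1_wgrad)
  also have "\<dots> = graph u + graph v"
    using assms by (simp add: H1_L2 graph_def ext_simps flux_def vec_eq_iff L2_sqrt_mult wgrad_L2 distrib_left)
  finally show ?thesis .
qed

lemma graph_scale:
  assumes "u \<in> H1 \<Omega>" shows "graph (\<lambda>x. r * u x) = r *\<^sub>R graph u"
proof -
  have "graph (\<lambda>x. r * u x) = (ext \<Omega> (\<lambda>x. r * u x), flux (\<lambda>x. r *\<^sub>R wgrad \<Omega> u x))"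
    using assms by (intro graph_eq L2_scale weak_gradient_scale) (auto simp: H1_L2 H1_wgrad)
  also have "\<dots> = r *\<^sub>R graph u"
    using assms ext_scale[OF meas_\<Omega>, of "\<lambda>x. sqrt (b x) * wgrad \<Omega> u x $ i" r for i]
    by (simp add: H1_L2 graph_def ext_simps flux_def vec_eq_iff L2_sqrt_mult wgrad_L2 mult.left_commute)
  finally show ?thesis .
qed

lemma H1_diff:
  assumes "u \<in> H1 \<Omega>" "v \<in> H1 \<Omega>"
  shows "u - v \<in> H1 \<Omega>" "graph (u - v) = graph u - graph v"
proof -
  have "u - v = (\<lambda>x. u x + (-1) * v x)" by (simp add: fun_eq_iff)
  then show "u - v \<in> H1 \<Omega>" "graph (u - v) = graph u - graph v"
    using graph_add[OF assms(1) H1_scale[OF assms(2), of "-1"]] graph_scale[OF assms(2), of "-1"]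
      H1_add[OF assms(1) H1_scale[OF assms(2), of "-1"]] by simp_all
qed

text \<open>In the squared norm of the graph the function has weight 1 and the gradient a weight
  between \<open>c\<close> and \<open>C\<close>, hence the minimum and the maximum with 1.\<close>

lemma norm_graph:
  assumes u: "u \<in> H1 \<Omega>"
  shows "sqrt (min 1 c) * H1_norm \<Omega> u \<le> norm (graph u)" "norm (graph u) \<le> sqrt (max 1 C) * H1_norm \<Omega> u"
proof -
  let ?g = "wgrad \<Omega> u"
  define p where "p = L2_inner \<Omega> u u"
  define q where "q = (\<integral>x. ?g x \<bullet> ?g x \<partial>lebesgue_on \<Omega>)"
  define s where "s = (\<integral>x. b x * (?g x \<bullet> ?g x) \<partial>lebesgue_on \<Omega>)"
  note int = flux_inner[OF wgrad_L2[OF u] wgrad_L2[OF u]]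
  have "(\<integral>x. c * (?g x \<bullet> ?g x) \<partial>lebesgue_on \<Omega>) \<le> s"
    unfolding s_def by (intro integral_mono integrable_mult_right int mult_right_mono b_bounds) auto
  then have s1: "c * q \<le> s" by (simp add: q_def)
  have "s \<le> (\<integral>x. C * (?g x \<bullet> ?g x) \<partial>lebesgue_on \<Omega>)"
    unfolding s_def by (intro integral_mono integrable_mult_right int mult_right_mono b_bounds) auto
  then have s2: "s \<le> C * q" by (simp add: q_def)
  have pos: "0 \<le> p" "0 \<le> q" by (auto simp: p_def q_def L2_inner_def)
  have n: "norm (graph u) = sqrt (p + s)"
    by (simp add: norm_eq_sqrt_inner graph_def inner_prod_def int(1) p_def s_def inner_ext[OF meas_\<Omega>] H1_L2[OF u])
  have h: "H1_norm \<Omega> u = sqrt (p + q)" by (simp add: H1_norm_def H1_inner_def p_def q_def)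
  have "min 1 c * (p + q) = min 1 c * p + min 1 c * q" by (rule distrib_left)
  also have "\<dots> \<le> 1 * p + c * q" using pos by (intro add_mono mult_right_mono) auto
  finally show "sqrt (min 1 c) * H1_norm \<Omega> u \<le> norm (graph u)"
    using s1 unfolding n h by (simp add: real_sqrt_mult[symmetric])
  have "1 * p + C * q \<le> max 1 C * p + max 1 C * q" using pos by (intro add_mono mult_right_mono) auto
  then show "norm (graph u) \<le> sqrt (max 1 C) * H1_norm \<Omega> u"
    using s2 unfolding n h by (simp add: real_sqrt_mult[symmetric] distrib_left)
qed

text \<open>Closed by construction. That it consists of the graphs of the functions in
  \<open>H10 \<Omega>\<close> is shown below.\<close>

definition W :: "((real^'n) l2 \<times> ((real^'n) l2 ^ 'n)) set" where
  "W = closure (graph ` test_functions \<Omega>)"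

lemma subspace_W: "subspace W"
proof -
  have "subspace (graph ` test_functions \<Omega>)"
  proof (rule subspaceI)
    have "graph (\<lambda>x. 0) = 0" using graph_scale[OF test_H1[OF test_functions_zero], of 0] by simp
    then show "0 \<in> graph ` test_functions \<Omega>" using test_functions_zero by (metis imageI)
    show "x + y \<in> graph ` test_functions \<Omega>" if xy: "x \<in> graph ` test_functions \<Omega>" "y \<in> graph ` test_functions \<Omega>" for x y
    proof -
      obtain u v where "x = graph u" "y = graph v" "u \<in> test_functions \<Omega>" "v \<in> test_functions \<Omega>" using xy by auto
      then show ?thesis
        using graph_add[OF test_H1 test_H1, of u v] test_functions_add[of u \<Omega> v] by (metis imageI)
    qed
    show "r *\<^sub>R x \<in> graph ` test_functions \<Omega>" if x: "x \<in> graph ` test_functions \<Omega>" for r x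
    proof -
      obtain u where "x = graph u" "u \<in> test_functions \<Omega>" using x by auto
      then show ?thesis using graph_scale[OF test_H1, of u r] test_functions_scale[of u \<Omega> r] by (metis imageI)
    qed
  qed
  then show ?thesis unfolding W_def by (rule subspace_closure)
qed

lemma H10_graph: assumes "u \<in> H10 \<Omega>" shows "u \<in> H1 \<Omega>" "graph u \<in> W"
proof -
  show u: "u \<in> H1 \<Omega>" using assms by (simp add: H10_def)
  show "graph u \<in> W"
    unfolding W_def closure_approachable
  proof (intro allI impI)
    fix e :: real assume e: "e > 0"
    define m where "m = sqrt (max 1 C)"
    have m: "m > 0" by (simp add: m_def less_max_iff_disj)
    from assms e m obtain \<phi> where \<phi>: "\<phi> \<in> test_functions \<Omega>" "H1_norm \<Omega> (u - \<phi>) < e / m"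
      unfolding H10_def by (auto dest!: spec[of _ "e / m"])
    have "norm (graph u - graph \<phi>) \<le> m * H1_norm \<Omega> (u - \<phi>)"
      using norm_graph(2)[OF H1_diff(1)[OF u test_H1[OF \<phi>(1)]]] H1_diff(2)[OF u test_H1[OF \<phi>(1)]] by (simp add: m_def)
    also have "\<dots> < e" using \<phi>(2) m by (simp add: field_simps)
    finally show "\<exists>y\<in>graph ` test_functions \<Omega>. dist y (graph u) < e"
      using \<phi>(1) by (auto simp: dist_norm norm_minus_commute)
  qed
qed

text \<open>These are the classes supported in the domain, the fixed points of the continuous
  restriction map.\<close>

lemma closed_ext_rep: "closed {h. ext \<Omega> (rep_l2 h) = h}"
proof -
  have "continuous_on UNIV (\<lambda>h. ext \<Omega> (rep_l2 h))"
    by (rule norm_Lipschitz_continuous_on[of _ 1]) (simp add: norm_ext_rep_diff[OF meas_\<Omega>])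
  then show ?thesis by (intro closed_Collect_eq continuous_on_id)
qed

lemma W_ext_rep:
  assumes "w \<in> W" shows "ext \<Omega> (rep_l2 (fst w)) = fst w" "ext \<Omega> (rep_l2 (snd w $ i)) = snd w $ i"
proof -
  have "closed (fst -` {h. ext \<Omega> (rep_l2 h) = h} \<inter> (\<lambda>w. snd w $ i) -` {h. ext \<Omega> (rep_l2 h) = h})"
    by (intro closed_Int closed_vimage closed_ext_rep continuous_intros)
  moreover have "graph ` test_functions \<Omega> \<subseteq> fst -` {h. ext \<Omega> (rep_l2 h) = h} \<inter> (\<lambda>w. snd w $ i) -` {h. ext \<Omega> (rep_l2 h) = h}"
    by (auto simp: graph_def flux_def ext_rep_ext[OF meas_\<Omega>] L2_test L2_sqrt_mult wgrad_L2 test_H1)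
  ultimately have "W \<subseteq> fst -` {h. ext \<Omega> (rep_l2 h) = h} \<inter> (\<lambda>w. snd w $ i) -` {h. ext \<Omega> (rep_l2 h) = h}"
    unfolding W_def by (rule closure_minimal[rotated])
  then show "ext \<Omega> (rep_l2 (fst w)) = fst w" "ext \<Omega> (rep_l2 (snd w $ i)) = snd w $ i" using assms by auto
qed

text \<open>On graphs of test functions this is the defining identity of the weak gradient, with the
  factor 1/sqrt(b) cancelling the weight. Both terms are continuous in \<open>w\<close>, so the
  identity survives the closure.\<close>

lemma W_weak_gradient:
  assumes "w \<in> W" "\<phi> \<in> test_functions \<Omega>"
  shows "fst w \<bullet> ext \<Omega> (partial i \<phi>) + snd w $ i \<bullet> ext \<Omega> (\<lambda>x. 1 / sqrt (b x) * \<phi> x) = 0"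
proof -
  let ?S = "{w. fst w \<bullet> ext \<Omega> (partial i \<phi>) + snd w $ i \<bullet> ext \<Omega> (\<lambda>x. 1 / sqrt (b x) * \<phi> x) = 0}"
  have "closed ?S" by (intro closed_Collect_eq continuous_intros)
  moreover have "graph \<psi> \<in> ?S" if \<psi>: "\<psi> \<in> test_functions \<Omega>" for \<psi>
  proof -
    note H = test_H1[OF \<psi>]
    have "ext \<Omega> (\<lambda>x. sqrt (b x) * wgrad \<Omega> \<psi> x $ i) \<bullet> ext \<Omega> (\<lambda>x. 1 / sqrt (b x) * \<phi> x)
      = L2_inner \<Omega> (\<lambda>x. sqrt (b x) * wgrad \<Omega> \<psi> x $ i) (\<lambda>x. 1 / sqrt (b x) * \<phi> x)"
      by (intro inner_ext[OF meas_\<Omega>] L2_sqrt_mult L2_sqrt_divide wgrad_L2 H L2_test[OF assms(2)])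
    also have "\<dots> = L2_inner \<Omega> (\<lambda>x. wgrad \<Omega> \<psi> x $ i) \<phi>"
      unfolding L2_inner_def
    proof (rule Bochner_Integration.integral_cong[OF refl])
      fix x assume "x \<in> space (lebesgue_on \<Omega>)"
      then have "sqrt (b x) \<noteq> 0" using b_bounds(1)[of x] c by auto
      then show "sqrt (b x) * wgrad \<Omega> \<psi> x $ i * (1 / sqrt (b x) * \<phi> x) = wgrad \<Omega> \<psi> x $ i * \<phi> x" by simp
    qed
    finally have *: "snd (graph \<psi>) $ i \<bullet> ext \<Omega> (\<lambda>x. 1 / sqrt (b x) * \<phi> x) = L2_inner \<Omega> (\<lambda>x. wgrad \<Omega> \<psi> x $ i) \<phi>"
      by (simp add: graph_def flux_def)
    have "fst (graph \<psi>) \<bullet> ext \<Omega> (partial i \<phi>) = L2_inner \<Omega> \<psi> (partial i \<phi>)"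
      using inner_ext[OF meas_\<Omega> L2_test[OF \<psi>] L2_test[OF partial_test[OF assms(2)]]] by (simp add: graph_def)
    also have "\<dots> = - L2_inner \<Omega> (\<lambda>x. wgrad \<Omega> \<psi> x $ i) \<phi>"
      using H1_wgrad[OF H] assms(2) unfolding weak_gradient_alt[OF L2_test[OF \<psi>]] by blast
    finally show ?thesis using * by simp
  qed
  ultimately have "W \<subseteq> ?S" unfolding W_def by (intro closure_minimal) auto
  with assms(1) show ?thesis by blast
qed

text \<open>The weak gradient is a closed operator: removing the weight from the second component of
  \<open>w\<close> gives a weak gradient of any function representing the first. The approximating
  test functions come from the definition of \<open>W\<close> and the lower norm bound.\<close>

lemma W_imp_H10:
  assumes w: "w \<in> W" and u: "u \<in> L2 \<Omega>" "ext \<Omega> u = fst w"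
  shows "u \<in> H10 \<Omega>" "graph u = w"
proof -
  define g where "g = (\<lambda>x. \<chi> i. 1 / sqrt (b x) * rep_l2 (snd w $ i) x)"
  have gL2: "(\<lambda>x. g x $ i) \<in> L2 \<Omega>" for i by (simp add: g_def L2_sqrt_divide[simplified] rep_l2_L2[OF meas_\<Omega>])
  have wg: "weak_gradient \<Omega> u g"
    unfolding weak_gradient_alt[OF u(1)]
  proof (intro conjI allI ballI gL2)
    fix \<phi> i assume \<phi>: "\<phi> \<in> test_functions \<Omega>"
    have "snd w $ i \<bullet> ext \<Omega> (\<lambda>x. 1 / sqrt (b x) * \<phi> x) = ext \<Omega> (rep_l2 (snd w $ i)) \<bullet> ext \<Omega> (\<lambda>x. 1 / sqrt (b x) * \<phi> x)"
      using W_ext_rep(2)[OF w] by simp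
    also have "\<dots> = L2_inner \<Omega> (rep_l2 (snd w $ i)) (\<lambda>x. 1 / sqrt (b x) * \<phi> x)"
      by (intro inner_ext[OF meas_\<Omega>] rep_l2_L2[OF meas_\<Omega>] L2_sqrt_divide L2_test[OF \<phi>])
    also have "\<dots> = L2_inner \<Omega> (\<lambda>x. g x $ i) \<phi>" by (simp add: L2_inner_def g_def mult.commute mult.left_commute)
    finally show "L2_inner \<Omega> u (partial i \<phi>) = - L2_inner \<Omega> (\<lambda>x. g x $ i) \<phi>"
      using W_weak_gradient[OF w \<phi>, of i] inner_ext[OF meas_\<Omega> u(1) L2_test[OF partial_test[OF \<phi>]], of i]
      by (simp add: u(2))
  qed
  have "flux g = snd w"
    unfolding flux_def vec_eq_iff vec_lambda_beta
  proof
    fix i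
    have "ext \<Omega> (\<lambda>x. sqrt (b x) * g x $ i) = ext \<Omega> (rep_l2 (snd w $ i))"
      unfolding ext_eq_iff[OF meas_\<Omega> L2_sqrt_mult[OF gL2] rep_l2_L2[OF meas_\<Omega>]]
    proof (rule AE_I2)
      fix x assume "x \<in> space (lebesgue_on \<Omega>)"
      then have "sqrt (b x) \<noteq> 0" using b_bounds(1)[of x] c by auto
      then show "sqrt (b x) * g x $ i = rep_l2 (snd w $ i) x" by (simp add: g_def)
    qed
    then show "ext \<Omega> (\<lambda>x. sqrt (b x) * g x $ i) = snd w $ i" using W_ext_rep(2)[OF w] by simp
  qed
  then show gu: "graph u = w" using graph_eq[OF u(1) wg] by (simp add: u(2))
  have H: "u \<in> H1 \<Omega>" using u(1) wg by (rule H1_I)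
  have "\<exists>\<phi>\<in>test_functions \<Omega>. H1_norm \<Omega> (u - \<phi>) < e" if e: "e > 0" for e
  proof -
    define m where "m = sqrt (min 1 c)"
    have m: "m > 0" using c by (simp add: m_def)
    have "w \<in> closure (graph ` test_functions \<Omega>)" using w by (simp add: W_def)
    then obtain \<phi> where \<phi>: "\<phi> \<in> test_functions \<Omega>" "norm (graph \<phi> - w) < m * e"
      using m e unfolding closure_approachable by (auto dest!: spec[of _ "m * e"] simp: dist_norm)
    have "m * H1_norm \<Omega> (u - \<phi>) \<le> norm (graph u - graph \<phi>)"
      using norm_graph(1)[OF H1_diff(1)[OF H test_H1[OF \<phi>(1)]]] H1_diff(2)[OF H test_H1[OF \<phi>(1)]] by (simp add: m_def)
    also have "\<dots> < m * e" using \<phi>(2) gu by (simp add: norm_minus_commute)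
    finally show ?thesis using \<phi>(1) m by auto
  qed
  then show "u \<in> H10 \<Omega>" using H by (simp add: H10_def)
qed

text \<open>Closure under the operations is inherited from the subspace \<open>W\<close>, because a
  function in H1 whose graph lies in \<open>W\<close> belongs to
  \<open>H10 \<Omega>\<close>.\<close>

lemma H10_subspace:
  assumes "u \<in> H10 \<Omega>" "v \<in> H10 \<Omega>"
  shows "u + v \<in> H10 \<Omega>" "r *\<^sub>R u \<in> H10 \<Omega>" "u - v \<in> H10 \<Omega>"
    "graph (u + v) = graph u + graph v" "graph (r *\<^sub>R u) = r *\<^sub>R graph u" "graph (u - v) = graph u - graph v"
proof -
  note u = H10_graph[OF assms(1)] and v = H10_graph[OF assms(2)]
  have eq: "u + v = (\<lambda>x. u x + v x)" "r *\<^sub>R u = (\<lambda>x. r * u x)" by (auto simp: fun_eq_iff scaleR_fun_def)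
  show g: "graph (u + v) = graph u + graph v" "graph (r *\<^sub>R u) = r *\<^sub>R graph u" "graph (u - v) = graph u - graph v"
    unfolding eq using graph_add[OF u(1) v(1)] graph_scale[OF u(1)] H1_diff(2)[OF u(1) v(1)] by auto
  have H: "u + v \<in> H1 \<Omega>" "r *\<^sub>R u \<in> H1 \<Omega>" "u - v \<in> H1 \<Omega>"
    unfolding eq using H1_add[OF u(1) v(1)] H1_scale[OF u(1)] H1_diff(1)[OF u(1) v(1)] by auto
  have "graph (u + v) \<in> W" "graph (r *\<^sub>R u) \<in> W" "graph (u - v) \<in> W"
    unfolding g using u v subspace_W by (auto intro: subspace_add subspace_scale subspace_diff)
  note * = this
  have "f \<in> H10 \<Omega>" if "graph f \<in> W" "f \<in> H1 \<Omega>" for f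
    by (rule W_imp_H10(1)[OF that(1) H1_L2[OF that(2)]]) (simp add: graph_def)
  with * H show "u + v \<in> H10 \<Omega>" "r *\<^sub>R u \<in> H10 \<Omega>" "u - v \<in> H10 \<Omega>" by auto
qed

text \<open>This is the density of V in H: the part of \<open>u\<close> orthogonal to the closure is
  orthogonal to every test function, and vanishes by the fundamental lemma.\<close>

lemma ext_in_closure_W:
  assumes u: "u \<in> L2 \<Omega>"
  shows "ext \<Omega> u \<in> closure (fst ` W)"
proof -
  let ?Y = "closure (fst ` W)"
  have "subspace ?Y"
    by (intro subspace_closure linear_subspace_image subspace_W) (simp add: linear_iff)
  then obtain p where p: "p \<in> ?Y" "\<And>y. y \<in> ?Y \<Longrightarrow> (ext \<Omega> u - p) \<bullet> y = 0"
    using orthogonal_projection_exists[of ?Y "ext \<Omega> u"] by auto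
  have "fst ` W \<subseteq> {h. ext \<Omega> (rep_l2 h) = h}" using W_ext_rep(1) by auto
  then have "?Y \<subseteq> {h. ext \<Omega> (rep_l2 h) = h}" by (intro closure_minimal closed_ext_rep)
  then have pr: "ext \<Omega> (rep_l2 p) = p" using p(1) by auto
  have "AE x in lebesgue_on \<Omega>. u x = rep_l2 p x"
  proof (rule ext_eq_if_orthogonal_to_test_functions[OF u rep_l2_L2[OF meas_\<Omega>]])
    fix \<phi> assume \<phi>: "\<phi> \<in> test_functions \<Omega>"
    have "graph \<phi> \<in> W" unfolding W_def by (intro closure_subset[THEN subsetD] imageI \<phi>)
    then have "fst (graph \<phi>) \<in> ?Y" by (intro closure_subset[THEN subsetD] imageI)
    then have "ext \<Omega> \<phi> \<in> ?Y" by (simp add: graph_def)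
    from p(2)[OF this] have "ext \<Omega> u \<bullet> ext \<Omega> \<phi> = ext \<Omega> (rep_l2 p) \<bullet> ext \<Omega> \<phi>" by (simp add: pr inner_diff_left)
    then show "L2_inner \<Omega> u \<phi> = L2_inner \<Omega> (rep_l2 p) \<phi>"
      by (simp add: inner_ext[OF meas_\<Omega>] u rep_l2_L2[OF meas_\<Omega>] L2_test[OF \<phi>])
  qed
  then have "ext \<Omega> u = p" using ext_eq_iff[OF meas_\<Omega> u rep_l2_L2[OF meas_\<Omega>]] pr by metis
  with p(1) show ?thesis by simp
qed

end

subsection \<open>Duals and Bochner spaces of seminormed carriers\<close>

lemma tendsto_abs_bound:
  fixes f g :: "nat \<Rightarrow> real"
  assumes "\<And>i. \<bar>f i - l\<bar> \<le> g i" "g \<longlonglongrightarrow> 0"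
  shows "f \<longlonglongrightarrow> l"
proof -
  have "(\<lambda>i. f i - l) \<longlonglongrightarrow> 0"
    by (rule Lim_null_comparison[OF _ assms(2)]) (simp add: assms(1))
  then show ?thesis by (simp add: LIM_zero_iff)
qed

section \<open>Seminormed carriers and their dual seminorms\<close>

locale seminorm_on =
  fixes X :: "'a::real_vector set" and p :: "'a \<Rightarrow> real"
  assumes subspace: "subspace X"
    and triangle: "u \<in> X \<Longrightarrow> v \<in> X \<Longrightarrow> p (u + v) \<le> p u + p v"
    and scale: "u \<in> X \<Longrightarrow> p (c *\<^sub>R u) = \<bar>c\<bar> * p u"
begin

lemma zero: "0 \<in> X" "p 0 = 0"
  using subspace_0[OF subspace] scale[of 0 0] by auto

lemma uminus: "u \<in> X \<Longrightarrow> - u \<in> X" "u \<in> X \<Longrightarrow> p (- u) = p u"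
  using subspace_neg[OF subspace] scale[of u "-1"] by auto

lemma diff: "u \<in> X \<Longrightarrow> v \<in> X \<Longrightarrow> u - v \<in> X" using subspace_diff[OF subspace] .

lemma nonneg: "u \<in> X \<Longrightarrow> 0 \<le> p u"
  using triangle[of u "- u"] uminus[of u] zero by simp

lemma triangle_diff:
  assumes "u \<in> X" "v \<in> X" "w \<in> X" shows "p (u - w) \<le> p (u - v) + p (v - w)"
  using triangle[OF diff[OF assms(1,2)] diff[OF assms(2,3)]] by simp

lemma diff_commute: "u \<in> X \<Longrightarrow> v \<in> X \<Longrightarrow> p (u - v) = p (v - u)"
  using uminus(2)[of "u - v"] diff[of u v] by simp

lemma triangle_abs: "u \<in> X \<Longrightarrow> v \<in> X \<Longrightarrow> \<bar>p u - p v\<bar> \<le> p (u - v)"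
  using triangle[of "u - v" v] triangle[of "v - u" u] diff diff_commute[of u v] by fastforce

lemma dual_norm_le:
  assumes "\<And>v. v \<in> X \<Longrightarrow> \<bar>\<Lambda> v\<bar> \<le> C * p v" "0 \<le> C"
  shows "dual_norm X p \<Lambda> \<le> C"
  unfolding dual_norm_def
proof (rule cSup_least)
  show "{\<bar>\<Lambda> v\<bar> |v. v \<in> X \<and> p v \<le> 1} \<noteq> {}" using zero by auto
  fix r assume "r \<in> {\<bar>\<Lambda> v\<bar> |v. v \<in> X \<and> p v \<le> 1}"
  then obtain v where v: "r = \<bar>\<Lambda> v\<bar>" "v \<in> X" "p v \<le> 1" by auto
  have "C * p v \<le> C" using v(3) assms(2) by (simp add: mult_left_le)
  then show "r \<le> C" using assms(1)[OF v(2)] v(1) by linarith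
qed

lemma bdd_above_dual:
  assumes "\<Lambda> \<in> dual X p" shows "bdd_above {\<bar>\<Lambda> v\<bar> |v. v \<in> X \<and> p v \<le> 1}"
proof -
  obtain C where C: "\<And>v. v \<in> X \<Longrightarrow> \<bar>\<Lambda> v\<bar> \<le> C * p v" using assms unfolding dual_def by blast
  show ?thesis
  proof (rule bdd_aboveI[of _ "\<bar>C\<bar>"])
    fix r assume "r \<in> {\<bar>\<Lambda> v\<bar> |v. v \<in> X \<and> p v \<le> 1}"
    then obtain w where w: "r = \<bar>\<Lambda> w\<bar>" "w \<in> X" "p w \<le> 1" by auto
    have "C * p w \<le> \<bar>C\<bar> * 1" using w nonneg[OF w(2)] by (intro mult_mono) auto
    then show "r \<le> \<bar>C\<bar>" using C[OF w(2)] w(1) by simp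
  qed
qed

text \<open>When \<open>p v\<close> is positive, normalise \<open>v\<close>. When it is 0, the bound
  that exists by definition of the dual already forces the value 0.\<close>

lemma dual_bound:
  assumes "\<Lambda> \<in> dual X p" "v \<in> X"
  shows "\<bar>\<Lambda> v\<bar> \<le> dual_norm X p \<Lambda> * p v"
proof -
  obtain C where C: "\<And>v. v \<in> X \<Longrightarrow> \<bar>\<Lambda> v\<bar> \<le> C * p v" using assms(1) unfolding dual_def by blast
  have hom: "\<Lambda> (r *\<^sub>R v) = r * \<Lambda> v" for r using assms by (auto simp: dual_def)
  show ?thesis
  proof (cases "p v = 0")
    case True
    then show ?thesis using C[OF assms(2)] by simp
  next
    case False
    then have pos: "p v > 0" using nonneg[OF assms(2)] by simp
    note bdd = bdd_above_dual[OF assms(1)]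
    have "\<bar>\<Lambda> ((1 / p v) *\<^sub>R v)\<bar> \<le> dual_norm X p \<Lambda>"
      unfolding dual_norm_def
    proof (rule cSup_upper[OF _ bdd])
      show "\<bar>\<Lambda> ((1 / p v) *\<^sub>R v)\<bar> \<in> {\<bar>\<Lambda> v\<bar> |v. v \<in> X \<and> p v \<le> 1}"
        using assms(2) pos subspace_scale[OF subspace assms(2)] by (auto simp: scale intro!: exI[of _ "(1 / p v) *\<^sub>R v"])
    qed
    then show ?thesis using pos by (simp add: hom abs_mult field_simps)
  qed
qed

lemma dual_norm_nonneg: "0 \<le> dual_norm X p \<Lambda>" if "\<Lambda> \<in> dual X p"
proof -
  have "\<bar>\<Lambda> 0\<bar> \<le> dual_norm X p \<Lambda>"
    unfolding dual_norm_def using zero by (intro cSup_upper bdd_above_dual that) auto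
  then show ?thesis by linarith
qed

text \<open>Subadditivity and the upper bound for multiples follow from the pointwise bounds;
  applying that upper bound once more with the reciprocal factor gives exact homogeneity.\<close>

lemma seminorm_dual: "seminorm_on (dual X p) (dual_norm X p)"
proof
  show sub: "subspace (dual X p)"
  proof (rule subspaceI)
    show "0 \<in> dual X p" by (auto simp: dual_def intro!: exI[of _ 0])
    show "\<Lambda> + M \<in> dual X p" if "\<Lambda> \<in> dual X p" "M \<in> dual X p" for \<Lambda> M
    proof -
      have "\<bar>(\<Lambda> + M) v\<bar> \<le> (dual_norm X p \<Lambda> + dual_norm X p M) * p v" if "v \<in> X" for v
        using dual_bound[OF \<open>\<Lambda> \<in> dual X p\<close> that] dual_bound[OF \<open>M \<in> dual X p\<close> that] by (simp add: distrib_right)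
      then have "\<exists>C. \<forall>v\<in>X. \<bar>(\<Lambda> + M) v\<bar> \<le> C * p v" by blast
      then show ?thesis using that by (simp add: dual_def distrib_left)
    qed
    show "c *\<^sub>R \<Lambda> \<in> dual X p" if "\<Lambda> \<in> dual X p" for c \<Lambda>
    proof -
      have "\<bar>(c *\<^sub>R \<Lambda>) v\<bar> \<le> (\<bar>c\<bar> * dual_norm X p \<Lambda>) * p v" if "v \<in> X" for v
        using mult_left_mono[OF dual_bound[OF \<open>\<Lambda> \<in> dual X p\<close> that], of "\<bar>c\<bar>"]
        by (simp add: scaleR_fun_def abs_mult mult.assoc)
      then have "\<exists>C. \<forall>v\<in>X. \<bar>(c *\<^sub>R \<Lambda>) v\<bar> \<le> C * p v" by blast
      then show ?thesis using that by (simp add: dual_def scaleR_fun_def distrib_left mult.left_commute)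
    qed
  qed
  show "dual_norm X p (\<Lambda> + M) \<le> dual_norm X p \<Lambda> + dual_norm X p M" if "\<Lambda> \<in> dual X p" "M \<in> dual X p" for \<Lambda> M
  proof (rule dual_norm_le)
    show "\<bar>(\<Lambda> + M) v\<bar> \<le> (dual_norm X p \<Lambda> + dual_norm X p M) * p v" if "v \<in> X" for v
      using dual_bound[OF \<open>\<Lambda> \<in> dual X p\<close> that] dual_bound[OF \<open>M \<in> dual X p\<close> that] by (simp add: distrib_right)
  qed (use that dual_norm_nonneg in auto)
  have le: "dual_norm X p (c *\<^sub>R \<Lambda>) \<le> \<bar>c\<bar> * dual_norm X p \<Lambda>" if "\<Lambda> \<in> dual X p" for c \<Lambda>
  proof (rule dual_norm_le)
    show "\<bar>(c *\<^sub>R \<Lambda>) v\<bar> \<le> (\<bar>c\<bar> * dual_norm X p \<Lambda>) * p v" if "v \<in> X" for v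
      using mult_left_mono[OF dual_bound[OF \<open>\<Lambda> \<in> dual X p\<close> that], of "\<bar>c\<bar>"]
      by (simp add: scaleR_fun_def abs_mult mult.assoc)
  qed (use that dual_norm_nonneg in auto)
  show "dual_norm X p (c *\<^sub>R \<Lambda>) = \<bar>c\<bar> * dual_norm X p \<Lambda>" if \<Lambda>: "\<Lambda> \<in> dual X p" for c \<Lambda>
  proof (cases "c = 0")
    case True
    then show ?thesis using le[OF \<Lambda>, of 0] dual_norm_nonneg[OF subspace_0[OF sub]] by simp
  next
    case False
    have "dual_norm X p ((1 / c) *\<^sub>R (c *\<^sub>R \<Lambda>)) \<le> \<bar>1 / c\<bar> * dual_norm X p (c *\<^sub>R \<Lambda>)"
      by (rule le[OF subspace_scale[OF sub \<Lambda>]])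
    then have "\<bar>c\<bar> * dual_norm X p \<Lambda> \<le> dual_norm X p (c *\<^sub>R \<Lambda>)"
      using False by (simp add: field_simps)
    then show ?thesis using le[OF \<Lambda>, of c] by simp
  qed
qed

end

text \<open>Lebesgue measure is complete, so changing the everywhere defined \<open>lim\<close> on a
  null set keeps it measurable.\<close>

lemma borel_measurable_lebesgue_on_AE_limit:
  fixes f :: "nat \<Rightarrow> 'a::euclidean_space \<Rightarrow> real"
  assumes S: "S \<in> sets lebesgue" and f: "\<And>n. f n \<in> borel_measurable (lebesgue_on S)"
    and lim: "AE t in lebesgue_on S. (\<lambda>n. f n t) \<longlonglongrightarrow> g t"
  shows "g \<in> borel_measurable (lebesgue_on S)"
proof -
  define h where "h = (\<lambda>t. lim (\<lambda>n. f n t))"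
  have h: "h \<in> borel_measurable (lebesgue_on S)" unfolding h_def by (rule borel_measurable_lim_metric[OF f])
  have "AE t in lebesgue_on S. h t = g t" using lim by eventually_elim (simp add: h_def limI)
  then have "AE t in lebesgue. t \<in> S \<longrightarrow> h t = g t" using S by (simp add: AE_restrict_space_iff)
  then have "AE t in lebesgue. (if t \<in> S then h t else 0) = (if t \<in> S then g t else 0)"
    by eventually_elim simp
  from borel_measurable_AE[OF _ this] have "(\<lambda>t. if t \<in> S then g t else 0) \<in> borel_measurable lebesgue"
    using borel_measurable_if[OF S, of h] h by blast
  then show ?thesis using S by (simp add: borel_measurable_if)
qed

text \<open>Rounding t down to a multiple of 1/N takes finitely many values on a bounded interval,
  each on a measurable set, so the samples form a simple function for arbitrary
  \<open>g\<close>.\<close>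

lemma simple_function_time_steps:
  assumes "0 < N"
  shows "simple_function (time_measure T) (\<lambda>t. g (of_int \<lfloor>t * real N\<rfloor> / real N :: real))"
proof -
  have "simple_function (time_measure T) (\<lambda>t. \<lfloor>t * real N\<rfloor>)"
    unfolding simple_function_def
  proof (intro conjI ballI)
    have "(\<lambda>t. \<lfloor>t * real N\<rfloor>) ` space (time_measure T) \<subseteq> {0..\<lfloor>T * real N\<rfloor>}"
      by (auto intro!: floor_mono mult_right_mono)
    then show "finite ((\<lambda>t. \<lfloor>t * real N\<rfloor>) ` space (time_measure T))"
      by (rule finite_subset) simp
    fix k
    have "(\<lambda>t::real. \<lfloor>t * real N\<rfloor>) \<in> measurable borel (count_space UNIV)" by measurable
    then have "(\<lambda>t. \<lfloor>t * real N\<rfloor>) -` {k} \<inter> space borel \<in> sets borel"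
      by (rule measurable_sets) simp
    then have "(\<lambda>t. \<lfloor>t * real N\<rfloor>) -` {k} \<in> sets lebesgue" by (simp add: sets_completionI_sets)
    then show "(\<lambda>t. \<lfloor>t * real N\<rfloor>) -` {k} \<inter> space (time_measure T) \<in> sets (time_measure T)"
      by (auto simp: sets_restrict_space)
  qed
  from simple_function_compose1[OF this, of "\<lambda>k. g (of_int k / real N)"] show ?thesis .
qed

text \<open>By uniform continuity a fine grid suffices; rounding down moves t by less than 1/N and
  does not leave the interval.\<close>

lemma continuous_time_step_approximation:
  fixes y :: "real \<Rightarrow> 'b::metric_space"
  assumes "continuous_on {0..T} y" "e > 0"
  shows "\<exists>N>0. \<forall>t\<in>{0<..<T}. of_int \<lfloor>t * real N\<rfloor> / real N \<in> {0..T} \<and> dist (y (of_int \<lfloor>t * real N\<rfloor> / real N)) (y t) < e"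
proof -
  have "uniformly_continuous_on {0..T} y" using assms(1) by (simp add: compact_uniformly_continuous)
  then obtain d where d: "d > 0" "\<And>s t. s \<in> {0..T} \<Longrightarrow> t \<in> {0..T} \<Longrightarrow> dist s t < d \<Longrightarrow> dist (y s) (y t) < e"
    using assms(2) unfolding uniformly_continuous_on_def by metis
  obtain N where N: "inverse (real (Suc N)) < d" using reals_Archimedean[OF d(1)] by auto
  let ?N = "Suc N"
  have "of_int \<lfloor>t * real ?N\<rfloor> / real ?N \<in> {0..T} \<and> dist (y (of_int \<lfloor>t * real ?N\<rfloor> / real ?N)) (y t) < e" if t: "t \<in> {0<..<T}" for t
  proof -
    define s where "s = of_int \<lfloor>t * real ?N\<rfloor> / real ?N"
    have fl: "of_int \<lfloor>t * real ?N\<rfloor> \<le> t * real ?N" "t * real ?N < of_int \<lfloor>t * real ?N\<rfloor> + 1" by linarith+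
    have "(0::int) \<le> \<lfloor>t * real ?N\<rfloor>" using t by simp
    then have "0 \<le> s" unfolding s_def by (intro divide_nonneg_nonneg) auto
    moreover have "s \<le> t" unfolding s_def using fl(1) by (simp add: divide_le_eq)
    moreover have "t - s < d"
    proof -
      have "t < s + inverse (real ?N)" unfolding s_def using fl(2) by (simp add: field_simps)
      then show ?thesis using N by linarith
    qed
    ultimately show ?thesis unfolding s_def[symmetric] using t by (auto intro!: d(2) simp: dist_real_def)
  qed
  then show ?thesis by (intro exI[of _ ?N]) auto
qed

context seminorm_on
begin

text \<open>Step functions along the approximating sequence witness strong measurability.\<close>

lemma bochner_L2_of_continuous_limit:
  fixes y :: "nat \<Rightarrow> real \<Rightarrow> 'b::real_normed_vector" and y' :: "real \<Rightarrow> 'b"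
  assumes cont: "\<And>n. continuous_on {0..T} (y n)" and yY: "\<And>n t. t \<in> {0..T} \<Longrightarrow> y n t \<in> Y"
    and \<Theta>: "\<And>a. a \<in> Y \<Longrightarrow> \<Theta> a \<in> X" "\<And>a. a \<in> Y \<Longrightarrow> p (\<Theta> a) \<le> C * norm a"
      "\<And>a b. a \<in> Y \<Longrightarrow> b \<in> Y \<Longrightarrow> p (\<Theta> a - \<Theta> b) \<le> C * norm (a - b)" and C: "0 \<le> C"
    and F: "AE t in time_measure T. y' t \<in> Y \<and> F t \<in> X \<and> p (F t - \<Theta> (y' t)) = 0"
    and lim: "AE t in time_measure T. (\<lambda>n. y n t) \<longlonglongrightarrow> y' t"
    and L2lim: "(\<lambda>n. \<integral>\<^sup>+t. ennreal ((norm (y n t - y' t))\<^sup>2) \<partial>time_measure T) \<longlonglongrightarrow> 0" and T: "0 < T"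
  shows "F \<in> bochner_L2 (time_measure T) X p"
    and "\<exists>s. (\<forall>i::nat. simple_function (time_measure T) (s i) \<and> s i ` space (time_measure T) \<subseteq> X) \<and>
      (\<lambda>i. \<integral>\<^sup>+t. ennreal (p (F t - s i t)) \<partial>time_measure T) \<longlonglongrightarrow> 0"
proof -
  let ?M = "time_measure T"
  have S: "{0<..<T} \<in> sets lebesgue" by simp
  have "\<exists>N>0. \<forall>t\<in>{0<..<T}. of_int \<lfloor>t * real N\<rfloor> / real N \<in> {0..T} \<and>
      dist (y i (of_int \<lfloor>t * real N\<rfloor> / real N)) (y i t) < inverse (real (Suc i))" for i
    by (rule continuous_time_step_approximation[OF cont]) simp
  then obtain N where N: "\<And>i. 0 < N i" "\<And>i t. t \<in> {0<..<T} \<Longrightarrow> of_int \<lfloor>t * real (N i)\<rfloor> / real (N i) \<in> {0..T}"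
     "\<And>i t. t \<in> {0<..<T} \<Longrightarrow> dist (y i (of_int \<lfloor>t * real (N i)\<rfloor> / real (N i))) (y i t) < inverse (real (Suc i))"
    by metis
  define s where "s = (\<lambda>i t. \<Theta> (y i (of_int \<lfloor>t * real (N i)\<rfloor> / real (N i))))"
  have simple: "simple_function ?M (s i)" for i
    unfolding s_def by (rule simple_function_time_steps[OF N(1), where g="\<lambda>r. \<Theta> (y i r)"])
  have sX: "s i t \<in> X" if "t \<in> {0<..<T}" for i t
    unfolding s_def by (intro \<Theta> yY N that)
  have AE_space: "AE t in ?M. t \<in> {0<..<T}" by (rule AE_I2) simp
  have cont_meas: "g \<in> borel_measurable ?M" if "continuous_on {0..T} g" for g :: "real \<Rightarrow> real"
    by (rule continuous_imp_measurable_on_sets_lebesgue[OF continuous_on_subset[OF that]]) auto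
  have d_meas: "(\<lambda>t. norm (y i t - y' t)) \<in> borel_measurable ?M" for i
  proof (rule borel_measurable_lebesgue_on_AE_limit[OF S])
    show "(\<lambda>t. norm (y i t - y n t)) \<in> borel_measurable ?M" for n
      by (intro cont_meas continuous_intros cont)
    show "AE t in ?M. (\<lambda>n. norm (y i t - y n t)) \<longlonglongrightarrow> norm (y i t - y' t)"
      using lim by eventually_elim (intro tendsto_intros)
  qed
  have y'_meas: "(\<lambda>t. norm (y' t)) \<in> borel_measurable ?M"
  proof (rule borel_measurable_lebesgue_on_AE_limit[OF S])
    show "(\<lambda>t. norm (y n t)) \<in> borel_measurable ?M" for n
      by (intro cont_meas continuous_intros cont)
    show "AE t in ?M. (\<lambda>n. norm (y n t)) \<longlonglongrightarrow> norm (y' t)"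
      using lim by eventually_elim (intro tendsto_intros)
  qed
  \<comment> \<open>Three errors add up: \<open>F\<close> differs from
    \<open>\<Theta> (y' t)\<close> by seminorm zero, \<open>y'\<close> differs from
    \<open>y i\<close>, and \<open>y i\<close> differs from its sampled values by less than
    1/(i+1).\<close>
  have bound: "AE t in ?M. \<forall>i. p (F t - s i t) \<le> C * norm (y i t - y' t) + C * inverse (real (Suc i))"
    using F AE_space
  proof eventually_elim
    case (elim t)
    show ?case
    proof
      fix i
      have y: "y' t \<in> Y" "y i t \<in> Y" "y i (of_int \<lfloor>t * real (N i)\<rfloor> / real (N i)) \<in> Y"
        using elim N(2)[of t i] yY by auto
      have "p (F t - s i t) \<le> p (F t - \<Theta> (y' t)) + p (\<Theta> (y' t) - s i t)"
        using elim y \<Theta> sX by (intro triangle_diff) auto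
      also have "p (\<Theta> (y' t) - s i t) \<le> p (\<Theta> (y' t) - \<Theta> (y i t)) + p (\<Theta> (y i t) - s i t)"
        using elim y \<Theta> sX by (intro triangle_diff) auto
      finally have "p (F t - s i t) \<le> p (\<Theta> (y' t) - \<Theta> (y i t)) + p (\<Theta> (y i t) - s i t)"
        using elim by simp
      moreover have "p (\<Theta> (y' t) - \<Theta> (y i t)) \<le> C * norm (y i t - y' t)"
        using \<Theta>(3)[OF y(1,2)] by (simp add: norm_minus_commute)
      moreover have "p (\<Theta> (y i t) - s i t) \<le> C * inverse (real (Suc i))"
        using \<Theta>(3)[OF y(2,3)] mult_left_mono[OF less_imp_le[OF N(3)[OF elim(2), of i]] C]
        by (simp add: s_def dist_norm norm_minus_commute)
      ultimately show "p (F t - s i t) \<le> C * norm (y i t - y' t) + C * inverse (real (Suc i))" by linarith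
    qed
  qed
  have conv: "AE t in ?M. F t \<in> X \<and> (\<lambda>i. p (F t - s i t)) \<longlonglongrightarrow> 0"
    using bound lim F AE_space
  proof eventually_elim
    case (elim t)
    have "(\<lambda>i. C * norm (y i t - y' t) + C * inverse (real (Suc i))) \<longlonglongrightarrow> C * norm (y' t - y' t) + C * 0"
      by (intro tendsto_intros elim LIMSEQ_inverse_real_of_nat)
    then have lim0: "(\<lambda>i. C * norm (y i t - y' t) + C * inverse (real (Suc i))) \<longlonglongrightarrow> 0" by simp
    have "0 \<le> p (F t - s i t)" for i using elim sX by (intro nonneg diff) auto
    with elim(1) have "(\<lambda>i. p (F t - s i t)) \<longlonglongrightarrow> 0"
      by (intro tendsto_sandwich[OF _ _ tendsto_const lim0]) (auto intro: always_eventually)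
    then show ?case using elim by simp
  qed
  have strong: "strongly_measurable ?M X p F"
    unfolding strongly_measurable_def using simple sX conv by (intro exI[of _ s]) auto
  have L2_fin: "(\<integral>\<^sup>+t. ennreal ((norm (y' t))\<^sup>2) \<partial>?M) < \<infinity>"
  proof -
    have "\<forall>\<^sub>F n in sequentially. (\<integral>\<^sup>+t. ennreal ((norm (y n t - y' t))\<^sup>2) \<partial>?M) < 1"
      by (rule order_tendstoD(2)[OF L2lim]) simp
    then obtain n where n: "(\<integral>\<^sup>+t. ennreal ((norm (y n t - y' t))\<^sup>2) \<partial>?M) < 1"
      by (auto simp: eventually_sequentially)
    obtain B where B: "\<And>t. t \<in> {0..T} \<Longrightarrow> norm (y n t) \<le> B"
      using compact_imp_bounded[OF compact_continuous_image[OF cont[of n] compact_Icc]]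
      unfolding bounded_iff by (metis imageI)
    have "(\<integral>\<^sup>+t. ennreal ((norm (y' t))\<^sup>2) \<partial>?M) \<le> (\<integral>\<^sup>+t. 2 * ennreal ((norm (y n t - y' t))\<^sup>2) + ennreal (2 * B\<^sup>2) \<partial>?M)"
    proof (rule nn_integral_mono_AE, use AE_space in eventually_elim)
      fix t assume t: "t \<in> {0<..<T}"
      have "norm (y' t) \<le> norm (y n t - y' t) + B"
        using norm_triangle_ineq4[of "y n t" "y n t - y' t"] B[of t] t by simp
      then have "(norm (y' t))\<^sup>2 \<le> (norm (y n t - y' t) + B)\<^sup>2" by (intro power_mono) auto
      also have "\<dots> \<le> 2 * (norm (y n t - y' t))\<^sup>2 + 2 * B\<^sup>2"
        using sum_squares_bound[of "norm (y n t - y' t)" B] by (simp add: power2_sum)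
      finally have "ennreal ((norm (y' t))\<^sup>2) \<le> ennreal (2 * (norm (y n t - y' t))\<^sup>2 + 2 * B\<^sup>2)" by (rule ennreal_leI)
      also have "\<dots> = 2 * ennreal ((norm (y n t - y' t))\<^sup>2) + ennreal (2 * B\<^sup>2)"
        by (subst ennreal_plus) (simp_all add: ennreal_mult)
      finally show "ennreal ((norm (y' t))\<^sup>2) \<le> 2 * ennreal ((norm (y n t - y' t))\<^sup>2) + ennreal (2 * B\<^sup>2)" .
    qed
    also have "\<dots> = 2 * (\<integral>\<^sup>+t. ennreal ((norm (y n t - y' t))\<^sup>2) \<partial>?M) + ennreal (2 * B\<^sup>2) * ennreal T"
      using d_meas[of n] T by (subst nn_integral_add) (auto simp: nn_integral_cmult emeasure_restrict_space)
    also have "\<dots> < \<infinity>" using n by (auto simp: ennreal_mult_less_top less_top[symmetric] ennreal_mult_eq_top_iff dest: less_trans)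
    finally show ?thesis .
  qed
  have p_meas: "(\<lambda>t. p (F t)) \<in> borel_measurable ?M"
  proof (rule borel_measurable_lebesgue_on_AE_limit[OF S])
    show "(\<lambda>t. p (s i t)) \<in> borel_measurable ?M" for i
      by (rule borel_measurable_simple_function) (rule simple_function_compose1[OF simple])
    show "AE t in ?M. (\<lambda>i. p (s i t)) \<longlonglongrightarrow> p (F t)"
      using conv AE_space
    proof eventually_elim
      case (elim t)
      have "\<bar>p (s i t) - p (F t)\<bar> \<le> p (F t - s i t)" for i
        using triangle_abs[of "F t" "s i t"] elim sX[of t i] by (simp add: abs_minus_commute)
      then show ?case by (rule tendsto_abs_bound) (use elim in simp)
    qed
  qed
  have "integrable ?M (\<lambda>t. (p (F t))\<^sup>2)"
  proof (rule integrableI_bounded)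
    have "(\<integral>\<^sup>+t. ennreal (norm ((p (F t))\<^sup>2)) \<partial>?M) \<le> (\<integral>\<^sup>+t. ennreal (C\<^sup>2) * ennreal ((norm (y' t))\<^sup>2) \<partial>?M)"
    proof (rule nn_integral_mono_AE, use F in eventually_elim)
      case (elim t)
      have "p (F t) \<le> C * norm (y' t)"
        using triangle_abs[of "F t" "\<Theta> (y' t)"] \<Theta>(1,2)[of "y' t"] elim by auto
      then have "(p (F t))\<^sup>2 \<le> (C * norm (y' t))\<^sup>2" using nonneg elim by (intro power_mono) auto
      then show ?case by (simp add: ennreal_mult[symmetric] power_mult_distrib ennreal_leI)
    qed
    also have "\<dots> = ennreal (C\<^sup>2) * (\<integral>\<^sup>+t. ennreal ((norm (y' t))\<^sup>2) \<partial>?M)"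
      by (intro nn_integral_cmult measurable_compose[OF _ measurable_ennreal] borel_measurable_power y'_meas)
    also have "\<dots> < \<infinity>" using L2_fin by (simp add: ennreal_mult_less_top)
    finally show "(\<integral>\<^sup>+t. ennreal (norm ((p (F t))\<^sup>2)) \<partial>?M) < \<infinity>" .
  qed (use p_meas in measurable)
  with strong show "F \<in> bochner_L2 ?M X p" by (simp add: bochner_L2_def)
  have "(\<lambda>i. \<integral>\<^sup>+t. ennreal (p (F t - s i t)) \<partial>?M) \<longlonglongrightarrow> 0"
  proof (rule order_tendstoI)
    fix a :: ennreal assume "0 < a"
    then obtain e where e: "e > 0" "ennreal e \<le> a"
    proof (cases a)
      case (real r) then show ?thesis using \<open>0 < a\<close> by (intro that[of r]) auto
    qed (auto intro: that[of 1])
    \<comment> \<open>Chosen so that the final bound \<eta> C (1 + 2 T) is at most e/2; the added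
      units keep the denominator positive.\<close>
    define \<eta> where "\<eta> = e / (4 * (C + 1) * (T + 1))"
    have \<eta>: "\<eta> > 0" using e C T by (simp add: \<eta>_def)
    have "\<forall>\<^sub>F i in sequentially. (\<integral>\<^sup>+t. ennreal ((norm (y i t - y' t))\<^sup>2) \<partial>?M) < ennreal (\<eta>\<^sup>2)"
      by (rule order_tendstoD(2)[OF L2lim]) (use \<eta> in simp)
    moreover have "\<forall>\<^sub>F i in sequentially. inverse (real (Suc i)) < \<eta>"
      by (rule order_tendstoD(2)[OF LIMSEQ_inverse_real_of_nat \<eta>])
    ultimately show "\<forall>\<^sub>F i in sequentially. (\<integral>\<^sup>+t. ennreal (p (F t - s i t)) \<partial>?M) < a"
    proof eventually_elim
      case (elim i)
      have "(\<integral>\<^sup>+t. ennreal (p (F t - s i t)) \<partial>?M) \<le>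
          (\<integral>\<^sup>+t. ennreal (C / \<eta>) * ennreal ((norm (y i t - y' t))\<^sup>2) + ennreal (2 * C * \<eta>) \<partial>?M)"
      proof (rule nn_integral_mono_AE, use bound in eventually_elim)
        case (elim t)
        let ?n = "norm (y i t - y' t)"
        \<comment> \<open>Trades the known L2 convergence for L1 convergence, at the price of a
          small constant on a bounded interval.\<close>
        have "?n \<le> \<eta> + ?n\<^sup>2 / \<eta>"
        proof (cases "?n \<le> \<eta>")
          case False
          then have "\<eta> * ?n \<le> ?n * ?n" by (intro mult_right_mono) auto
          then have "?n \<le> ?n\<^sup>2 / \<eta>" using \<eta> by (simp add: field_simps power2_eq_square)
          then show ?thesis using \<eta> by linarith
        qed (use \<eta> in \<open>simp add: add_increasing2\<close>)
        then have "C * ?n \<le> C * (\<eta> + ?n\<^sup>2 / \<eta>)" by (rule mult_left_mono[OF _ C])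
        moreover have "C * inverse (real (Suc i)) \<le> C * \<eta>"
          using \<open>inverse (real (Suc i)) < \<eta>\<close> C by (intro mult_left_mono) auto
        ultimately have "p (F t - s i t) \<le> C / \<eta> * ?n\<^sup>2 + 2 * C * \<eta>"
          using elim[rule_format, of i] by (simp add: distrib_left)
        then have "ennreal (p (F t - s i t)) \<le> ennreal (C / \<eta> * ?n\<^sup>2 + 2 * C * \<eta>)" by (rule ennreal_leI)
        also have "\<dots> = ennreal (C / \<eta>) * ennreal (?n\<^sup>2) + ennreal (2 * C * \<eta>)"
        proof -
          have "0 \<le> C / \<eta>" "0 \<le> 2 * C * \<eta>" using C \<eta> by auto
          then show ?thesis by (simp only: ennreal_plus ennreal_mult zero_le_power2 mult_nonneg_nonneg)
        qed
        finally show ?case .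
      qed
      also have "\<dots> = ennreal (C / \<eta>) * (\<integral>\<^sup>+t. ennreal ((norm (y i t - y' t))\<^sup>2) \<partial>?M) + ennreal (2 * C * \<eta>) * ennreal T"
        using d_meas[of i] T by (subst nn_integral_add) (auto simp: nn_integral_cmult emeasure_restrict_space)
      also have "\<dots> \<le> ennreal (C / \<eta>) * ennreal (\<eta>\<^sup>2) + ennreal (2 * C * \<eta>) * ennreal T"
        using elim(1) by (intro add_right_mono mult_left_mono) auto
      also have "\<dots> = ennreal (C / \<eta> * \<eta>\<^sup>2 + 2 * C * \<eta> * T)"
        using C \<eta> T by (simp add: ennreal_mult[symmetric] ennreal_plus[symmetric] del: ennreal_plus)
      also have "C / \<eta> * \<eta>\<^sup>2 + 2 * C * \<eta> * T < e"
      proof -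
        have "C / \<eta> * \<eta>\<^sup>2 + 2 * C * \<eta> * T = \<eta> * (C * (1 + 2 * T))"
          using \<eta> by (simp add: power2_eq_square algebra_simps)
        also have "\<dots> \<le> \<eta> * ((C + 1) * (2 * (T + 1)))"
          using \<eta> C T by (intro mult_left_mono mult_mono) auto
        also have "\<dots> = e / 2"
        proof -
          have *: "e / (4 * a * b) * (a * (2 * b)) = e / 2" if "a \<noteq> 0" "b \<noteq> 0" for a b :: real
            using that by (simp add: field_simps)
          show ?thesis unfolding \<eta>_def by (rule *) (use C T in auto)
        qed
        also have "\<dots> < e" using e by simp
        finally show ?thesis .
      qed
      then have "ennreal (C / \<eta> * \<eta>\<^sup>2 + 2 * C * \<eta> * T) < ennreal e" using e by (intro ennreal_lessI)
      finally show ?case using e(2) by (rule order_less_le_trans)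
    qed
  qed simp
  then show "\<exists>s. (\<forall>i::nat. simple_function ?M (s i) \<and> s i ` space ?M \<subseteq> X) \<and>
      (\<lambda>i. \<integral>\<^sup>+t. ennreal (p (F t - s i t)) \<partial>?M) \<longlonglongrightarrow> 0"
    using simple sX by (intro exI[of _ s]) auto
qed

text \<open>By the reverse triangle inequality the function is an almost everywhere limit of
  seminorms of differences of simple functions.\<close>

lemma measurable_seminorm_diff_simple:
  assumes S: "S \<in> sets lebesgue" and F: "strongly_measurable (lebesgue_on S) X p F"
    and s: "simple_function (lebesgue_on S) s" "s ` space (lebesgue_on S) \<subseteq> X"
  shows "(\<lambda>t. p (F t - s t)) \<in> borel_measurable (lebesgue_on S)"
proof -
  obtain s' where s': "\<And>i::nat. simple_function (lebesgue_on S) (s' i)" "\<And>i. s' i ` space (lebesgue_on S) \<subseteq> X"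
    "AE t in lebesgue_on S. F t \<in> X \<and> (\<lambda>i. p (F t - s' i t)) \<longlonglongrightarrow> 0"
    using F unfolding strongly_measurable_def by blast
  have AE_space: "AE t in lebesgue_on S. t \<in> space (lebesgue_on S)" by (rule AE_I2)
  show ?thesis
  proof (rule borel_measurable_lebesgue_on_AE_limit[OF S])
    show "(\<lambda>t. p (s' i t - s t)) \<in> borel_measurable (lebesgue_on S)" for i
      by (rule borel_measurable_simple_function, rule simple_function_compose2[OF s'(1) s(1)])
    show "AE t in lebesgue_on S. (\<lambda>i. p (s' i t - s t)) \<longlonglongrightarrow> p (F t - s t)"
      using s'(3) AE_space
    proof eventually_elim
      case (elim t)
      have X: "s' i t \<in> X" "s t \<in> X" for i using s'(2) s(2) elim by auto
      have "\<bar>p (s' i t - s t) - p (F t - s t)\<bar> \<le> p (F t - s' i t)" for i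
        using triangle_abs[of "s' i t - s t" "F t - s t"] X elim diff diff_commute[of "F t" "s' i t"] by simp
      then show ?case by (rule tendsto_abs_bound) (use elim in simp)
    qed
  qed
qed

section \<open>Bochner integrals in the dual, tested against single vectors\<close>

lemma simple_bochner_integrable_eval:
  assumes "simple_function M s" "emeasure M {t \<in> space M. s t \<noteq> 0} \<noteq> \<infinity>"
  shows "Bochner_Integration.simple_bochner_integrable M (\<lambda>t. s t v :: real)"
    and "Bochner_Integration.simple_bochner_integral M s v = Bochner_Integration.simple_bochner_integral M (\<lambda>t. s t v)"
proof -
  have s: "Bochner_Integration.simple_bochner_integrable M s" using assms by (rule simple_bochner_integrable.intros)
  have "emeasure M {t \<in> space M. s t v \<noteq> 0} \<le> emeasure M {t \<in> space M. s t \<noteq> 0}"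
  proof (rule emeasure_mono)
    have "s -` (- {0}) \<inter> space M \<in> sets M" by (rule simple_functionD(2)[OF assms(1)])
    moreover have "s -` (- {0}) \<inter> space M = {t \<in> space M. s t \<noteq> 0}" by auto
    ultimately show "{t \<in> space M. s t \<noteq> 0} \<in> sets M" by simp
  qed auto
  moreover have "simple_function M (\<lambda>t. s t v)" by (rule simple_function_compose1[OF assms(1)])
  ultimately show "Bochner_Integration.simple_bochner_integrable M (\<lambda>t. s t v :: real)"
    using assms(2) by (intro simple_bochner_integrable.intros) (auto simp: top_unique)
  have "linear (\<lambda>f::_ \<Rightarrow> real. f v)" by (rule linearI) (auto simp: scaleR_fun_def)
  from simple_bochner_integral_linear[OF this s]
  show "Bochner_Integration.simple_bochner_integral M s v = Bochner_Integration.simple_bochner_integral M (\<lambda>t. s t v)" by simp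
qed

lemma simple_bochner_integral_mem:
  assumes "simple_function M s" "s ` space M \<subseteq> X"
  shows "Bochner_Integration.simple_bochner_integral M s \<in> X"
  unfolding simple_bochner_integral_def using assms
  by (intro subspace_sum[OF subspace] subspace_scale[OF subspace]) auto

lemma AE_eval_bound:
  assumes F: "AE t in M. F t \<in> dual X p" and s: "s ` space M \<subseteq> dual X p" and v: "v \<in> X"
  shows "AE t in M. \<bar>F t v - s t v\<bar> \<le> dual_norm X p (F t - s t) * p v"
proof -
  have "AE t in M. t \<in> space M" by (rule AE_I2)
  with F show ?thesis
  proof eventually_elim
    case (elim t)
    then show ?case
      using dual_bound[OF seminorm_on.diff[OF seminorm_dual, of "F t" "s t"] v] s by auto
  qed
qed

lemma strongly_measurable_eval:
  assumes S: "S \<in> sets lebesgue" and F: "strongly_measurable (lebesgue_on S) (dual X p) (dual_norm X p) F"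
    and v: "v \<in> X"
  shows "(\<lambda>t. F t v) \<in> borel_measurable (lebesgue_on S)"
proof -
  obtain s' where s': "\<And>i::nat. simple_function (lebesgue_on S) (s' i)" "\<And>i. s' i ` space (lebesgue_on S) \<subseteq> dual X p"
    "AE t in lebesgue_on S. F t \<in> dual X p \<and> (\<lambda>i. dual_norm X p (F t - s' i t)) \<longlonglongrightarrow> 0"
    using F unfolding strongly_measurable_def by blast
  have "AE t in lebesgue_on S. F t \<in> dual X p" using s'(3) by eventually_elim simp
  from AE_eval_bound[OF this s'(2) v]
  have "AE t in lebesgue_on S. \<forall>i. \<bar>F t v - s' i t v\<bar> \<le> dual_norm X p (F t - s' i t) * p v"
    by (simp add: AE_all_countable)
  with s'(3) have lim: "AE t in lebesgue_on S. (\<lambda>i. s' i t v) \<longlonglongrightarrow> F t v"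
  proof eventually_elim
    case (elim t)
    have "(\<lambda>i. dual_norm X p (F t - s' i t) * p v) \<longlonglongrightarrow> 0"
      by (rule tendsto_mult_left_zero) (use elim in simp)
    then show ?case by (rule tendsto_abs_bound[rotated]) (use elim in \<open>simp add: abs_minus_commute\<close>)
  qed
  show ?thesis
  proof (rule borel_measurable_lebesgue_on_AE_limit[OF S _ lim])
    show "(\<lambda>t. s' i t v) \<in> borel_measurable (lebesgue_on S)" for i
      by (rule borel_measurable_simple_function, rule simple_function_compose1[OF s'(1)])
  qed
qed

text \<open>Evaluation at \<open>v\<close> is bounded on the dual by \<open>p v\<close>, so the
  approximating simple functions and their integrals become scalar ones. This reduces the weak time
  derivative to identities between real integrals.\<close>

lemma has_bochner_integral_in_eval:
  assumes S: "S \<in> sets lebesgue" and F: "has_bochner_integral_in (lebesgue_on S) (dual X p) (dual_norm X p) F I"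
    and v: "v \<in> X"
  shows "has_bochner_integral (lebesgue_on S) (\<lambda>t. F t v) (I v)"
proof -
  interpret D: seminorm_on "dual X p" "dual_norm X p" by (rule seminorm_dual)
  let ?M = "lebesgue_on S"
  obtain s where s: "\<And>i::nat. simple_function ?M (s i)" "\<And>i. s i ` space ?M \<subseteq> dual X p"
      "\<And>i. emeasure ?M {t \<in> space ?M. s i t \<noteq> 0} \<noteq> \<infinity>"
    and lim: "(\<lambda>i. \<integral>\<^sup>+t. ennreal (dual_norm X p (F t - s i t)) \<partial>?M) \<longlonglongrightarrow> 0"
    and limI: "(\<lambda>i. dual_norm X p (Bochner_Integration.simple_bochner_integral ?M (s i) - I)) \<longlonglongrightarrow> 0"
    and strong: "strongly_measurable ?M (dual X p) (dual_norm X p) F" and I: "I \<in> dual X p"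
    using F unfolding has_bochner_integral_in_def by blast
  have AEF: "AE t in ?M. F t \<in> dual X p" using strong unfolding strongly_measurable_def by auto
  show ?thesis
  proof (rule has_bochner_integral.intros)
    show "(\<lambda>t. F t v) \<in> borel_measurable ?M" by (rule strongly_measurable_eval[OF S strong v])
    show "Bochner_Integration.simple_bochner_integrable ?M (\<lambda>t. s i t v)" for i by (rule simple_bochner_integrable_eval(1)[OF s(1,3)])
    have le: "(\<integral>\<^sup>+t. ennreal (norm (F t v - s i t v)) \<partial>?M) \<le> ennreal (p v) * (\<integral>\<^sup>+t. ennreal (dual_norm X p (F t - s i t)) \<partial>?M)" for i
    proof -
      have "(\<integral>\<^sup>+t. ennreal (norm (F t v - s i t v)) \<partial>?M) \<le> (\<integral>\<^sup>+t. ennreal (p v) * ennreal (dual_norm X p (F t - s i t)) \<partial>?M)"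
        using AE_eval_bound[OF AEF s(2)[of i] v] nonneg[OF v]
        by (intro nn_integral_mono_AE) (auto elim!: eventually_mono simp: ennreal_mult'[symmetric] mult.commute intro!: ennreal_leI)
      also have "\<dots> = ennreal (p v) * (\<integral>\<^sup>+t. ennreal (dual_norm X p (F t - s i t)) \<partial>?M)"
        using D.measurable_seminorm_diff_simple[OF S strong s(1,2)] by (intro nn_integral_cmult) auto
      finally show ?thesis .
    qed
    have "(\<lambda>i. ennreal (p v) * (\<integral>\<^sup>+t. ennreal (dual_norm X p (F t - s i t)) \<partial>?M)) \<longlonglongrightarrow> ennreal (p v) * 0"
      by (intro ennreal_tendsto_cmult lim) simp
    then have *: "(\<lambda>i. ennreal (p v) * (\<integral>\<^sup>+t. ennreal (dual_norm X p (F t - s i t)) \<partial>?M)) \<longlonglongrightarrow> 0" by simp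
    show "(\<lambda>i. \<integral>\<^sup>+t. ennreal (norm (F t v - s i t v)) \<partial>?M) \<longlonglongrightarrow> 0"
      by (rule tendsto_sandwich[OF _ _ tendsto_const *]) (use le in simp_all)
    show "(\<lambda>i. Bochner_Integration.simple_bochner_integral ?M (\<lambda>t. s i t v)) \<longlonglongrightarrow> I v"
    proof -
      have "\<bar>Bochner_Integration.simple_bochner_integral ?M (s i) v - I v\<bar> \<le>
          dual_norm X p (Bochner_Integration.simple_bochner_integral ?M (s i) - I) * p v" for i
        using dual_bound[OF D.diff[OF D.simple_bochner_integral_mem[OF s(1,2)] I] v, of i] by simp
      from tendsto_abs_bound[OF this tendsto_mult_left_zero[OF limI]]
      show ?thesis by (simp add: simple_bochner_integrable_eval(2)[OF s(1,3)])
    qed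
  qed
qed

text \<open>\<open>I\<close> is prescribed only by scalar integrals. It lies in the dual because
  these are linear in the test vector and bounded by the integral of the dual norms. Testing the
  difference between \<open>I\<close> and a simple integral with \<open>v\<close> costs at most the
  L1 error times \<open>p v\<close>, which is convergence in the dual norm.\<close>

lemma has_bochner_integral_in_dualI:
  fixes T :: real
  defines "M \<equiv> time_measure T"
  assumes F: "F \<in> bochner_L2 M (dual X p) (dual_norm X p)"
    and s: "\<exists>s. (\<forall>i::nat. simple_function M (s i) \<and> s i ` space M \<subseteq> dual X p) \<and>
      (\<lambda>i. \<integral>\<^sup>+t. ennreal (dual_norm X p (F t - s i t)) \<partial>M) \<longlonglongrightarrow> 0"
    and I: "\<And>v. v \<in> X \<Longrightarrow> I v = (\<integral>t. F t v \<partial>M)"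
  shows "has_bochner_integral_in M (dual X p) (dual_norm X p) F I"
proof -
  interpret D: seminorm_on "dual X p" "dual_norm X p" by (rule seminorm_dual)
  have S: "{0<..<T} \<in> sets lebesgue" by simp
  interpret M: finite_measure M
    unfolding M_def by (rule finite_measure_lebesgue_on) (simp add: lmeasurable_interval)
  obtain s where s: "\<And>i::nat. simple_function M (s i)" "\<And>i. s i ` space M \<subseteq> dual X p"
    and lim: "(\<lambda>i. \<integral>\<^sup>+t. ennreal (dual_norm X p (F t - s i t)) \<partial>M) \<longlonglongrightarrow> 0" using s by blast
  have strong: "strongly_measurable M (dual X p) (dual_norm X p) F" and sq: "integrable M (\<lambda>t. (dual_norm X p (F t))\<^sup>2)"
    using F by (auto simp: bochner_L2_def)
  have AEF: "AE t in M. F t \<in> dual X p" using strong unfolding strongly_measurable_def by auto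
  have eval_meas: "(\<lambda>t. F t v) \<in> borel_measurable M" if "v \<in> X" for v
    using strongly_measurable_eval[OF S, of F v] strong that by (simp add: M_def)
  have norm_meas: "(\<lambda>t. dual_norm X p (F t - s i t)) \<in> borel_measurable M" for i
    using D.measurable_seminorm_diff_simple[OF S, of F "s i"] strong s by (simp add: M_def)
  have "(\<lambda>t. dual_norm X p (F t - 0)) \<in> borel_measurable M"
    using D.measurable_seminorm_diff_simple[OF S, of F "\<lambda>t. 0"] strong D.zero by (auto simp: M_def image_subset_iff)
  then have norm_meas0: "(\<lambda>t. dual_norm X p (F t)) \<in> borel_measurable M" by simp
  \<comment> \<open>Square integrability suffices because the time interval has finite
    measure.\<close>
  have int_norm: "integrable M (\<lambda>t. dual_norm X p (F t))"
  proof (rule Bochner_Integration.integrable_bound[OF _ norm_meas0])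
    show "integrable M (\<lambda>t. 1 + (dual_norm X p (F t))\<^sup>2)" by (intro Bochner_Integration.integrable_add sq) simp
    have "\<bar>a\<bar> \<le> \<bar>1 + a\<^sup>2\<bar>" for a :: real
    proof -
      have "0 \<le> (\<bar>a\<bar> - 1)\<^sup>2" "0 \<le> \<bar>a\<bar>" by simp_all
      then show ?thesis by (simp add: power2_diff)
    qed
    then show "AE t in M. norm (dual_norm X p (F t)) \<le> norm (1 + (dual_norm X p (F t))\<^sup>2)" by simp
  qed
  have eval_int: "integrable M (\<lambda>t. F t v)" if v: "v \<in> X" for v
  proof (rule Bochner_Integration.integrable_bound[OF integrable_mult_left[OF int_norm, of "p v"] eval_meas[OF v]])
    show "AE t in M. norm (F t v) \<le> norm (dual_norm X p (F t) * p v)"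
      using AEF by eventually_elim (use dual_bound[OF _ v] in force)
  qed
  have ID: "I \<in> dual X p"
    unfolding dual_def
  proof (intro CollectI conjI ballI allI exI)
    fix u v assume uv: "u \<in> X" "v \<in> X"
    have "(\<integral>t. F t (u + v) \<partial>M) = (\<integral>t. F t u + F t v \<partial>M)"
    proof (rule integral_cong_AE)
      show "AE t in M. F t (u + v) = F t u + F t v"
        using AEF by eventually_elim (use uv in \<open>auto simp: dual_def\<close>)
    qed (use eval_meas uv subspace_add[OF subspace] in auto)
    also have "\<dots> = (\<integral>t. F t u \<partial>M) + (\<integral>t. F t v \<partial>M)" by (intro Bochner_Integration.integral_add eval_int uv)
    finally show "I (u + v) = I u + I v" using uv subspace_add[OF subspace uv] by (simp add: I)
  next
    fix r u assume u: "u \<in> X"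
    have "(\<integral>t. F t (r *\<^sub>R u) \<partial>M) = (\<integral>t. r * F t u \<partial>M)"
    proof (rule integral_cong_AE)
      show "AE t in M. F t (r *\<^sub>R u) = r * F t u"
        using AEF by eventually_elim (use u in \<open>auto simp: dual_def\<close>)
    qed (use eval_meas u subspace_scale[OF subspace] in auto)
    then show "I (r *\<^sub>R u) = r * I u" using u subspace_scale[OF subspace u] by (simp add: I)
  next
    fix v assume v: "v \<in> X"
    have "\<bar>I v\<bar> \<le> (\<integral>t. \<bar>F t v\<bar> \<partial>M)" unfolding I[OF v] by (rule integral_abs_bound)
    also have "\<dots> \<le> (\<integral>t. dual_norm X p (F t) * p v \<partial>M)"
      using AEF by (intro integral_mono_AE integrable_mult_left int_norm integrable_abs eval_int v)
        (auto elim!: eventually_mono intro: dual_bound[OF _ v])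
    finally show "\<bar>I v\<bar> \<le> (\<integral>t. dual_norm X p (F t) \<partial>M) * p v" by simp
  qed
  have fin: "emeasure M {t \<in> space M. s i t \<noteq> 0} \<noteq> \<infinity>" for i by (simp add: M.emeasure_finite)
  have "(\<lambda>i. dual_norm X p (Bochner_Integration.simple_bochner_integral M (s i) - I)) \<longlonglongrightarrow> 0"
  proof (rule tendsto_sandwich[OF _ _ tendsto_const])
    show "\<forall>\<^sub>F i in sequentially. 0 \<le> dual_norm X p (Bochner_Integration.simple_bochner_integral M (s i) - I)"
      by (intro always_eventually allI D.nonneg D.diff ID D.simple_bochner_integral_mem s)
    show "(\<lambda>i. enn2real (\<integral>\<^sup>+t. ennreal (dual_norm X p (F t - s i t)) \<partial>M)) \<longlonglongrightarrow> 0"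
      using tendsto_enn2real[OF lim[folded ennreal_0]] by simp
    have "\<forall>\<^sub>F i in sequentially. (\<integral>\<^sup>+t. ennreal (dual_norm X p (F t - s i t)) \<partial>M) < \<infinity>"
      by (rule order_tendstoD(2)[OF lim]) simp
    then show "\<forall>\<^sub>F i in sequentially. dual_norm X p (Bochner_Integration.simple_bochner_integral M (s i) - I) \<le>
        enn2real (\<integral>\<^sup>+t. ennreal (dual_norm X p (F t - s i t)) \<partial>M)"
    proof eventually_elim
      case (elim i)
      have AEd: "AE t in M. 0 \<le> dual_norm X p (F t - s i t)"
      proof -
        have "AE t in M. t \<in> space M" by (rule AE_I2)
        with AEF show ?thesis by eventually_elim (use s(2)[of i] in \<open>auto intro!: D.nonneg D.diff\<close>)
      qed
      have "(\<integral>\<^sup>+t. ennreal (norm (dual_norm X p (F t - s i t))) \<partial>M) = (\<integral>\<^sup>+t. ennreal (dual_norm X p (F t - s i t)) \<partial>M)"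
        by (rule nn_integral_cong_AE) (use AEd in eventually_elim, simp)
      with elim have int: "integrable M (\<lambda>t. dual_norm X p (F t - s i t))"
        by (intro integrableI_bounded norm_meas) simp
      have eq: "enn2real (\<integral>\<^sup>+t. ennreal (dual_norm X p (F t - s i t)) \<partial>M) = (\<integral>t. dual_norm X p (F t - s i t) \<partial>M)"
        using integral_nonneg_AE[OF AEd] by (simp add: nn_integral_eq_integral[OF int AEd])
      show ?case unfolding eq
      proof (rule dual_norm_le)
        show "0 \<le> (\<integral>t. dual_norm X p (F t - s i t) \<partial>M)" using integral_nonneg_AE[OF AEd] .
        fix v assume v: "v \<in> X"
        note sb = simple_bochner_integrable_eval[OF s(1) fin, of i v]
        have si: "has_bochner_integral M (\<lambda>t. s i t v) (Bochner_Integration.simple_bochner_integral M (\<lambda>t. s i t v))"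
          by (rule has_bochner_integral_simple_bochner_integrable[OF sb(1)])
        have "(Bochner_Integration.simple_bochner_integral M (s i) - I) v = (\<integral>t. s i t v - F t v \<partial>M)"
          using has_bochner_integral_integral_eq[OF si] integrable.intros[OF si]
          by (simp add: sb(2) I[OF v] eval_int[OF v])
        then have "\<bar>(Bochner_Integration.simple_bochner_integral M (s i) - I) v\<bar> \<le> (\<integral>t. \<bar>s i t v - F t v\<bar> \<partial>M)"
          by (simp add: integral_abs_bound)
        also have "\<dots> \<le> (\<integral>t. dual_norm X p (F t - s i t) * p v \<partial>M)"
          using AE_eval_bound[OF AEF s(2)[of i] v]
          by (intro integral_mono_AE integrable_mult_left int integrable_abs Bochner_Integration.integrable_diff eval_int v integrable.intros[OF si])
            (auto elim!: eventually_mono simp: abs_minus_commute)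
        finally show "\<bar>(Bochner_Integration.simple_bochner_integral M (s i) - I) v\<bar> \<le> (\<integral>t. dual_norm X p (F t - s i t) \<partial>M) * p v"
          by simp
      qed
    qed
  qed
  then show ?thesis
    unfolding has_bochner_integral_in_def using strong ID s fin lim by blast
qed

end

subsection \<open>Functions of time\<close>

lemma continuous_integrable_time:
  fixes g :: "real \<Rightarrow> real"
  assumes "continuous_on {0..T} g"
  shows "integrable (time_measure T) g" and "(\<integral>t. g t \<partial>time_measure T) = integral {0..T} g"
proof -
  have "set_integrable lebesgue {0..T} g"
    using continuous_imp_integrable_real[OF assms]
    by (simp add: set_integrable_def integrable_restrict_space)
  then have "set_integrable lebesgue {0<..<T} g"
    by (rule set_integrable_subset) auto
  then show int: "integrable (time_measure T) g"
    by (simp add: set_integrable_def integrable_restrict_space)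
  have "(\<integral>t. g t \<partial>time_measure T) = integral {0<..<T} g"
    by (rule lebesgue_integral_eq_integral[OF int]) simp
  also have "\<dots> = integral {0..T} g"
    using integral_open_interval[of 0 T g] by simp
  finally show "(\<integral>t. g t \<partial>time_measure T) = integral {0..T} g" .
qed

lemma continuous_measurable_time:
  "continuous_on {0..T} g \<Longrightarrow> g \<in> borel_measurable (time_measure T)" for g :: "real \<Rightarrow> real"
  using continuous_integrable_time(1) by blast

lemma continuous_nn_integral_time:
  fixes g :: "real \<Rightarrow> real"
  assumes "continuous_on {0..T} g" "\<And>t. 0 \<le> g t"
  shows "(\<integral>\<^sup>+t. ennreal (g t) \<partial>time_measure T) = ennreal (integral {0..T} g)"
  using nn_integral_eq_integral[OF continuous_integrable_time(1)[OF assms(1)]] assms(2)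
    continuous_integrable_time(2)[OF assms(1)] by simp

text \<open>The exceptional set in the open interval is both open and null, hence empty; the
  endpoints follow by taking the closure.\<close>

lemma AE_closed_imp_everywhere:
  fixes h :: "real \<Rightarrow> 'a::topological_space"
  assumes "continuous_on {0..T} h" "closed S" "AE t in time_measure T. h t \<in> S" "0 < T" "t \<in> {0..T}"
  shows "h t \<in> S"
proof -
  let ?C = "{0..T} \<inter> h -` S"
  have closed: "closed ?C" using assms(1,2) by (intro continuous_closed_preimage) auto
  have open_diff: "open ({0<..<T} - ?C)" using closed by (intro open_Diff) auto
  have "AE t in lebesgue. t \<in> {0<..<T} \<longrightarrow> h t \<in> S" using assms(3) by (simp add: AE_restrict_space_iff)
  then have "AE t in lebesgue. t \<notin> {0<..<T} - ?C" by eventually_elim auto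
  then have "{0<..<T} - ?C \<in> null_sets lebesgue"
    using open_diff AE_iff_null_sets[of "{0<..<T} - ?C" lebesgue] by auto
  then have "negligible ({0<..<T} - ?C)" by (simp add: negligible_iff_null_sets)
  then have "{0<..<T} - ?C = {}" using open_diff open_not_negligible by blast
  then have "{0<..<T} \<subseteq> ?C" by blast
  then have "closure {0<..<T} \<subseteq> ?C" using closed by (rule closure_minimal)
  then show ?thesis using assms(4,5) by (auto simp: closure_greaterThanLessThan)
qed

lemma test_function_deriv:
  fixes \<phi> :: "real \<Rightarrow> real"
  assumes "\<phi> \<in> test_functions U"
  shows "(\<phi> has_real_derivative deriv \<phi> t) (at t)" and "deriv \<phi> \<in> test_functions U"
proof -
  have "(\<phi> has_derivative (\<lambda>h. frechet_derivative \<phi> (at t) 1 * h)) (at t)" for t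
  proof -
    have "frechet_derivative \<phi> (at t) = (\<lambda>h. frechet_derivative \<phi> (at t) 1 * h)"
    proof
      fix h :: real
      have "frechet_derivative \<phi> (at t) (h *\<^sub>R 1) = h *\<^sub>R frechet_derivative \<phi> (at t) 1"
        by (rule linear_scale[OF has_derivative_linear[OF test_function_has_derivative[OF assms]]])
      then show "frechet_derivative \<phi> (at t) h = frechet_derivative \<phi> (at t) 1 * h" by simp
    qed
    then show ?thesis using test_function_has_derivative[OF assms, of t] by simp
  qed
  then have d: "(\<phi> has_real_derivative frechet_derivative \<phi> (at t) 1) (at t)" for t
    by (simp add: has_field_derivative_def)
  then have eq: "deriv \<phi> = (\<lambda>t. frechet_derivative \<phi> (at t) 1)" using DERIV_imp_deriv by blast
  show "(\<phi> has_real_derivative deriv \<phi> t) (at t)" using d by (simp add: eq)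
  show "deriv \<phi> \<in> test_functions U" unfolding eq using test_functions_derivative[OF assms, of 1] by simp
qed

text \<open>The support of \<open>\<phi>\<close> lies in the open interval, so the boundary terms
  vanish whatever values \<open>g\<close> takes at the ends.\<close>

lemma integration_by_parts_time:
  fixes g g' :: "real \<Rightarrow> real"
  assumes \<phi>: "\<phi> \<in> test_functions {0<..<T}" and T: "0 < T"
    and g: "\<And>t. t \<in> {0..T} \<Longrightarrow> (g has_real_derivative g' t) (at t within {0..T})" and g': "continuous_on {0..T} g'"
  shows "(\<integral>t. deriv \<phi> t * g t \<partial>time_measure T) = - (\<integral>t. \<phi> t * g' t \<partial>time_measure T)"
proof -
  have contg: "continuous_on {0..T} g"
    using g DERIV_continuous continuous_on_eq_continuous_within by blast
  have cont: "continuous_on {0..T} (\<lambda>t. deriv \<phi> t * g t)" "continuous_on {0..T} (\<lambda>t. \<phi> t * g' t)"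
    by (intro continuous_intros contg g' test_function_continuous[OF \<phi>] test_function_continuous[OF test_function_deriv(2)[OF \<phi>]])+
  have zero: "\<phi> 0 = 0" "\<phi> T = 0"
    using test_functionsD(3)[OF \<phi>] closure_subset[of "{x. \<phi> x \<noteq> 0}"] by auto
  have "((\<lambda>t. deriv \<phi> t * g t + \<phi> t * g' t) has_integral (\<phi> T * g T - \<phi> 0 * g 0)) {0..T}"
  proof (rule fundamental_theorem_of_calculus)
    show "((\<lambda>t. \<phi> t * g t) has_vector_derivative deriv \<phi> t * g t + \<phi> t * g' t) (at t within {0..T})" if "t \<in> {0..T}" for t
      unfolding has_real_derivative_iff_has_vector_derivative[symmetric]
      by (rule derivative_eq_intros has_field_derivative_at_within[OF test_function_deriv(1)[OF \<phi>]] g that)+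
        (simp add: mult.commute)
  qed (use T in simp)
  then have "integral {0..T} (\<lambda>t. deriv \<phi> t * g t + \<phi> t * g' t) = 0" by (simp add: zero integral_unique)
  moreover have "integral {0..T} (\<lambda>t. deriv \<phi> t * g t + \<phi> t * g' t) =
      integral {0..T} (\<lambda>t. deriv \<phi> t * g t) + integral {0..T} (\<lambda>t. \<phi> t * g' t)"
    by (intro Henstock_Kurzweil_Integration.integral_add integrable_continuous_real cont)
  ultimately show ?thesis by (simp add: continuous_integrable_time(2)[OF cont(1)] continuous_integrable_time(2)[OF cont(2)])
qed

text \<open>The primitive from 0 vanishes left of the support of \<open>\<xi>\<close>, and also
  right of it because the total integral is zero.\<close>

lemma test_function_antiderivative:
  assumes \<xi>: "\<xi> \<in> test_functions {0<..<T}" and zero: "integral {0..T} \<xi> = 0" and T: "0 < T"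
  shows "\<exists>\<phi>\<in>test_functions {0<..<T}. deriv \<phi> = \<xi>"
proof -
  let ?K = "closure {x. \<xi> x \<noteq> 0}"
  define \<phi> where "\<phi> = (\<lambda>t. integral {0..t} \<xi>)"
  have "\<exists>a b. 0 < a \<and> a \<le> b \<and> b < T \<and> ?K \<subseteq> {a..b}"
  proof (cases "?K = {}")
    case True
    then show ?thesis using T by (intro exI[of _ "T/2"]) auto
  next
    case False
    then obtain a b where ab: "a \<in> ?K" "b \<in> ?K" "\<And>x. x \<in> ?K \<Longrightarrow> a \<le> x" "\<And>x. x \<in> ?K \<Longrightarrow> x \<le> b"
      using compact_attains_inf[OF test_functionsD(2)[OF \<xi>] False]
        compact_attains_sup[OF test_functionsD(2)[OF \<xi>] False] by blast
    then have "a \<in> {0<..<T}" "b \<in> {0<..<T}" using test_functionsD(3)[OF \<xi>] by blast+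
    then show ?thesis using ab by (intro exI[of _ a] exI[of _ b]) auto
  qed
  then obtain a b where ab: "0 < a" "a \<le> b" "b < T" "?K \<subseteq> {a..b}" by blast
  have out: "\<xi> x = 0" if "x \<notin> {a..b}" for x using that ab(4) closure_subset[of "{x. \<xi> x \<noteq> 0}"] by auto
  have int: "\<xi> integrable_on {s..t}" for s t
    by (rule integrable_continuous_real[OF test_function_continuous[OF \<xi>]])
  have low: "\<phi> t = 0" if "t < a" for t
  proof -
    have "integral {0..t} \<xi> = integral {0..t} (\<lambda>_. 0)"
      by (rule Henstock_Kurzweil_Integration.integral_cong) (use that out in auto)
    then show ?thesis by (simp add: \<phi>_def)
  qed
  have high: "\<phi> t = 0" if "t > b" for t
  proof -
    have eq0: "integral {b..t} \<xi> = 0" if "t > b" for t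
    proof -
      have "integral {b..t} \<xi> = integral {b<..<t} \<xi>" using integral_open_interval[of b t \<xi>] by simp
      also have "\<dots> = integral {b<..<t} (\<lambda>_. 0)"
        by (rule Henstock_Kurzweil_Integration.integral_cong) (use out in auto)
      finally show ?thesis by simp
    qed
    have "integral {0..b} \<xi> + integral {b..t} \<xi> = \<phi> t" if "t > b" for t
      unfolding \<phi>_def using that ab by (intro Henstock_Kurzweil_Integration.integral_combine int) auto
    from this[OF that] this[OF ab(3)] show ?thesis using zero by (simp add: eq0 that ab(3) \<phi>_def)
  qed
  \<comment> \<open>Left of \<open>a\<close> the primitive is identically zero, which also covers
    negative times; elsewhere t is positive and the fundamental theorem applies on an interval
    around t.\<close>
  have der: "(\<phi> has_real_derivative \<xi> t) (at t)" for t
  proof (cases "t < a")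
    case True
    have "((\<lambda>_. 0) has_real_derivative 0) (at t)" by simp
    then have "(\<phi> has_real_derivative 0) (at t)"
      by (rule DERIV_cong_ev[THEN iffD1, rotated -1, OF _ refl _ refl])
        (use True low in \<open>auto simp: eventually_nhds intro!: exI[of _ "{..<a}"]\<close>)
    then show ?thesis using out[of t] True by simp
  next
    case False
    have "(\<phi> has_vector_derivative \<xi> t) (at t within {0..t + 1})"
      unfolding \<phi>_def using False ab
      by (intro integral_has_vector_derivative test_function_continuous[OF \<xi>]) auto
    then have "(\<phi> has_vector_derivative \<xi> t) (at t within {0<..<t + 1})"
      by (rule has_vector_derivative_within_subset) auto
    then show ?thesis using False ab
      by (simp add: has_real_derivative_iff_has_vector_derivative at_within_open[of t "{0<..<t + 1}"])
  qed
  have "Ck_on k UNIV \<phi>" for k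
    using Ck_on_real_Suc[OF der open_UNIV test_functionsD(1)[OF \<xi>], of k] Ck_on_SucD by blast
  moreover have "{x. \<phi> x \<noteq> 0} \<subseteq> {a..b}"
  proof
    fix x assume "x \<in> {x. \<phi> x \<noteq> 0}"
    then show "x \<in> {a..b}" using low[of x] high[of x] by (cases "x < a"; cases "x > b") auto
  qed
  ultimately have "\<phi> \<in> test_functions {0<..<T}"
    by (rule test_functions_I) (use ab in auto)
  moreover have "deriv \<phi> = \<xi>" using der DERIV_imp_deriv by blast
  ultimately show ?thesis by blast
qed

text \<open>A test function with vanishing integral is the derivative of a test function, so the
  difference of g and the primitive of k is orthogonal to all of these, hence constant.\<close>

lemma distributional_derivative_imp_integral:
  fixes g k :: "real \<Rightarrow> real"
  assumes T: "0 < T" and g: "continuous_on {0..T} g" and k: "continuous_on {0..T} k"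
    and weak: "\<And>\<phi>. \<phi> \<in> test_functions {0<..<T} \<Longrightarrow>
      (\<integral>t. deriv \<phi> t * g t \<partial>time_measure T) = - (\<integral>t. \<phi> t * k t \<partial>time_measure T)"
    and t: "t \<in> {0..T}"
  shows "g t - g 0 = integral {0..t} k"
proof -
  define D where "D = (\<lambda>t. g t - integral {0..t} k)"
  have derK: "((\<lambda>t. integral {0..t} k) has_real_derivative k t) (at t within {0..T})" if "t \<in> {0..T}" for t
    using integral_has_vector_derivative[OF k that] by (simp add: has_real_derivative_iff_has_vector_derivative)
  have contK: "continuous_on {0..T} (\<lambda>t. integral {0..t} k)"
    using derK DERIV_continuous continuous_on_eq_continuous_within by blast
  have contD: "continuous_on {0..T} D" unfolding D_def by (intro continuous_intros g contK)
  have orth: "(\<integral>t. deriv \<phi> t * D t \<partial>time_measure T) = 0" if \<phi>: "\<phi> \<in> test_functions {0<..<T}" for \<phi>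
  proof -
    note c = test_function_continuous[OF test_function_deriv(2)[OF \<phi>], of "{0..T}"]
    have "(\<integral>t. deriv \<phi> t * D t \<partial>time_measure T) = (\<integral>t. deriv \<phi> t * g t \<partial>time_measure T) - (\<integral>t. deriv \<phi> t * integral {0..t} k \<partial>time_measure T)"
      unfolding D_def right_diff_distrib
      by (intro Bochner_Integration.integral_diff continuous_integrable_time continuous_intros c g contK)
    also have "\<dots> = 0" using weak[OF \<phi>] integration_by_parts_time[OF \<phi> T derK k] by simp
    finally show ?thesis .
  qed
  define m where "m = (\<lambda>\<psi> :: real \<Rightarrow> real. (\<integral>t. \<psi> t \<partial>time_measure T))"
  \<comment> \<open>A fixed test function of positive mass; subtracting a multiple of it gives any
    test function integral zero.\<close>
  define \<rho> where "\<rho> = bump (T/4) (3*T/4) 0"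
  have \<rho>: "\<rho> \<in> test_functions {0<..<T}" unfolding \<rho>_def by (rule bump_test_function) (use T in auto)
  have "m \<rho> > 0"
  proof -
    have "integral {0..T} \<rho> \<noteq> 0"
    proof
      assume "integral {0..T} \<rho> = 0"
      moreover have "0 \<le> \<rho> x" for x unfolding \<rho>_def by (rule bump_nonneg)
      ultimately have "\<forall>x\<in>{0..T}. \<rho> x = 0"
        using integral_eq_0_iff[OF test_function_continuous[OF \<rho>] T] by blast
      then have "\<rho> (T/2) = 0" using T by auto
      moreover have "T/2 \<in> box (T/4) (3*T/4)" using T by (simp add: box_real)
      ultimately show False unfolding \<rho>_def using bump_eq_0_iff by blast
    qed
    moreover have "0 \<le> integral {0..T} \<rho>"
      by (rule Henstock_Kurzweil_Integration.integral_nonneg)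
        (auto simp: \<rho>_def bump_nonneg intro!: integrable_continuous_real continuous_bump)
    ultimately show ?thesis unfolding m_def continuous_integrable_time(2)[OF test_function_continuous[OF \<rho>]] by simp
  qed
  \<comment> \<open>The mean of D weighted by \<open>\<rho>\<close>: the only possible value if D is
    constant.\<close>
  define c where "c = (\<integral>t. \<rho> t * D t \<partial>time_measure T) / m \<rho>"
  have "AE t in time_measure T. D t - c = 0"
  proof (rule AE_zero_if_orthogonal_to_test_functions)
    show "integrable (lebesgue_on (cbox a b)) (\<lambda>t. D t - c)" if "cbox a b \<subseteq> {0<..<T}" for a b
    proof -
      have "{a..b} \<subseteq> {0..T}" using that by (auto simp: subset_iff)
      then have "continuous_on {a..b} (\<lambda>t. D t - c)"
        by (intro continuous_intros continuous_on_subset[OF contD])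
      then show ?thesis using continuous_imp_integrable_real by simp
    qed
    fix \<psi> assume \<psi>: "\<psi> \<in> test_functions {0<..<T}"
    define \<xi> where "\<xi> = (\<lambda>t. \<psi> t + (- (m \<psi> / m \<rho>)) * \<rho> t)"
    have \<xi>: "\<xi> \<in> test_functions {0<..<T}" unfolding \<xi>_def by (intro test_functions_add test_functions_scale \<psi> \<rho>)
    note cont = test_function_continuous[OF \<psi>, of "{0..T}"] test_function_continuous[OF \<rho>, of "{0..T}"]
    note int = continuous_integrable_time(1)[OF cont(1)] continuous_integrable_time(1)[OF cont(2)]
      continuous_integrable_time(1)[OF continuous_on_mult[OF cont(1) contD]]
      continuous_integrable_time(1)[OF continuous_on_mult[OF cont(2) contD]]
    have "m \<xi> = m \<psi> + (- (m \<psi> / m \<rho>)) * m \<rho>"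
      unfolding m_def \<xi>_def using int by simp
    then have "m \<xi> = 0" using \<open>m \<rho> > 0\<close> by simp
    then have "integral {0..T} \<xi> = 0" unfolding m_def continuous_integrable_time(2)[OF test_function_continuous[OF \<xi>]] .
    from test_function_antiderivative[OF \<xi> this T] obtain \<phi> where "\<phi> \<in> test_functions {0<..<T}" "deriv \<phi> = \<xi>" by blast
    with orth have "(\<integral>t. \<xi> t * D t \<partial>time_measure T) = 0" by metis
    moreover have "(\<integral>t. \<xi> t * D t \<partial>time_measure T) = (\<integral>t. \<psi> t * D t \<partial>time_measure T) - c * m \<psi>"
    proof -
      have "(\<integral>t. \<xi> t * D t \<partial>time_measure T) = (\<integral>t. \<psi> t * D t + (- (m \<psi> / m \<rho>)) * (\<rho> t * D t) \<partial>time_measure T)"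
        by (simp add: \<xi>_def distrib_right left_diff_distrib mult.assoc)
      also have "\<dots> = (\<integral>t. \<psi> t * D t \<partial>time_measure T) - m \<psi> / m \<rho> * (\<integral>t. \<rho> t * D t \<partial>time_measure T)"
        using int by simp
      finally show ?thesis by (simp add: c_def)
    qed
    moreover have "(\<integral>t. (D t - c) * \<psi> t \<partial>time_measure T) = (\<integral>t. \<psi> t * D t \<partial>time_measure T) - c * m \<psi>"
    proof -
      have "(\<integral>t. (D t - c) * \<psi> t \<partial>time_measure T) = (\<integral>t. \<psi> t * D t - c * \<psi> t \<partial>time_measure T)"
        by (rule Bochner_Integration.integral_cong) (simp_all add: algebra_simps)
      also have "\<dots> = (\<integral>t. \<psi> t * D t \<partial>time_measure T) - c * m \<psi>" using int by (simp add: m_def)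
      finally show ?thesis .
    qed
    ultimately show "(\<integral>t. (D t - c) * \<psi> t \<partial>time_measure T) = 0" by simp
  qed simp
  then have AE: "AE t in time_measure T. D t \<in> {c}" by simp
  have "D s \<in> {c}" if "s \<in> {0..T}" for s
    by (rule AE_closed_imp_everywhere[OF contD _ AE T that]) simp
  from this[OF t] this[of 0] show ?thesis using T by (simp add: D_def)
qed

text \<open>Approximation by continuous functions is easier to transport through maps than strong
  measurability, which it implies. Convergence almost everywhere gives measurability of scalar
  quantities, and convergence in L2 gives limits of integrals.\<close>

definition L2_approx :: "real \<Rightarrow> (nat \<Rightarrow> real \<Rightarrow> 'b::real_normed_vector) \<Rightarrow> (real \<Rightarrow> 'b) \<Rightarrow> bool" where
  "L2_approx T y y' \<longleftrightarrow> (\<forall>n. continuous_on {0..T} (y n)) \<and>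
     (AE t in time_measure T. (\<lambda>n. y n t) \<longlonglongrightarrow> y' t) \<and>
     (\<lambda>n. \<integral>\<^sup>+t. ennreal ((norm (y n t - y' t))\<^sup>2) \<partial>time_measure T) \<longlonglongrightarrow> 0"

lemma L2_approx_measurable:
  assumes y: "L2_approx T y y'"
  shows "(\<lambda>t. norm (y n t - y' t)) \<in> borel_measurable (time_measure T)"
proof (rule borel_measurable_lebesgue_on_AE_limit)
  show "(\<lambda>t. norm (y n t - y m t)) \<in> borel_measurable (time_measure T)" for m
    using y unfolding L2_approx_def by (intro continuous_measurable_time continuous_intros) auto
  have "AE t in time_measure T. (\<lambda>n. y n t) \<longlonglongrightarrow> y' t" using y by (simp add: L2_approx_def)
  then show "AE t in time_measure T. (\<lambda>m. norm (y n t - y m t)) \<longlonglongrightarrow> norm (y n t - y' t)"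
    by eventually_elim (intro tendsto_intros)
qed simp

text \<open>A Lipschitz constant uniform in time carries over both modes of convergence. Applied to
  the nonlinearity, to projections and to multiplication by a test function.\<close>

lemma L2_approx_lipschitz:
  assumes y: "L2_approx T y y'" and cont: "\<And>n. continuous_on {0..T} (\<lambda>t. h t (y n t))"
    and C: "0 \<le> C" and lip: "\<And>t a b. t \<in> {0..T} \<Longrightarrow> norm (h t a - h t b) \<le> C * norm (a - b)"
  shows "L2_approx T (\<lambda>n t. h t (y n t)) (\<lambda>t. h t (y' t))"
  unfolding L2_approx_def
proof (intro conjI allI cont)
  have AE_space: "AE t in time_measure T. t \<in> {0..T}" by (rule AE_I2) simp
  have lim: "AE t in time_measure T. (\<lambda>n. y n t) \<longlonglongrightarrow> y' t" using y by (simp add: L2_approx_def)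
  with AE_space show "AE t in time_measure T. (\<lambda>n. h t (y n t)) \<longlonglongrightarrow> h t (y' t)"
  proof eventually_elim
    case (elim t)
    have "(\<lambda>n. norm (y n t - y' t)) \<longlonglongrightarrow> 0" using elim by (simp add: tendsto_norm_zero LIM_zero)
    then have "(\<lambda>n. C * norm (y n t - y' t)) \<longlonglongrightarrow> 0" by (rule tendsto_mult_right_zero)
    then have "(\<lambda>n. h t (y n t) - h t (y' t)) \<longlonglongrightarrow> 0"
      by (rule Lim_null_comparison[rotated]) (intro always_eventually allI lip elim(1))
    then show ?case by (simp add: LIM_zero_iff)
  qed
  note meas = L2_approx_measurable[OF y]
  have le: "(\<integral>\<^sup>+t. ennreal ((norm (h t (y n t) - h t (y' t)))\<^sup>2) \<partial>time_measure T) \<le>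
      ennreal (C\<^sup>2) * (\<integral>\<^sup>+t. ennreal ((norm (y n t - y' t))\<^sup>2) \<partial>time_measure T)" for n
  proof -
    have "(\<integral>\<^sup>+t. ennreal ((norm (h t (y n t) - h t (y' t)))\<^sup>2) \<partial>time_measure T) \<le>
      (\<integral>\<^sup>+t. ennreal (C\<^sup>2) * ennreal ((norm (y n t - y' t))\<^sup>2) \<partial>time_measure T)"
    proof (rule nn_integral_mono)
      fix t assume "t \<in> space (time_measure T)"
      then have "norm (h t (y n t) - h t (y' t)) \<le> C * norm (y n t - y' t)" by (intro lip) auto
      then have "(norm (h t (y n t) - h t (y' t)))\<^sup>2 \<le> (C * norm (y n t - y' t))\<^sup>2" by (rule power_mono) simp
      then show "ennreal ((norm (h t (y n t) - h t (y' t)))\<^sup>2) \<le> ennreal (C\<^sup>2) * ennreal ((norm (y n t - y' t))\<^sup>2)"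
        by (simp add: power_mult_distrib ennreal_mult[symmetric] ennreal_leI)
    qed
    also have "\<dots> = ennreal (C\<^sup>2) * (\<integral>\<^sup>+t. ennreal ((norm (y n t - y' t))\<^sup>2) \<partial>time_measure T)"
      by (intro nn_integral_cmult measurable_compose[OF _ measurable_ennreal] borel_measurable_power meas)
    finally show ?thesis .
  qed
  have "(\<lambda>n. ennreal (C\<^sup>2) * (\<integral>\<^sup>+t. ennreal ((norm (y n t - y' t))\<^sup>2) \<partial>time_measure T)) \<longlonglongrightarrow> ennreal (C\<^sup>2) * 0"
    using y unfolding L2_approx_def by (intro ennreal_tendsto_cmult) auto
  then have *: "(\<lambda>n. ennreal (C\<^sup>2) * (\<integral>\<^sup>+t. ennreal ((norm (y n t - y' t))\<^sup>2) \<partial>time_measure T)) \<longlonglongrightarrow> 0" by simp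
  show "(\<lambda>n. \<integral>\<^sup>+t. ennreal ((norm (h t (y n t) - h t (y' t)))\<^sup>2) \<partial>time_measure T) \<longlonglongrightarrow> 0"
    by (rule tendsto_sandwich[OF _ _ tendsto_const *]) (use le in simp_all)
qed

lemma L2_approx_Pair:
  assumes "L2_approx T y y'" "L2_approx T z z'"
  shows "L2_approx T (\<lambda>n t. (y n t, z n t)) (\<lambda>t. (y' t, z' t))"
  unfolding L2_approx_def
proof (intro conjI allI)
  let ?I = "\<lambda>x n. \<integral>\<^sup>+t. ennreal ((norm (x n t))\<^sup>2) \<partial>time_measure T"
  show "continuous_on {0..T} (\<lambda>t. (y n t, z n t))" for n
    using assms by (intro continuous_intros) (auto simp: L2_approx_def)
  have lim: "AE t in time_measure T. (\<lambda>n. y n t) \<longlonglongrightarrow> y' t" "AE t in time_measure T. (\<lambda>n. z n t) \<longlonglongrightarrow> z' t"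
    using assms by (auto simp: L2_approx_def)
  then show "AE t in time_measure T. (\<lambda>n. (y n t, z n t)) \<longlonglongrightarrow> (y' t, z' t)"
    by eventually_elim (rule tendsto_Pair)
  note meas = L2_approx_measurable[OF assms(1)] and meas' = L2_approx_measurable[OF assms(2)]
  have "?I (\<lambda>n t. (y n t, z n t) - (y' t, z' t)) n = ?I (\<lambda>n t. y n t - y' t) n + ?I (\<lambda>n t. z n t - z' t) n" for n
  proof -
    have "?I (\<lambda>n t. (y n t, z n t) - (y' t, z' t)) n =
        (\<integral>\<^sup>+t. ennreal ((norm (y n t - y' t))\<^sup>2) + ennreal ((norm (z n t - z' t))\<^sup>2) \<partial>time_measure T)"
      by (simp add: norm_Pair)
    also have "\<dots> = ?I (\<lambda>n t. y n t - y' t) n + ?I (\<lambda>n t. z n t - z' t) n"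
      by (intro nn_integral_add measurable_compose[OF _ measurable_ennreal] borel_measurable_power meas meas')
    finally show ?thesis .
  qed
  moreover have "(\<lambda>n. ?I (\<lambda>n t. y n t - y' t) n + ?I (\<lambda>n t. z n t - z' t) n) \<longlonglongrightarrow> 0 + 0"
    using assms unfolding L2_approx_def by (intro tendsto_add) auto
  ultimately show "(\<lambda>n. \<integral>\<^sup>+t. ennreal ((norm ((y n t, z n t) - (y' t, z' t)))\<^sup>2) \<partial>time_measure T) \<longlonglongrightarrow> 0"
    by simp
qed

text \<open>On a bounded interval L2 convergence implies L1 convergence, by the Cauchy-Schwarz
  inequality against the constant 1.\<close>

lemma L2_approx_inner:
  fixes z :: "'b::real_inner"
  assumes y: "L2_approx T y y'" and T: "0 < T"
  shows "(\<lambda>n. \<integral>t. y n t \<bullet> z \<partial>time_measure T) \<longlonglongrightarrow> (\<integral>t. y' t \<bullet> z \<partial>time_measure T)"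
proof -
  interpret M: finite_measure "time_measure T"
    by (rule finite_measure_lebesgue_on) (simp add: lmeasurable_interval)
  let ?a = "\<lambda>n t. y n t \<bullet> z" and ?a' = "\<lambda>t. y' t \<bullet> z"
  have a: "L2_approx T ?a ?a'"
  proof (rule L2_approx_lipschitz[OF y])
    show "continuous_on {0..T} (\<lambda>t. y n t \<bullet> z)" for n
      using y by (intro continuous_intros) (auto simp: L2_approx_def)
    show "norm (a \<bullet> z - b \<bullet> z) \<le> norm z * norm (a - b)" for a b
      using Cauchy_Schwarz_ineq2[of "a - b" z] by (simp add: inner_diff_left mult.commute)
  qed simp
  have cont: "continuous_on {0..T} (?a n)" for n using a by (simp add: L2_approx_def)
  have "AE t in time_measure T. (\<lambda>n. ?a n t) \<longlonglongrightarrow> ?a' t" using a by (simp add: L2_approx_def)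
  then have meas: "?a' \<in> borel_measurable (time_measure T)"
    by (rule borel_measurable_lebesgue_on_AE_limit[rotated -1]) (simp_all add: continuous_measurable_time[OF cont])
  have meas_d: "(\<lambda>t. ?a n t - ?a' t) \<in> borel_measurable (time_measure T)" for n
    by (intro borel_measurable_diff continuous_measurable_time cont meas)
  have "(\<lambda>n. \<integral>\<^sup>+t. ennreal (norm (?a n t - ?a' t)) \<partial>time_measure T) \<longlonglongrightarrow> 0"
  proof -
    let ?f = "\<lambda>n. \<integral>\<^sup>+t. ennreal (norm (?a n t - ?a' t)) \<partial>time_measure T"
    have sq_le: "(?f n)\<^sup>2 \<le> (\<integral>\<^sup>+t. ennreal ((norm (?a n t - ?a' t))\<^sup>2) \<partial>time_measure T) * ennreal T" for n
    proof -
      have "(\<integral>\<^sup>+t. ennreal (norm (?a n t - ?a' t)) * 1 \<partial>time_measure T)\<^sup>2 \<le>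
        (\<integral>\<^sup>+t. (ennreal (norm (?a n t - ?a' t)))\<^sup>2 \<partial>time_measure T) * (\<integral>\<^sup>+t. 1\<^sup>2 \<partial>time_measure T)"
        by (rule Cauchy_Schwarz_nn_integral)
          (simp_all only: measurable_compose[OF borel_measurable_norm[THEN measurable_compose[OF meas_d]] measurable_ennreal] borel_measurable_const)
      also have "(\<integral>\<^sup>+t. 1\<^sup>2 \<partial>time_measure T) = ennreal T" using T by (simp add: emeasure_restrict_space)
      finally show ?thesis by (simp add: ennreal_power)
    qed
    have "(\<lambda>n. (\<integral>\<^sup>+t. ennreal ((norm (?a n t - ?a' t))\<^sup>2) \<partial>time_measure T) * ennreal T) \<longlonglongrightarrow> ennreal T * 0"
      unfolding mult.commute[of _ "ennreal T"]
      using a unfolding L2_approx_def by (intro ennreal_tendsto_cmult) auto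
    then have "(\<lambda>n. (\<integral>\<^sup>+t. ennreal ((norm (?a n t - ?a' t))\<^sup>2) \<partial>time_measure T) * ennreal T) \<longlonglongrightarrow> 0" by simp
    from tendsto_sandwich[OF always_eventually always_eventually tendsto_const this] have sq: "(\<lambda>n. (?f n)\<^sup>2) \<longlonglongrightarrow> 0"
      using sq_le by simp
    show ?thesis
    proof (rule order_tendstoI)
      fix e :: ennreal assume e: "0 < e"
      then have "0 < e\<^sup>2" by (simp add: power2_eq_square ennreal_zero_less_mult_iff)
      from order_tendstoD(2)[OF sq this] show "\<forall>\<^sub>F n in sequentially. ?f n < e"
        by eventually_elim (metis not_le power_mono zero_le)
    qed simp
  qed
  moreover have int: "integrable (time_measure T) (?a n)" for n by (rule continuous_integrable_time[OF cont])
  moreover have "integrable (time_measure T) ?a'"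
  proof -
    obtain n where n: "(\<integral>\<^sup>+t. ennreal (norm (?a n t - ?a' t)) \<partial>time_measure T) < 1"
      using order_tendstoD(2)[OF calculation(1), of 1] by (auto simp: eventually_sequentially)
    have "integrable (time_measure T) (\<lambda>t. ?a n t - ?a' t)"
      by (rule integrableI_bounded[OF meas_d]) (use n in \<open>simp add: order_less_trans\<close>)
    from Bochner_Integration.integrable_diff[OF int[of n] this] show ?thesis by simp
  qed
  ultimately show ?thesis by (intro tendsto_L1_int)
qed

subsection \<open>Weak solutions\<close>

lemma norm_fst_proj_le: "norm (fst z) \<le> norm z" and norm_snd_proj_le: "norm (snd z) \<le> norm z"
  using norm_fst_le[of "fst z" "snd z"] norm_snd_le[of "snd z" "fst z"] by simp_all

context weighted_domain
begin

lemma closed_W: "closed W" by (simp add: W_def)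

lemma graph_inner_bound:
  assumes "v \<in> H10 \<Omega>" shows "\<bar>y \<bullet> graph v\<bar> \<le> sqrt (max 1 C) * norm y * H1_norm \<Omega> v"
proof -
  have "\<bar>y \<bullet> graph v\<bar> \<le> norm y * norm (graph v)" by (rule Cauchy_Schwarz_ineq2)
  also have "\<dots> \<le> norm y * (sqrt (max 1 C) * H1_norm \<Omega> v)"
    by (intro mult_left_mono norm_graph H10_graph assms) simp
  finally show ?thesis by (simp add: ac_simps)
qed

text \<open>With unit weight the norm of the graph is the H1 norm.\<close>

lemma seminorm_H10: "seminorm_on (H10 \<Omega>) (H1_norm \<Omega>)"
proof -
  interpret one: weighted_domain \<Omega> "\<lambda>_. 1" 1 1
    by standard (auto simp: open_\<Omega>)
  have eq: "H1_norm \<Omega> u = norm (one.graph u)" if "u \<in> H10 \<Omega>" for u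
    using one.norm_graph[OF one.H10_graph(1)[OF that]] by simp
  have "(\<lambda>x. 0) \<in> H10 \<Omega>"
    using W_imp_H10(1)[OF subspace_0[OF subspace_W] L2_zero] ext_scale[OF meas_\<Omega> L2_zero, of 0] by simp
  then have "subspace (H10 \<Omega>)"
    by (intro subspaceI H10_subspace) (simp_all add: zero_fun_def)
  then show ?thesis
    by unfold_locales (simp_all add: eq one.H10_subspace norm_triangle_ineq)
qed

text \<open>A pair acts on V by its first component against the function plus its second against the
  weighted gradient. Elements of H and values of the diffusion operator are both of this form, so
  convergence in the dual follows from convergence of vectors.\<close>

definition functional :: "(real^'n) l2 \<times> ((real^'n) l2 ^ 'n) \<Rightarrow> (real^'n \<Rightarrow> real) \<Rightarrow> real" where
  "functional y = (\<lambda>v. y \<bullet> graph v)"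

lemma functional_diff: "functional y - functional z = functional (y - z)"
  by (simp add: functional_def fun_eq_iff inner_diff_left)

lemma functional_dual: "functional y \<in> Vdual \<Omega>"
  unfolding dual_def functional_def
proof (intro CollectI conjI ballI allI)
  show "\<exists>c. \<forall>u\<in>H10 \<Omega>. \<bar>y \<bullet> graph u\<bar> \<le> c * H1_norm \<Omega> u" using graph_inner_bound by blast
qed (simp_all add: H10_subspace inner_add_right)

lemma functional_norm: "Vdual_norm \<Omega> (functional y) \<le> sqrt (max 1 C) * norm y"
  unfolding functional_def
  by (rule seminorm_on.dual_norm_le[OF seminorm_H10 graph_inner_bound]) simp_all

lemma dual_cong:
  assumes "\<Lambda> \<in> Vdual \<Omega>" "\<And>v. v \<in> H10 \<Omega> \<Longrightarrow> M v = \<Lambda> v"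
  shows "M \<in> Vdual \<Omega>"
  using assms H10_subspace by (auto simp: dual_def)

lemma H_to_Vdual_eq: "u \<in> L2 \<Omega> \<Longrightarrow> v \<in> H10 \<Omega> \<Longrightarrow> H_to_Vdual \<Omega> u v = functional (ext \<Omega> u, 0) v"
  by (simp add: H_to_Vdual_def functional_def graph_def inner_ext[OF meas_\<Omega>] H1_L2 H10_graph(1))

lemma diffusion_functional:
  "u \<in> H10 \<Omega> \<Longrightarrow> v \<in> H10 \<Omega> \<Longrightarrow> diffusion_operator \<Omega> b u v = functional (0, snd (graph u)) v"
  by (simp add: diffusion_eq H10_graph(1) functional_def inner_prod_def)

lemma W_lift:
  assumes "w \<in> W"
  shows "rep_l2 (fst w) \<in> H10 \<Omega>" "graph (rep_l2 (fst w)) = w"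
  using W_imp_H10[OF assms rep_l2_L2[OF meas_\<Omega>] W_ext_rep(1)[OF assms]] by auto

lemma closure_W_ext_rep:
  assumes "h \<in> closure (fst ` W)" shows "ext \<Omega> (rep_l2 h) = h"
proof -
  have "fst ` W \<subseteq> {h. ext \<Omega> (rep_l2 h) = h}" using W_ext_rep(1) by auto
  then have "closure (fst ` W) \<subseteq> {h. ext \<Omega> (rep_l2 h) = h}" by (intro closure_minimal closed_ext_rep)
  then show ?thesis using assms by auto
qed

text \<open>\<open>functional\<close> is Lipschitz from the product space into the dual, so
  approximations of vectors become approximations of functionals. \<open>F\<close> and
  \<open>I\<close> are tied to the vectors only through their values on V.\<close>

lemma L2_approx_dual:
  assumes y: "L2_approx T y y'" and T: "0 < T"
    and F: "AE t in time_measure T. \<forall>v\<in>H10 \<Omega>. F t v = functional (y' t) v"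
  shows "F \<in> bochner_L2 (time_measure T) (Vdual \<Omega>) (Vdual_norm \<Omega>)"
    and "(\<And>v. v \<in> H10 \<Omega> \<Longrightarrow> I v = (\<integral>t. y' t \<bullet> graph v \<partial>time_measure T)) \<Longrightarrow>
      has_bochner_integral_in (time_measure T) (Vdual \<Omega>) (Vdual_norm \<Omega>) F I"
proof -
  interpret V: seminorm_on "H10 \<Omega>" "H1_norm \<Omega>" by (rule seminorm_H10)
  interpret D: seminorm_on "Vdual \<Omega>" "Vdual_norm \<Omega>" by (rule V.seminorm_dual)
  have "AE t in time_measure T. y' t \<in> UNIV \<and> F t \<in> Vdual \<Omega> \<and> Vdual_norm \<Omega> (F t - functional (y' t)) = 0"
    using F
  proof eventually_elim
    case (elim t)
    have Fd: "F t \<in> Vdual \<Omega>" by (rule dual_cong[OF functional_dual]) (use elim in auto)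
    have "Vdual_norm \<Omega> (F t - functional (y' t)) \<le> 0"
      by (rule V.dual_norm_le) (use elim in auto)
    moreover have "0 \<le> Vdual_norm \<Omega> (F t - functional (y' t))"
      by (intro D.nonneg D.diff Fd functional_dual)
    ultimately show ?case using Fd by simp
  qed
  note * = D.bochner_L2_of_continuous_limit[where Y=UNIV and \<Theta>=functional and y=y and y'=y' and F=F and T=T
      and C="sqrt (max 1 C)", OF _ _ functional_dual functional_norm _ _ this _ _ T]
  have "continuous_on {0..T} (y n)" "AE t in time_measure T. (\<lambda>n. y n t) \<longlonglongrightarrow> y' t"
    "(\<lambda>n. \<integral>\<^sup>+t. ennreal ((norm (y n t - y' t))\<^sup>2) \<partial>time_measure T) \<longlonglongrightarrow> 0" for n
    using y by (auto simp: L2_approx_def)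
  note ** = *[OF this(1) _ _ _ this(2,3), simplified functional_diff, OF UNIV_I functional_norm]
  show mem: "F \<in> bochner_L2 (time_measure T) (Vdual \<Omega>) (Vdual_norm \<Omega>)" by (rule **(1)) simp
  show "has_bochner_integral_in (time_measure T) (Vdual \<Omega>) (Vdual_norm \<Omega>) F I"
    if I: "\<And>v. v \<in> H10 \<Omega> \<Longrightarrow> I v = (\<integral>t. y' t \<bullet> graph v \<partial>time_measure T)"
  proof (rule V.has_bochner_integral_in_dualI[OF mem])
    show "\<exists>s. (\<forall>i::nat. simple_function (time_measure T) (s i) \<and> s i ` space (time_measure T) \<subseteq> Vdual \<Omega>) \<and>
      (\<lambda>i. \<integral>\<^sup>+t. ennreal (Vdual_norm \<Omega> (F t - s i t)) \<partial>time_measure T) \<longlonglongrightarrow> 0"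
      by (rule **(2)) simp
    fix v assume v: "v \<in> H10 \<Omega>"
    have "strongly_measurable (time_measure T) (Vdual \<Omega>) (Vdual_norm \<Omega>) F" using mem by (simp add: bochner_L2_def)
    then have 1: "(\<lambda>t. F t v) \<in> borel_measurable (time_measure T)"
      by (rule V.strongly_measurable_eval[rotated]) (simp_all add: v)
    have "AE t in time_measure T. (\<lambda>n. y n t \<bullet> graph v) \<longlonglongrightarrow> y' t \<bullet> graph v"
      using y unfolding L2_approx_def by (auto elim!: eventually_mono intro: tendsto_intros)
    then have 2: "(\<lambda>t. y' t \<bullet> graph v) \<in> borel_measurable (time_measure T)"
      by (rule borel_measurable_lebesgue_on_AE_limit[rotated -1])
        (use y in \<open>auto intro!: continuous_measurable_time continuous_intros simp: L2_approx_def\<close>)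
    have "AE t in time_measure T. F t v = y' t \<bullet> graph v"
      using F by eventually_elim (use v in \<open>auto simp: functional_def\<close>)
    from integral_cong_AE[OF 1 2 this] show "I v = (\<integral>t. F t v \<partial>time_measure T)" by (simp add: I[OF v])
  qed
qed

text \<open>Representatives are picked arbitrarily, yet the choice is Lipschitz from
  \<open>W\<close> into the H1 seminorm, because the graph of a difference of representatives is the
  difference of the elements of \<open>W\<close>.\<close>

lemma L2_approx_H10:
  assumes y: "L2_approx T y y'" and T: "0 < T" and W: "\<And>n t. t \<in> {0..T} \<Longrightarrow> y n t \<in> W"
    and F: "AE t in time_measure T. y' t \<in> W \<and> F t = rep_l2 (fst (y' t))"
  shows "F \<in> bochner_L2 (time_measure T) (H10 \<Omega>) (H1_norm \<Omega>)"
proof -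
  interpret V: seminorm_on "H10 \<Omega>" "H1_norm \<Omega>" by (rule seminorm_H10)
  define m where "m = sqrt (min 1 c)"
  have m: "m > 0" using c by (simp add: m_def)
  have bound: "H1_norm \<Omega> u \<le> 1 / m * norm (graph u)" if "u \<in> H10 \<Omega>" for u
    using norm_graph(1)[OF H10_graph(1)[OF that]] m by (simp add: m_def[symmetric] field_simps)
  show ?thesis
  proof (rule V.bochner_L2_of_continuous_limit(1)[where Y=W and \<Theta>="\<lambda>a. rep_l2 (fst a)" and y=y and y'=y' and C="1 / m"])
    show "continuous_on {0..T} (y n)" for n using y by (simp add: L2_approx_def)
    show "H1_norm \<Omega> (rep_l2 (fst a)) \<le> 1 / m * norm a" if "a \<in> W" for a
      using bound[OF W_lift(1)[OF that]] by (simp add: W_lift(2)[OF that])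
    show "H1_norm \<Omega> (rep_l2 (fst a) - rep_l2 (fst b)) \<le> 1 / m * norm (a - b)" if "a \<in> W" "b \<in> W" for a b
      using bound[OF H10_subspace(3)[OF W_lift(1)[OF that(1)] W_lift(1)[OF that(2)]]]
      by (simp add: H10_subspace(6)[OF W_lift(1)[OF that(1)] W_lift(1)[OF that(2)]] W_lift(2) that)
    show "AE t in time_measure T. y' t \<in> W \<and> F t \<in> H10 \<Omega> \<and> H1_norm \<Omega> (F t - rep_l2 (fst (y' t))) = 0"
      using F by eventually_elim (auto simp: W_lift V.zero(2))
  qed (use y m T W W_lift in \<open>auto simp: L2_approx_def\<close>)
qed

end

section \<open>The semilinear problem on a weighted domain\<close>

locale semilinear_domain = weighted_domain \<Omega> b c C
  for \<Omega> :: "(real^'n) set" and b c C +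
  fixes f :: "(real^'n \<Rightarrow> real) \<Rightarrow> real^'n \<Rightarrow> real" and L K T :: real
  assumes f_maps: "u \<in> L2 \<Omega> \<Longrightarrow> f u \<in> L2 \<Omega>"
    and f_lip: "u \<in> L2 \<Omega> \<Longrightarrow> v \<in> L2 \<Omega> \<Longrightarrow> L2_norm \<Omega> (f u - f v) \<le> L * L2_norm \<Omega> (u - v)" and L: "0 \<le> L"
    and f_bound: "u \<in> L2 \<Omega> \<Longrightarrow> L2_norm \<Omega> (f u) \<le> K" and T: "0 < T"
begin

definition F :: "(real^'n) l2 \<Rightarrow> (real^'n) l2" where "F h = ext \<Omega> (f (rep_l2 h))"

lemma L2_norm_diff:
  assumes "u \<in> L2 \<Omega>" "v \<in> L2 \<Omega>" shows "L2_norm \<Omega> (u - v) = norm (ext \<Omega> u - ext \<Omega> v)"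
proof -
  have "u - v = (\<lambda>x. u x - v x)" by (simp add: fun_eq_iff)
  then show ?thesis using assms
    by (simp add: norm_ext[OF meas_\<Omega> L2_diff[OF assms], symmetric] ext_diff[OF meas_\<Omega>])
qed

text \<open>\<open>f\<close> acts on functions. By the Lipschitz bound, arguments at distance zero
  have images at distance zero, so \<open>f\<close> passes to classes.\<close>

lemma F_ext: assumes "u \<in> L2 \<Omega>" shows "F (ext \<Omega> u) = ext \<Omega> (f u)"
proof -
  let ?v = "rep_l2 (ext \<Omega> u)"
  have v: "?v \<in> L2 \<Omega>" by (rule rep_l2_L2[OF meas_\<Omega>])
  have "norm (ext \<Omega> (f ?v) - ext \<Omega> (f u)) \<le> L * norm (ext \<Omega> ?v - ext \<Omega> u)"
    using f_lip[OF v assms] by (simp add: L2_norm_diff f_maps v assms)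
  then show ?thesis by (simp add: F_def ext_rep_ext[OF meas_\<Omega> assms])
qed

sublocale H: semilinear W F L K T
proof
  show "norm (F x - F y) \<le> L * norm (x - y)" for x y
  proof -
    have "norm (F x - F y) \<le> L * norm (ext \<Omega> (rep_l2 x) - ext \<Omega> (rep_l2 y))"
      using f_lip[OF rep_l2_L2[OF meas_\<Omega>] rep_l2_L2[OF meas_\<Omega>], of x y]
      by (simp add: F_def L2_norm_diff f_maps rep_l2_L2[OF meas_\<Omega>])
    also have "\<dots> \<le> L * norm (x - y)" by (intro mult_left_mono norm_ext_rep_diff meas_\<Omega> L)
    finally show ?thesis .
  qed
  show "norm (F x) \<le> K" for x
    using f_bound[OF rep_l2_L2[OF meas_\<Omega>], of x] by (simp add: F_def norm_ext[OF meas_\<Omega>] f_maps rep_l2_L2[OF meas_\<Omega>])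
qed (use subspace_W closed_W L T in auto)

lemma continuous_ext:
  assumes "u \<in> continuous_into T (L2 \<Omega>) (L2_norm \<Omega>)"
  shows "continuous_on {0..T} (\<lambda>t. ext \<Omega> (u t))"
  unfolding continuous_on_def
proof
  fix t assume t: "t \<in> {0..T}"
  have u: "u s \<in> L2 \<Omega>" if "s \<in> {0..T}" for s using assms that by (simp add: continuous_into_def)
  have "((\<lambda>s. L2_norm \<Omega> (u s - u t)) \<longlongrightarrow> 0) (at t within {0..T})" using assms t by (simp add: continuous_into_def)
  then have "((\<lambda>s. norm (ext \<Omega> (u s) - ext \<Omega> (u t))) \<longlongrightarrow> 0) (at t within {0..T})"
    by (rule Lim_transform_eventually) (auto simp: eventually_at_filter L2_norm_diff u t[simplified] intro!: always_eventually)
  then show "((\<lambda>t. ext \<Omega> (u t)) \<longlongrightarrow> ext \<Omega> (u t)) (at t within {0..T})"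
    by (simp add: tendsto_norm_zero_iff LIM_zero_iff)
qed

text \<open>The equation is only kept for test functions in the range of a resolvent, where the
  diffusion form no longer involves the gradient of the solution.\<close>

definition represents :: "(real \<Rightarrow> real^'n \<Rightarrow> real) \<Rightarrow> (real \<Rightarrow> (real^'n) l2) \<Rightarrow> (real^'n \<Rightarrow> real) \<Rightarrow> bool" where
  "represents u v u0 \<longleftrightarrow> continuous_on {0..T} v \<and> v 0 = ext \<Omega> u0 \<and>
    (AE t in time_measure T. u t \<in> H10 \<Omega> \<and> ext \<Omega> (u t) = v t) \<and>
    (\<forall>t\<in>{0..T}. v t \<in> closure (fst ` W)) \<and>
    (\<forall>l>0. \<forall>h. \<forall>t\<in>{0..T}. (v t - v 0) \<bullet> fst (H.Jw l h) =
        integral {0..t} (\<lambda>s. F (v s) \<bullet> fst (H.Jw l h) - v s \<bullet> H.A l h))"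

lemma weak_solution_representative:
  assumes sol: "weak_solution \<Omega> b f T u0 u"
  shows "\<exists>v. represents u v u0"
proof -
  interpret V: seminorm_on "H10 \<Omega>" "H1_norm \<Omega>" by (rule seminorm_H10)
  have S: "{0<..<T} \<in> sets lebesgue" by simp
  obtain w u' where uL2: "u \<in> bochner_L2 (time_measure T) (H10 \<Omega>) (H1_norm \<Omega>)"
    and weak: "weak_time_derivative T (Vdual \<Omega>) (Vdual_norm \<Omega>) (\<lambda>t. H_to_Vdual \<Omega> (u t)) w"
    and eq: "AE t in time_measure T. \<forall>v\<in>H10 \<Omega>. (w t + diffusion_operator \<Omega> b (u t)) v = H_to_Vdual \<Omega> (f (u t)) v"
    and u': "u' \<in> continuous_into T (L2 \<Omega>) (L2_norm \<Omega>)" "AE t in time_measure T. equal_ae \<Omega> (u t) (u' t)"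
      "equal_ae \<Omega> (u' 0) u0"
    using sol unfolding weak_solution_def by blast
  define v where "v = (\<lambda>t. ext \<Omega> (u' t))"
  have u'L2: "u' t \<in> L2 \<Omega>" if "t \<in> {0..T}" for t using u'(1) that by (simp add: continuous_into_def)
  have cont: "continuous_on {0..T} v" unfolding v_def by (rule continuous_ext[OF u'(1)])
  have AE_space: "AE t in time_measure T. t \<in> {0..T}" by (rule AE_I2) simp
  have "AE t in time_measure T. u t \<in> H10 \<Omega>"
    using uL2 unfolding bochner_L2_def strongly_measurable_def by auto
  with u'(2) AE_space have rep: "AE t in time_measure T. u t \<in> H10 \<Omega> \<and> ext \<Omega> (u t) = v t"
  proof eventually_elim
    case (elim t)
    then have "ext \<Omega> (u t) = ext \<Omega> (u' t)"
      by (subst ext_eq_iff[OF meas_\<Omega>]) (auto simp: equal_ae_def u'L2 H1_L2 H10_graph(1))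
    with elim show ?case by (simp add: v_def)
  qed
  \<comment> \<open>Square integrability of \<open>u0\<close> on the domain is derived here from its
    agreement with \<open>u' 0\<close> almost everywhere, measurability coming from completeness of
    the measure.\<close>
  have "v 0 = ext \<Omega> u0"
  proof -
    have "AE x in lebesgue_on \<Omega>. u' 0 x = u0 x" using u'(3) by (simp add: equal_ae_def)
    then have "AE x in lebesgue. x \<in> \<Omega> \<longrightarrow> u' 0 x = u0 x" using meas_\<Omega> by (simp add: AE_restrict_space_iff)
    then have *: "AE x in lebesgue. (if x \<in> \<Omega> then u' 0 x else 0) = (if x \<in> \<Omega> then u0 x else 0)"
      by eventually_elim simp
    have L2: "(\<lambda>x. if x \<in> \<Omega> then u' 0 x else 0) \<in> L2 UNIV" using L2_ext[OF meas_\<Omega> u'L2[of 0]] T by simp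
    have "(\<lambda>x. if x \<in> \<Omega> then u0 x else 0) \<in> L2 UNIV"
      using L2_cong_AE[OF L2, unfolded lebesgue_on_UNIV_eq, OF * borel_measurable_AE[OF _ *]] L2_measurable[OF L2]
      by (simp add: lebesgue_on_UNIV_eq)
    then show ?thesis
      unfolding v_def ext_def using abs_l2_eq_iff[OF L2] * unfolding lebesgue_on_UNIV_eq by blast
  qed
  moreover have "v t \<in> closure (fst ` W)" if "t \<in> {0..T}" for t
    unfolding v_def by (rule ext_in_closure_W[OF u'L2[OF that]])
  moreover have "(v t - v 0) \<bullet> fst (H.Jw l h) = integral {0..t} (\<lambda>s. F (v s) \<bullet> fst (H.Jw l h) - v s \<bullet> H.A l h)"
    if l: "0 < l" and t: "t \<in> {0..T}" for l h t
  proof -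
    \<comment> \<open>The function of V whose graph is the resolvent vector; it is the test function
      put into the equation.\<close>
    define \<zeta> where "\<zeta> = rep_l2 (fst (H.Jw l h))"
    have \<zeta>: "\<zeta> \<in> H10 \<Omega>" "graph \<zeta> = H.Jw l h" unfolding \<zeta>_def using W_lift[OF H.Jw_mem[OF l]] by auto
    define k where "k = (\<lambda>s. F (v s) \<bullet> fst (H.Jw l h) - v s \<bullet> H.A l h)"
    have contk: "continuous_on {0..T} k" unfolding k_def
      by (intro continuous_intros cont continuous_on_compose2[OF H.continuous_F cont]) auto
    have contg: "continuous_on {0..T} (\<lambda>s. v s \<bullet> fst (H.Jw l h))" by (intro continuous_intros cont)
    have wk: "AE s in time_measure T. H_to_Vdual \<Omega> (u s) \<zeta> = v s \<bullet> fst (H.Jw l h) \<and> w s \<zeta> = k s"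
      using rep eq
    proof eventually_elim
      case (elim s)
      have us: "u s \<in> L2 \<Omega>" using elim by (simp add: H1_L2 H10_graph(1))
      have gu: "graph (u s) \<in> W" "fst (graph (u s)) = v s" 
        using elim H10_graph(2) by simp (simp add: graph_def elim)
      have "w s \<zeta> = H_to_Vdual \<Omega> (f (u s)) \<zeta> - diffusion_operator \<Omega> b (u s) \<zeta>" using elim \<zeta>(1) by force
      also have "H_to_Vdual \<Omega> (f (u s)) \<zeta> = F (v s) \<bullet> fst (H.Jw l h)"
        using F_ext[OF us] elim by (simp add: H_to_Vdual_eq f_maps us \<zeta> functional_def inner_prod_def)
      also have "diffusion_operator \<Omega> b (u s) \<zeta> = snd (H.Jw l h) \<bullet> snd (graph (u s))"
        using elim by (simp add: diffusion_functional \<zeta> functional_def inner_prod_def inner_commute)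
      \<comment> \<open>Here the gradient of the solution disappears: the form of a function and a
        resolvent is the inner product of that function with the Yosida term.\<close>
      also have "\<dots> = v s \<bullet> H.A l h" using H.A_weak[OF l gu(1), of h] gu(2) by (simp add: inner_commute)
      finally have "w s \<zeta> = k s" by (simp add: k_def)
      moreover have "H_to_Vdual \<Omega> (u s) \<zeta> = v s \<bullet> fst (H.Jw l h)"
        using elim by (simp add: H_to_Vdual_eq us \<zeta> functional_def inner_prod_def)
      ultimately show ?case by simp
    qed
    have "v t \<bullet> fst (H.Jw l h) - v 0 \<bullet> fst (H.Jw l h) = integral {0..t} k"
    proof (rule distributional_derivative_imp_integral[OF T contg contk _ t])
      fix \<phi> assume \<phi>: "\<phi> \<in> test_functions {0<..<T}"
      obtain I where I: "has_bochner_integral_in (time_measure T) (Vdual \<Omega>) (Vdual_norm \<Omega>) (\<lambda>t. deriv \<phi> t *\<^sub>R H_to_Vdual \<Omega> (u t)) I"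
        "has_bochner_integral_in (time_measure T) (Vdual \<Omega>) (Vdual_norm \<Omega>) (\<lambda>t. \<phi> t *\<^sub>R w t) (- I)"
        using weak \<phi> unfolding weak_time_derivative_def by blast
      note I1 = V.has_bochner_integral_in_eval[OF S I(1) \<zeta>(1)] and I2 = V.has_bochner_integral_in_eval[OF S I(2) \<zeta>(1)]
      have "(\<integral>t. deriv \<phi> t * (v t \<bullet> fst (H.Jw l h)) \<partial>time_measure T) = (\<integral>t. (deriv \<phi> t *\<^sub>R H_to_Vdual \<Omega> (u t)) \<zeta> \<partial>time_measure T)"
      proof (rule integral_cong_AE)
        show "(\<lambda>t. deriv \<phi> t * (v t \<bullet> fst (H.Jw l h))) \<in> borel_measurable (time_measure T)"
          by (intro continuous_measurable_time continuous_intros contg test_function_continuous[OF test_function_deriv(2)[OF \<phi>]])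
        show "AE t in time_measure T. deriv \<phi> t * (v t \<bullet> fst (H.Jw l h)) = (deriv \<phi> t *\<^sub>R H_to_Vdual \<Omega> (u t)) \<zeta>"
          using wk by eventually_elim (simp add: scaleR_fun_def)
      qed (use I1 in \<open>auto dest: borel_measurable_has_bochner_integral\<close>)
      also have "\<dots> = I \<zeta>" using I1 by (rule has_bochner_integral_integral_eq)
      also have "I \<zeta> = - (\<integral>t. (\<phi> t *\<^sub>R w t) \<zeta> \<partial>time_measure T)" using has_bochner_integral_integral_eq[OF I2] by simp
      also have "(\<integral>t. (\<phi> t *\<^sub>R w t) \<zeta> \<partial>time_measure T) = (\<integral>t. \<phi> t * k t \<partial>time_measure T)"
      proof (rule integral_cong_AE)
        show "(\<lambda>t. \<phi> t * k t) \<in> borel_measurable (time_measure T)"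
          by (intro continuous_measurable_time continuous_intros contk test_function_continuous[OF \<phi>])
        show "AE t in time_measure T. (\<phi> t *\<^sub>R w t) \<zeta> = \<phi> t * k t"
          using wk by eventually_elim (simp add: scaleR_fun_def)
      qed (use I2 in \<open>auto dest: borel_measurable_has_bochner_integral\<close>)
      finally show "(\<integral>t. deriv \<phi> t * (v t \<bullet> fst (H.Jw l h)) \<partial>time_measure T) = - (\<integral>t. \<phi> t * k t \<partial>time_measure T)" .
    qed
    then show ?thesis by (simp add: inner_diff_left k_def)
  qed
  ultimately show ?thesis unfolding represents_def using cont rep by blast
qed

text \<open>The approximate solutions converge uniformly in H, to \<open>z\<close>, and their lifts
  in L2 of time, to \<open>y\<close>. Since \<open>y\<close> lifts \<open>z\<close> at almost every
  time, \<open>z\<close> takes values in V there and \<open>y\<close> provides its gradient.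
  Integration by parts for the approximations passes to the limit and identifies the time
  derivative.\<close>

lemma weak_solution_exists:
  assumes u0: "u0 \<in> L2 \<Omega>"
  shows "\<exists>u. weak_solution \<Omega> b f T u0 u \<and> u \<in> continuous_into T (L2 \<Omega>) (L2_norm \<Omega>)"
proof -
  let ?M = "time_measure T"
  have S: "{0<..<T} \<in> sets lebesgue" by simp
  have AE_space: "AE t in ?M. t \<in> {0..T}" by (rule AE_I2) simp
  obtain v w d where approx: "H.approximates v w d (ext \<Omega> u0)"
    using H.approximate_solutions_exist[OF ext_in_closure_W[OF u0]] by blast
  have contw: "continuous_on {0..T} (w n)" and wW: "t \<in> {0..T} \<Longrightarrow> w n t \<in> W" and contd: "continuous_on {0..T} (d n)"
    and derv: "t \<in> {0..T} \<Longrightarrow> (v n has_vector_derivative d n t) (at t within {0..T})"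
    and deq: "t \<in> {0..T} \<Longrightarrow> y \<in> W \<Longrightarrow> d n t \<bullet> fst y = F (v n t) \<bullet> fst y - snd (w n t) \<bullet> snd y"
    and v0: "(\<lambda>n. v n 0) \<longlonglongrightarrow> ext \<Omega> u0"
    and vC: "e > 0 \<Longrightarrow> \<exists>N. \<forall>m\<ge>N. \<forall>n\<ge>N. \<forall>t\<in>{0..T}. (norm (v m t - v n t))\<^sup>2 \<le> e"
    and wC: "e > 0 \<Longrightarrow> \<exists>N. \<forall>m\<ge>N. \<forall>n\<ge>N. integral {0..T} (\<lambda>t. (norm (w m t - w n t))\<^sup>2) \<le> e"
    and vw: "(\<lambda>n. integral {0..T} (\<lambda>t. (norm (fst (w n t) - v n t))\<^sup>2)) \<longlonglongrightarrow> 0" for n t y e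
    using approx unfolding H.approximates_def by blast+
  have contv: "continuous_on {0..T} (v n)" for n
    using derv has_vector_derivative_continuous continuous_on_eq_continuous_within by blast
  have "uniformly_Cauchy_on {0..T} v"
    unfolding uniformly_Cauchy_on_def
  proof (intro allI impI)
    fix e :: real assume e: "e > 0"
    obtain N where N: "\<And>m n t. m \<ge> N \<Longrightarrow> n \<ge> N \<Longrightarrow> t \<in> {0..T} \<Longrightarrow> (norm (v m t - v n t))\<^sup>2 \<le> (e/2)\<^sup>2"
      using vC[of "(e/2)\<^sup>2"] e by (meson half_gt_zero zero_less_power)
    have "dist (v m t) (v n t) < e" if "m \<ge> N" "n \<ge> N" "t \<in> {0..T}" for m n t
    proof -
      have "norm (v m t - v n t) \<le> e / 2" by (rule power2_le_imp_le[OF N[OF that]]) (use e in simp)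
      then show ?thesis using e by (simp add: dist_norm)
    qed
    then show "\<exists>M. \<forall>x\<in>{0..T}. \<forall>m\<ge>M. \<forall>n\<ge>M. dist (v m x) (v n x) < e" by blast
  qed
  then obtain z where z: "uniform_limit {0..T} v z sequentially"
    using Cauchy_uniformly_convergent uniformly_convergent_on_def by blast
  have contz: "continuous_on {0..T} z" by (rule uniform_limit_theorem[OF _ z]) (auto simp: contv)
  have vz: "(\<lambda>n. v n t) \<longlonglongrightarrow> z t" if "t \<in> {0..T}" for t by (rule tendsto_uniform_limitI[OF z that])
  have z0: "z 0 = ext \<Omega> u0" by (rule LIMSEQ_unique[OF vz v0]) (use T in simp)
  have vzL2: "(\<lambda>n. \<integral>\<^sup>+t. ennreal ((norm (v n t - z t))\<^sup>2) \<partial>?M) \<longlonglongrightarrow> 0"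
  proof (rule order_tendstoI)
    fix a :: ennreal assume "0 < a"
    then obtain e where e: "e > 0" "ennreal e \<le> a"
    proof (cases a)
      case (real r) then show ?thesis using \<open>0 < a\<close> by (intro that[of r]) auto
    qed (auto intro: that[of 1])
    define \<eta> where "\<eta> = sqrt (e / (2 * T))"
    have \<eta>: "\<eta> > 0" "\<eta>\<^sup>2 * T = e / 2" using e T by (auto simp: \<eta>_def field_simps)
    have "\<forall>\<^sub>F n in sequentially. \<forall>t\<in>{0..T}. dist (v n t) (z t) < \<eta>"
      using z \<eta>(1) by (rule uniform_limitD)
    then show "\<forall>\<^sub>F n in sequentially. (\<integral>\<^sup>+t. ennreal ((norm (v n t - z t))\<^sup>2) \<partial>?M) < a"
    proof eventually_elim
      case (elim n)
      have "(\<integral>\<^sup>+t. ennreal ((norm (v n t - z t))\<^sup>2) \<partial>?M) \<le> (\<integral>\<^sup>+t. ennreal (\<eta>\<^sup>2) \<partial>?M)"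
        using elim by (intro nn_integral_mono ennreal_leI power_mono) (auto simp: dist_norm intro: less_imp_le)
      also have "\<dots> = ennreal (\<eta>\<^sup>2 * T)" using T by (simp add: emeasure_restrict_space ennreal_mult)
      also have "\<dots> = ennreal (e / 2)" by (simp only: \<eta>(2))
      also have "\<dots> < ennreal e" using e by (intro ennreal_lessI) auto
      finally show ?case using e(2) by (rule order_less_le_trans)
    qed
  qed simp
  have sqw: "(\<integral>\<^sup>+t. ennreal ((norm (w m t - w n t))\<^sup>2) \<partial>?M) = ennreal (integral {0..T} (\<lambda>t. (norm (w m t - w n t))\<^sup>2))" for m n
    by (intro continuous_nn_integral_time continuous_intros contw) simp
  have "\<exists>h r. strict_mono (r :: nat \<Rightarrow> nat) \<and> (AE t in ?M. (\<lambda>k. w (r k) t) \<longlonglongrightarrow> h t) \<and>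
    (\<forall>e>0. \<exists>N. \<forall>n\<ge>N. (\<integral>\<^sup>+t. ennreal ((norm (w n t - h t))\<^sup>2) \<partial>?M) \<le> ennreal e)"
  proof (rule L2_Cauchy_imp_limit)
    show "(\<lambda>t. norm (w m t - w n t)) \<in> borel_measurable ?M" for m n
      by (intro continuous_measurable_time continuous_intros contw)
    show "\<exists>N. \<forall>m\<ge>N. \<forall>n\<ge>N. (\<integral>\<^sup>+t. ennreal ((norm (w m t - w n t))\<^sup>2) \<partial>?M) \<le> ennreal e" if "e > 0" for e
      unfolding sqw using wC[OF that] ennreal_leI by meson
  qed
  then obtain y and r :: "nat \<Rightarrow> nat" where r: "strict_mono r" and wy: "AE t in ?M. (\<lambda>k. w (r k) t) \<longlonglongrightarrow> y t"
    and wyL2: "\<And>e. e > 0 \<Longrightarrow> \<exists>N. \<forall>n\<ge>N. (\<integral>\<^sup>+t. ennreal ((norm (w n t - y t))\<^sup>2) \<partial>?M) \<le> ennreal e" by blast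
  have "(\<lambda>n. \<integral>\<^sup>+t. ennreal ((norm (w n t - y t))\<^sup>2) \<partial>?M) \<longlonglongrightarrow> 0"
  proof (rule order_tendstoI)
    fix a :: ennreal assume "0 < a"
    then obtain e where e: "e > 0" "ennreal e < a"
      using dense[OF \<open>0 < a\<close>] by (metis ennreal_cases ennreal_less_zero_iff less_top not_less_iff_gr_or_eq top_greatest leD)
    then show "\<forall>\<^sub>F n in sequentially. (\<integral>\<^sup>+t. ennreal ((norm (w n t - y t))\<^sup>2) \<partial>?M) < a"
      using wyL2[OF e(1)] by (auto simp: eventually_sequentially dest: order_le_less_trans)
  qed simp
  then have apw: "L2_approx T (\<lambda>n. w (r n)) y"
    using contw wy LIMSEQ_subseq_LIMSEQ[OF _ r, of "\<lambda>n. \<integral>\<^sup>+t. ennreal ((norm (w n t - y t))\<^sup>2) \<partial>?M"]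
    by (simp add: L2_approx_def o_def)
  have apv: "L2_approx T (\<lambda>n. v (r n)) z"
    unfolding L2_approx_def
  proof (intro conjI allI contv)
    show "AE t in ?M. (\<lambda>n. v (r n) t) \<longlonglongrightarrow> z t"
      using AE_space by eventually_elim (rule LIMSEQ_subseq_LIMSEQ[OF vz r, unfolded o_def])
    show "(\<lambda>n. \<integral>\<^sup>+t. ennreal ((norm (v (r n) t - z t))\<^sup>2) \<partial>?M) \<longlonglongrightarrow> 0"
      using LIMSEQ_subseq_LIMSEQ[OF vzL2 r] by (simp add: o_def)
  qed
  have yW: "AE t in ?M. y t \<in> W"
    using wy AE_space by eventually_elim (meson closed_W closed_sequentially wW)
  \<comment> \<open>By Fatou's lemma the L2 distance of \<open>fst y\<close> and \<open>z\<close> is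
    at most the limit of the distances of \<open>fst (w n)\<close> and \<open>v n\<close>, which is
    0.\<close>
  have "AE t in ?M. fst (y t) = z t"
  proof -
    have apd: "L2_approx T (\<lambda>n t. fst (w (r n) t) - v (r n) t) (\<lambda>t. fst (y t) - z t)"
    proof -
      have "L2_approx T (\<lambda>n t. (\<lambda>p. fst (fst p) - snd p) (w (r n) t, v (r n) t)) (\<lambda>t. (\<lambda>p. fst (fst p) - snd p) (y t, z t))"
      proof (rule L2_approx_lipschitz[OF L2_approx_Pair[OF apw apv], where C=2])
        show "norm ((fst (fst p) - snd p) - (fst (fst q) - snd q)) \<le> 2 * norm (p - q)" for p q :: "((real^'n) l2 \<times> ((real^'n) l2 ^ 'n)) \<times> (real^'n) l2"
        proof -
          have "norm ((fst (fst p) - snd p) - (fst (fst q) - snd q)) = norm (fst (fst (p - q)) - snd (p - q))" by (simp add: algebra_simps)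
          also have "\<dots> \<le> norm (fst (fst (p - q))) + norm (snd (p - q))" by (rule norm_triangle_ineq4)
          also have "\<dots> \<le> norm (p - q) + norm (p - q)"
            by (intro add_mono norm_snd_proj_le order_trans[OF norm_fst_proj_le norm_fst_proj_le])
          finally show ?thesis by simp
        qed
      qed (auto intro!: continuous_intros contw contv)
      then show ?thesis by simp
    qed
    have AEl: "AE t in ?M. ennreal ((norm (fst (y t) - z t))\<^sup>2) = liminf (\<lambda>n. ennreal ((norm (fst (w (r n) t) - v (r n) t))\<^sup>2))"
      using apd[unfolded L2_approx_def, THEN conjunct2, THEN conjunct1]
    proof eventually_elim
      case (elim t)
      then have "(\<lambda>n. ennreal ((norm (fst (w (r n) t) - v (r n) t))\<^sup>2)) \<longlonglongrightarrow> ennreal ((norm (fst (y t) - z t))\<^sup>2)"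
        by (intro tendsto_ennrealI tendsto_power tendsto_norm)
      from lim_imp_Liminf[OF _ this] show ?case by simp
    qed
    have m: "(\<lambda>t. ennreal ((norm (fst (w (r n) t) - v (r n) t))\<^sup>2)) \<in> borel_measurable ?M" for n
      by (intro measurable_compose[OF _ measurable_ennreal] continuous_measurable_time continuous_intros contw contv)
    have "(\<integral>\<^sup>+t. ennreal ((norm (fst (y t) - z t))\<^sup>2) \<partial>?M) = (\<integral>\<^sup>+t. liminf (\<lambda>n. ennreal ((norm (fst (w (r n) t) - v (r n) t))\<^sup>2)) \<partial>?M)"
      by (rule nn_integral_cong_AE[OF AEl])
    also have "\<dots> \<le> liminf (\<lambda>n. \<integral>\<^sup>+t. ennreal ((norm (fst (w (r n) t) - v (r n) t))\<^sup>2) \<partial>?M)"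
      by (rule nn_integral_liminf) (rule m)
    also have "\<dots> = 0"
    proof -
      have "(\<integral>\<^sup>+t. ennreal ((norm (fst (w n t) - v n t))\<^sup>2) \<partial>?M) = ennreal (integral {0..T} (\<lambda>t. (norm (fst (w n t) - v n t))\<^sup>2))" for n
        by (intro continuous_nn_integral_time continuous_intros contw contv) simp
      then have "(\<lambda>n. \<integral>\<^sup>+t. ennreal ((norm (fst (w n t) - v n t))\<^sup>2) \<partial>?M) \<longlonglongrightarrow> 0"
        using tendsto_ennrealI[OF vw] by simp
      from lim_imp_Liminf[OF _ LIMSEQ_subseq_LIMSEQ[OF this r]] show ?thesis by (simp add: o_def)
    qed
    finally have z: "(\<integral>\<^sup>+t. liminf (\<lambda>n. ennreal ((norm (fst (w (r n) t) - v (r n) t))\<^sup>2)) \<partial>?M) = 0"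
      using nn_integral_cong_AE[OF AEl] by simp
    have "AE t in ?M. liminf (\<lambda>n. ennreal ((norm (fst (w (r n) t) - v (r n) t))\<^sup>2)) = 0"
      using z by (subst (asm) nn_integral_0_iff_AE) (auto intro!: borel_measurable_liminf m)
    with AEl show ?thesis by eventually_elim simp
  qed
  then have yz: "AE t in ?M. y t \<in> W \<and> fst (y t) = z t" using yW by eventually_elim simp
  have zcl: "z t \<in> closure (fst ` W)" if "t \<in> {0..T}" for t
  proof (rule AE_closed_imp_everywhere[OF contz _ _ T that])
    show "AE t in ?M. z t \<in> closure (fst ` W)"
      using yz by eventually_elim (metis closure_subset image_eqI subsetD)
  qed simp
  \<comment> \<open>A representative is chosen at every time, so that u itself is continuous into L2
    and no adjustment on a null set of times remains.\<close>
  define u where "u = (\<lambda>t. rep_l2 (z t))"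
  have uL2: "u t \<in> L2 \<Omega>" for t unfolding u_def by (rule rep_l2_L2[OF meas_\<Omega>])
  have eu: "ext \<Omega> (u t) = z t" if "t \<in> {0..T}" for t unfolding u_def by (rule closure_W_ext_rep[OF zcl[OF that]])
  have uinto: "u \<in> continuous_into T (L2 \<Omega>) (L2_norm \<Omega>)"
    unfolding continuous_into_def
  proof (intro CollectI ballI conjI uL2)
    fix t assume t: "t \<in> {0..T}"
    have "((\<lambda>s. norm (z s - z t)) \<longlongrightarrow> 0) (at t within {0..T})"
      using contz t by (simp add: continuous_on_def tendsto_norm_zero_iff LIM_zero_iff)
    then show "((\<lambda>s. L2_norm \<Omega> (u s - u t)) \<longlongrightarrow> 0) (at t within {0..T})"
      by (rule Lim_transform_eventually) (auto simp: eventually_at_filter L2_norm_diff uL2 eu t[simplified] intro!: always_eventually)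
  qed
  have uH: "AE t in ?M. u t \<in> H10 \<Omega> \<and> graph (u t) = y t \<and> t \<in> {0..T}"
    using yz AE_space
  proof eventually_elim
    case (elim t) then show ?case using W_lift[of "y t"] by (simp add: u_def)
  qed
  \<comment> \<open>The vector representing f(u) - A u, the candidate for the time
    derivative.\<close>
  define Z where "Z = (\<lambda>t. (F (z t), - snd (y t)))"
  have apZ: "L2_approx T (\<lambda>n t. (F (v (r n) t), - snd (w (r n) t))) Z"
    unfolding Z_def
  proof (rule L2_approx_Pair)
    have cF: "continuous_on {0..T} (\<lambda>t. F (v (r n) t))" for n
      by (rule continuous_on_compose2[OF H.continuous_F contv]) simp
    show "L2_approx T (\<lambda>n t. F (v (r n) t)) (\<lambda>t. F (z t))"
      by (rule L2_approx_lipschitz[OF apv cF L H.F_lip])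
    show "L2_approx T (\<lambda>n t. - snd (w (r n) t)) (\<lambda>t. - snd (y t))"
    proof (rule L2_approx_lipschitz[OF apw, where C=1])
      show "norm (- snd a - - snd b) \<le> 1 * norm (a - b)" for a b :: "(real^'n) l2 \<times> ((real^'n) l2 ^ 'n)"
        using norm_snd_proj_le[of "a - b"] by (simp add: norm_minus_commute)
    qed (auto intro!: continuous_intros contw)
  qed
  have apU: "L2_approx T (\<lambda>n t. (v (r n) t, 0)) (\<lambda>t. (z t, 0 :: (real^'n) l2 ^ 'n))"
    by (rule L2_approx_lipschitz[OF apv, where C=1]) (auto intro!: continuous_intros contv simp: norm_Pair)
  define \<omega> where "\<omega> = (\<lambda>t. functional (Z t))"
  have "weak_time_derivative T (Vdual \<Omega>) (Vdual_norm \<Omega>) (\<lambda>t. H_to_Vdual \<Omega> (u t)) \<omega>"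
    unfolding weak_time_derivative_def
  proof
    fix \<phi> assume \<phi>: "\<phi> \<in> test_functions {0<..<T}"
    have scaled: "L2_approx T (\<lambda>n t. \<psi> t *\<^sub>R x n t) (\<lambda>t. \<psi> t *\<^sub>R x' t)"
      if x: "L2_approx T x x'" and \<psi>: "\<psi> \<in> test_functions {0<..<T}"
      for \<psi> and x :: "nat \<Rightarrow> real \<Rightarrow> (real^'n) l2 \<times> ((real^'n) l2 ^ 'n)" and x'
    proof -
      obtain B where B: "\<And>t. \<bar>\<psi> t\<bar> \<le> B" "0 \<le> B" using test_function_bounded[OF \<psi>] by metis
      show ?thesis
      proof (rule L2_approx_lipschitz[OF x _ B(2)])
        show "continuous_on {0..T} (\<lambda>t. \<psi> t *\<^sub>R x n t)" for n
          using x by (intro continuous_intros test_function_continuous[OF \<psi>]) (auto simp: L2_approx_def)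
        show "norm (\<psi> t *\<^sub>R a - \<psi> t *\<^sub>R b) \<le> B * norm (a - b)" for t a b
          by (simp add: scaleR_diff_right[symmetric] mult_right_mono B)
      qed
    qed
    note \<phi>' = test_function_deriv(2)[OF \<phi>]
    \<comment> \<open>The common value of the two integrals in the weak derivative, up to sign;
      integration by parts for the differentiable approximations matches the second integral with
      it.\<close>
    define I where "I = (\<lambda>g. \<integral>t. (deriv \<phi> t *\<^sub>R (z t, 0)) \<bullet> graph g \<partial>?M)"
    have "(\<integral>t. (\<phi> t *\<^sub>R Z t) \<bullet> graph g \<partial>?M) = - I g" if g: "g \<in> H10 \<Omega>" for g
    proof -
      note gW = H10_graph(2)[OF g]
      have "(\<integral>t. (deriv \<phi> t *\<^sub>R (v (r n) t, 0)) \<bullet> graph g \<partial>?M) = - (\<integral>t. (\<phi> t *\<^sub>R (F (v (r n) t), - snd (w (r n) t))) \<bullet> graph g \<partial>?M)" for n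
      proof -
        have der: "((\<lambda>t. v (r n) t \<bullet> fst (graph g)) has_real_derivative d (r n) t \<bullet> fst (graph g)) (at t within {0..T})" if "t \<in> {0..T}" for t
          using has_real_derivative_inner[OF derv[OF that] has_vector_derivative_const] by simp
        have "(\<integral>t. deriv \<phi> t * (v (r n) t \<bullet> fst (graph g)) \<partial>?M) = - (\<integral>t. \<phi> t * (d (r n) t \<bullet> fst (graph g)) \<partial>?M)"
          by (rule integration_by_parts_time[OF \<phi> T der]) (auto intro!: continuous_intros contd)
        moreover have "(\<integral>t. \<phi> t * (d (r n) t \<bullet> fst (graph g)) \<partial>?M) = (\<integral>t. (\<phi> t *\<^sub>R (F (v (r n) t), - snd (w (r n) t))) \<bullet> graph g \<partial>?M)"
          by (rule Bochner_Integration.integral_cong[OF refl]) (simp add: deq[OF _ gW] inner_prod_def right_diff_distrib)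
        moreover have "(\<integral>t. deriv \<phi> t * (v (r n) t \<bullet> fst (graph g)) \<partial>?M) = (\<integral>t. (deriv \<phi> t *\<^sub>R (v (r n) t, 0)) \<bullet> graph g \<partial>?M)"
          by (simp add: inner_prod_def)
        ultimately show ?thesis by simp
      qed
      moreover have "(\<lambda>n. \<integral>t. (deriv \<phi> t *\<^sub>R (v (r n) t, 0)) \<bullet> graph g \<partial>?M) \<longlonglongrightarrow> I g"
        unfolding I_def by (rule L2_approx_inner[OF scaled[OF apU \<phi>'] T])
      moreover have "(\<lambda>n. - (\<integral>t. (\<phi> t *\<^sub>R (F (v (r n) t), - snd (w (r n) t))) \<bullet> graph g \<partial>?M)) \<longlonglongrightarrow> - (\<integral>t. (\<phi> t *\<^sub>R Z t) \<bullet> graph g \<partial>?M)"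
        by (intro tendsto_minus L2_approx_inner[OF scaled[OF apZ \<phi>] T])
      ultimately have "I g = - (\<integral>t. (\<phi> t *\<^sub>R Z t) \<bullet> graph g \<partial>?M)" using LIMSEQ_unique by simp
      then show ?thesis by simp
    qed
    then have neg: "(- I) g = (\<integral>t. (\<phi> t *\<^sub>R Z t) \<bullet> graph g \<partial>?M)" if "g \<in> H10 \<Omega>" for g using that by simp
    show "\<exists>I. has_bochner_integral_in ?M (Vdual \<Omega>) (Vdual_norm \<Omega>) (\<lambda>t. deriv \<phi> t *\<^sub>R H_to_Vdual \<Omega> (u t)) I \<and>
        has_bochner_integral_in ?M (Vdual \<Omega>) (Vdual_norm \<Omega>) (\<lambda>t. \<phi> t *\<^sub>R \<omega> t) (- I)"
    proof (intro exI[of _ I] conjI)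
      show "has_bochner_integral_in ?M (Vdual \<Omega>) (Vdual_norm \<Omega>) (\<lambda>t. deriv \<phi> t *\<^sub>R H_to_Vdual \<Omega> (u t)) I"
      proof (rule L2_approx_dual(2)[OF scaled[OF apU \<phi>'] T])
        show "AE t in ?M. \<forall>g\<in>H10 \<Omega>. (deriv \<phi> t *\<^sub>R H_to_Vdual \<Omega> (u t)) g = functional (deriv \<phi> t *\<^sub>R (z t, 0)) g"
          using AE_space by eventually_elim (simp add: scaleR_fun_def H_to_Vdual_eq uL2 eu functional_def inner_prod_def)
      qed (simp add: I_def)
      show "has_bochner_integral_in ?M (Vdual \<Omega>) (Vdual_norm \<Omega>) (\<lambda>t. \<phi> t *\<^sub>R \<omega> t) (- I)"
        by (rule L2_approx_dual(2)[OF scaled[OF apZ \<phi>] T _ neg])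
          (simp add: scaleR_fun_def \<omega>_def functional_def)
    qed
  qed
  moreover have "\<omega> \<in> bochner_L2 ?M (Vdual \<Omega>) (Vdual_norm \<Omega>)"
    by (rule L2_approx_dual(1)[OF apZ T]) (simp add: \<omega>_def)
  moreover have "AE t in ?M. \<forall>g\<in>H10 \<Omega>. (\<omega> t + diffusion_operator \<Omega> b (u t)) g = H_to_Vdual \<Omega> (f (u t)) g"
    using uH
  proof eventually_elim
    case (elim t)
    then have "F (z t) = ext \<Omega> (f (u t))" using F_ext[OF uL2, of t] eu[of t] by simp
    with elim show ?case
      by (auto simp: \<omega>_def Z_def diffusion_functional H_to_Vdual_eq f_maps uL2 functional_def inner_prod_def)
  qed
  moreover have "u \<in> bochner_L2 ?M (H10 \<Omega>) (H1_norm \<Omega>)"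
  proof (rule L2_approx_H10[OF apw T wW])
    show "AE t in ?M. y t \<in> W \<and> u t = rep_l2 (fst (y t))" using yz by eventually_elim (simp add: u_def)
  qed
  moreover have "equal_ae \<Omega> (u 0) u0"
    using ext_eq_iff[OF meas_\<Omega> uL2 u0, of 0] eu[of 0] z0 T by (simp add: equal_ae_def)
  moreover have "AE t in ?M. equal_ae \<Omega> (u t) (u t)" by (simp add: equal_ae_def)
  ultimately have "weak_solution \<Omega> b f T u0 u" unfolding weak_solution_def using uinto by blast
  with uinto show ?thesis by blast
qed

section \<open>Uniqueness and continuous dependence on the initial value\<close>

lemma represents_stable:
  assumes v: "represents u v u0" and v': "represents u' v' u0'" and t: "t \<in> {0..T}"
  shows "norm (v t - v' t) \<le> exp (L * T) * norm (ext \<Omega> u0 - ext \<Omega> u0')"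
proof -
  have "(norm (v t - v' t))\<^sup>2 \<le> exp (2 * L * T) * (norm (v 0 - v' 0))\<^sup>2"
    using v v' unfolding represents_def by (intro H.weak_solutions_stable[OF _ _ _ _ _ _ t]) blast+
  also have "\<dots> = (exp (L * T) * norm (v 0 - v' 0))\<^sup>2"
    by (simp add: power_mult_distrib exp_double[symmetric] mult.assoc)
  finally have "norm (v t - v' t) \<le> exp (L * T) * norm (v 0 - v' 0)" by (rule power2_le_imp_le) simp
  then show ?thesis using v v' by (simp add: represents_def)
qed

lemma weak_solution_unique:
  assumes "weak_solution \<Omega> b f T u0 u" "weak_solution \<Omega> b f T u0 u'"
  shows "AE t in time_measure T. equal_ae \<Omega> (u t) (u' t)"
proof -
  obtain v v' where v: "represents u v u0" and v': "represents u' v' u0"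
    using assms weak_solution_representative by meson
  have "AE t in time_measure T. t \<in> {0..T}" by (rule AE_I2) simp
  moreover have "AE t in time_measure T. u t \<in> H10 \<Omega> \<and> ext \<Omega> (u t) = v t"
    "AE t in time_measure T. u' t \<in> H10 \<Omega> \<and> ext \<Omega> (u' t) = v' t"
    using v v' by (simp_all add: represents_def)
  ultimately show ?thesis
  proof eventually_elim
    case (elim t)
    then show ?case
      using represents_stable[OF v v' elim(1)] ext_eq_iff[OF meas_\<Omega>, of "u t" "u' t"]
      by (simp add: equal_ae_def H1_L2 H10_graph(1))
  qed
qed

text \<open>Continuous functions of time that agree almost everywhere agree at every time.
  Continuous dependence at a single time rests on this.\<close>

lemma represents_everywhere:
  assumes v: "represents u v u0" and u: "u \<in> continuous_into T (L2 \<Omega>) (L2_norm \<Omega>)" and t: "t \<in> {0..T}"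
  shows "ext \<Omega> (u t) = v t"
proof -
  have "ext \<Omega> (u t) - v t \<in> {0}"
  proof (rule AE_closed_imp_everywhere[OF _ _ _ T t])
    show "continuous_on {0..T} (\<lambda>t. ext \<Omega> (u t) - v t)"
      using v by (intro continuous_intros continuous_ext u) (simp add: represents_def)
    have "AE t in time_measure T. u t \<in> H10 \<Omega> \<and> ext \<Omega> (u t) = v t" using v by (simp add: represents_def)
    then show "AE t in time_measure T. ext \<Omega> (u t) - v t \<in> {0}" by eventually_elim simp
  qed simp
  then show ?thesis by simp
qed

lemma weak_solution_stable:
  assumes u: "weak_solution \<Omega> b f T u0 u" "u \<in> continuous_into T (L2 \<Omega>) (L2_norm \<Omega>)"
    and u': "weak_solution \<Omega> b f T u0' u'" "u' \<in> continuous_into T (L2 \<Omega>) (L2_norm \<Omega>)"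
    and L2: "u0 \<in> L2 \<Omega>" "u0' \<in> L2 \<Omega>" and t: "t \<in> {0..T}"
  shows "L2_norm \<Omega> (u t - u' t) \<le> exp (L * T) * L2_norm \<Omega> (u0 - u0')"
proof -
  obtain v v' where v: "represents u v u0" and v': "represents u' v' u0'"
    using u(1) u'(1) weak_solution_representative by meson
  have "u t \<in> L2 \<Omega>" "u' t \<in> L2 \<Omega>" using u(2) u'(2) t by (auto simp: continuous_into_def)
  then show ?thesis
    using represents_stable[OF v v' t] represents_everywhere[OF v u(2) t] represents_everywhere[OF v' u'(2) t] L2
    by (simp add: L2_norm_diff)
qed

end

text \<open>Weak solutions are determined only for almost every time, and this is the sense of
  uniqueness. For u(t) to have a meaning at each single time, existence provides a solution that is
  itself continuous into H, and continuity in \<open>u0\<close> is stated for every selection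
  \<open>S\<close> of such solutions.\<close>

theorem theorem4p1:
  fixes \<Omega> \<Omega>1 \<Omega>2 \<Gamma> :: "(real^'n) set"
    and b :: "real^'n \<Rightarrow> real" and b1 b2 :: real
    and f :: "(real^'n \<Rightarrow> real) \<Rightarrow> (real^'n \<Rightarrow> real)"
    and K T :: real
  assumes dim: "CARD('n) \<ge> 2"
    and domain: "open \<Omega>" "connected \<Omega>" "\<Omega> \<noteq> {}" "compact (closure \<Omega>)"
    and domain1: "open \<Omega>1" "connected \<Omega>1" "\<Omega>1 \<noteq> {}"
    and domain2: "open \<Omega>2" "connected \<Omega>2" "\<Omega>2 \<noteq> {}"
    and interface: "\<Gamma> \<subseteq> \<Omega>" "\<Gamma> = closure \<Omega>1 \<inter> closure \<Omega>2" "\<Omega> = \<Omega>1 \<union> \<Omega>2 \<union> \<Gamma>"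
    and boundaries: "frontier \<Omega>1 = \<Gamma>" "frontier \<Omega>2 = frontier \<Omega> \<union> \<Gamma>"
    and regularity: "C2_hypersurface (frontier \<Omega>)" "C2_hypersurface \<Gamma>"
    and diffusion_pos: "b1 > 0" "b2 > 0"
    and diffusion: "\<And>x. x \<in> closure \<Omega>1 \<Longrightarrow> b x = b1" "\<And>x. x \<in> \<Omega>2 \<Longrightarrow> b x = b2"
    and f_maps: "\<And>u. u \<in> L2 \<Omega> \<Longrightarrow> f u \<in> L2 \<Omega>"
    and f_lipschitz:
      "\<exists>L. \<forall>u\<in>L2 \<Omega>. \<forall>v\<in>L2 \<Omega>. L2_norm \<Omega> (f u - f v) \<le> L * L2_norm \<Omega> (u - v)"
    and K_pos: "K > 0"
    and f_inner: "\<And>u. u \<in> L2 \<Omega> \<Longrightarrow> L2_inner \<Omega> u (f u) \<le> K"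
    and f_bound: "\<And>u. u \<in> L2 \<Omega> \<Longrightarrow> L2_norm \<Omega> (f u) \<le> K"
    and T_pos: "T > 0"
  shows
    "(\<forall>u0\<in>L2 \<Omega>.
        (\<exists>u. weak_solution \<Omega> b f T u0 u \<and> u \<in> continuous_into T (L2 \<Omega>) (L2_norm \<Omega>)) \<and>
        (\<forall>u u'. weak_solution \<Omega> b f T u0 u \<longrightarrow> weak_solution \<Omega> b f T u0 u' \<longrightarrow>
           (AE t in time_measure T. equal_ae \<Omega> (u t) (u' t)))) \<and>
     (\<forall>S. (\<forall>u0\<in>L2 \<Omega>. weak_solution \<Omega> b f T u0 (S u0) \<and>
               S u0 \<in> continuous_into T (L2 \<Omega>) (L2_norm \<Omega>)) \<longrightarrow>
        (\<forall>t\<in>{0..T}. \<forall>u0\<in>L2 \<Omega>. \<forall>e>0. \<exists>d>0. \<forall>v0\<in>L2 \<Omega>.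
           L2_norm \<Omega> (v0 - u0) < d \<longrightarrow> L2_norm \<Omega> (S v0 t - S u0 t) < e))"
proof -
  obtain L0 where L0: "\<And>u v. u \<in> L2 \<Omega> \<Longrightarrow> v \<in> L2 \<Omega> \<Longrightarrow> L2_norm \<Omega> (f u - f v) \<le> L0 * L2_norm \<Omega> (u - v)"
    using f_lipschitz by blast
  \<comment> \<open>The absolute value secures the sign that the Gronwall estimates require.\<close>
  define L where "L = \<bar>L0\<bar>"
  have norm_nonneg: "0 \<le> L2_norm \<Omega> w" for w by (simp add: L2_norm_def L2_inner_def)
  \<comment> \<open>The interface lies in the closure of \<open>\<Omega>1\<close>, so the two cases
    of \<open>b\<close> exhaust the domain and \<open>b\<close> coincides there with a Borel
    function of two values.\<close>
  have cover: "\<Omega> \<subseteq> closure \<Omega>1 \<union> \<Omega>2" using interface(2,3) closure_subset by auto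
  have b_eq: "b x = (if x \<in> closure \<Omega>1 then b1 else b2)" if "x \<in> \<Omega>" for x
    using diffusion cover that by auto
  have "(\<lambda>x. if x \<in> closure \<Omega>1 then b1 else b2) \<in> borel_measurable borel"
    by (intro measurable_If_set) auto
  then have "(\<lambda>x. if x \<in> closure \<Omega>1 then b1 else b2) \<in> borel_measurable (lebesgue_on \<Omega>)"
    by (intro measurable_restrict_space1 measurable_completion) simp
  then have b_meas: "b \<in> borel_measurable (lebesgue_on \<Omega>)"
    by (rule measurable_cong[THEN iffD1, rotated]) (simp add: b_eq)
  interpret semilinear_domain \<Omega> b "min b1 b2" "max b1 b2" f L K T
  proof
    show "L2_norm \<Omega> (f u - f v) \<le> L * L2_norm \<Omega> (u - v)" if "u \<in> L2 \<Omega>" "v \<in> L2 \<Omega>" for u v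
      using L0[OF that] mult_right_mono[OF abs_ge_self[of L0] norm_nonneg[of "u - v"]] by (simp add: L_def)
  qed (use domain(1) b_meas b_eq diffusion_pos f_maps f_bound T_pos in \<open>auto simp: L_def\<close>)
  have cont: "\<exists>d>0. \<forall>v0\<in>L2 \<Omega>. L2_norm \<Omega> (v0 - u0) < d \<longrightarrow> L2_norm \<Omega> (S v0 t - S u0 t) < e"
    if S: "\<And>u0. u0 \<in> L2 \<Omega> \<Longrightarrow> weak_solution \<Omega> b f T u0 (S u0)"
        "\<And>u0. u0 \<in> L2 \<Omega> \<Longrightarrow> S u0 \<in> continuous_into T (L2 \<Omega>) (L2_norm \<Omega>)"
      and t: "t \<in> {0..T}" and u0: "u0 \<in> L2 \<Omega>" and e: "e > 0" for S t u0 e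
  \<comment> \<open>At each time the solution map is Lipschitz in the initial value with constant
    exp(L T).\<close>
  proof (intro exI[of _ "e / exp (L * T)"] conjI ballI impI)
    fix v0 assume v0: "v0 \<in> L2 \<Omega>" "L2_norm \<Omega> (v0 - u0) < e / exp (L * T)"
    have "L2_norm \<Omega> (S v0 t - S u0 t) \<le> exp (L * T) * L2_norm \<Omega> (v0 - u0)"
      by (rule weak_solution_stable[OF S(1,2)[OF v0(1)] S(1,2)[OF u0] v0(1) u0 t])
    also have "\<dots> < e" using v0(2) by (simp add: pos_less_divide_eq mult.commute)
    finally show "L2_norm \<Omega> (S v0 t - S u0 t) < e" .
  qed (use e in simp)
  show ?thesis
    using weak_solution_exists weak_solution_unique cont by blast
qed

end
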